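(* The map $\alpha$ gives an isomorphism from $Z_\gamma^\circ$ to $Y_\gamma^\circ$ as affine algebraic varieties.
   Context: Let $n\ge2$, let $\gamma_1,\dots,\gamma_{n-1}$ be any complex numbers and $\gamma_n=1$. For $1\le i\le n$ let $F_i(z,Q)=\sum_{I\subset\{1,\dots,n\},\,\#I=i}\prod_{j\in I}z_j\prod_{j\in I,\,j+1\notin I}(1-Q_j)$ with $Q_n:=0$. Let $Z_\gamma=\{(z,Q)\in\mathbb{C}^{2n-1}\mid F_i(z,Q)=\gamma_i\ (1\le i\le n)\}$, the affine variety with coordinate ring $\mathbb{C}[z_1,\dots,z_n,Q_1,\dots,Q_{n-1}]/\langle F_i(z,Q)-\gamma_i\ (1\le i\le n)\rangle$, and let $Z_\gamma^\circ\subset Z_\gamma$ be the open subset where $Q_i\ne0$ for all $1\le i\le n-1$. Let $A(z)=\sum_{i=1}^nz_iE_{i,i}-\sum_{i=1}^{n-1}E_{i,i+1}$ and $B(z,Q)=1-\sum_{i=1}^{n-1}Q_iz_iE_{i+1,i}$ ($n\times n$ matrices, $E_{i,j}$ matrix units). A point $(z,Q)$ of $Z_\gamma$ is identified with the matrix $L=AB^{-1}$, whose characteristic polynomial is $\zeta^n+\sum_{i=1}^n(-1)^i\gamma_i\zeta^{n-i}$. Let $f_\gamma(\zeta)=\zeta^n+\sum_{i=1}^n(-1)^i\gamma_i\zeta^{n-i}$ and $\mathscr{O}_\gamma=\mathbb{C}[\zeta]/(f_\gamma(\zeta))$, regarded also as an $n$-dimensional affine space; $\mathbb{P}(\mathscr{O}_\gamma)$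 is its projectivization. Let $\Delta_{1,1}=\Delta_{1,1}(z,Q)$ be the determinant of the matrix obtained from $\zeta B(z,Q)-A(z)$ by deleting the first row and first column; it is a monic polynomial in $\zeta$ of degree $n-1$. The map $\alpha:Z_\gamma\to\mathbb{P}(\mathscr{O}_\gamma)$ sends $(z,Q)$ to $[\Delta_{1,1}(z,Q)]$. Fix a linear isomorphism $c:\mathscr{O}_\gamma\to\mathbb{C}^n$. For $\varphi\in\mathscr{O}_\gamma$ and $0\le j\le n$ let $a_j=c(\zeta^j)$, $b_j=c(\varphi\zeta^j)$, and for $1\le i\le n$ define the $n\times n$ determinants $$T_i(\varphi)=|b_0,\dots,b_{i-1},a_{i-1},\dots,a_{n-2}|,\qquad S_i(\varphi)=|b_0,\dots,b_{i-1},a_i,\dots,a_{n-1}|$$ (for $i=n$ no $a$-columns occur). The choice of $c$ does not affect the non-vanishing of these homogeneous functions. Define the Zariski open set $$Y_\gamma^\circ=\{[\varphi]\in\mathbb{P}(\mathscr{O}_\gamma)\mid T_i(\varphi)\ne0,\ S_i(\varphi)\ne0\ (1\le i\le n)\}.$$ The claim concerns the restriction of $\alpha$ to $Z_\gamma^\circ$. *)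

theory Defs
  imports
    "HOL-Library.Poly_Mapping"
    "HOL-Library.FuncSet"
    "HOL-Computational_Algebra.Polynomial"
    "HOL-Algebra.QuotRing"
    "Jordan_Normal_Form.Determinant"
begin

section \<open>Affine algebraic varieties over the complex numbers\<close>

definition ring_on :: "'a::comm_ring_1 set \<Rightarrow> 'a ring" where
  "ring_on S = \<lparr>carrier = S, monoid.mult = (*), one = 1, zero = 0, add = (+)\<rparr>"

text \<open>Multivariate polynomials: finitely supported functions from monomials to coefficients;
  a monomial is a finitely supported function from variables to exponents.\<close>

type_synonym 'v cpoly = "('v \<Rightarrow>\<^sub>0 nat) \<Rightarrow>\<^sub>0 complex"

definition Const :: "complex \<Rightarrow> 'v cpoly" where
  "Const k = Poly_Mapping.single 0 k"

definition Var :: "'v \<Rightarrow> 'v cpoly" where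
  "Var v = Poly_Mapping.single (Poly_Mapping.single v 1) 1"

definition polys_in :: "'v set \<Rightarrow> 'v cpoly set" where
  "polys_in V = {p. \<forall>m \<in> Poly_Mapping.keys p. Poly_Mapping.keys m \<subseteq> V}"

definition homogeneous :: "nat \<Rightarrow> 'v cpoly \<Rightarrow> bool" where
  "homogeneous d p \<longleftrightarrow> (\<forall>m \<in> Poly_Mapping.keys p.
     (\<Sum>v \<in> Poly_Mapping.keys m. Poly_Mapping.lookup m v) = d)"

definition peval :: "('v \<Rightarrow> complex) \<Rightarrow> 'v cpoly \<Rightarrow> complex" where
  "peval x p = (\<Sum>m \<in> Poly_Mapping.keys p. Poly_Mapping.lookup p m *
     (\<Prod>v \<in> Poly_Mapping.keys m. x v ^ Poly_Mapping.lookup m v))"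

text \<open>An affine variety is given by its set of (closed) points and its coordinate ring, a
  \<open>\<complex>\<close>-algebra with structure map \<open>scalar\<close>; \<open>val f x\<close> is the value of the element \<open>f\<close> of the
  coordinate ring at the point \<open>x\<close>.  The coordinate ring is not presupposed to be reduced,
  so its elements need not be determined by their values.\<close>

record ('p, 'r) affine_variety =
  points :: "'p set"
  coord_ring :: "'r ring"
  scalar :: "complex \<Rightarrow> 'r"
  val :: "'r \<Rightarrow> 'p \<Rightarrow> complex"

text \<open>The map \<open>h\<close> on points is an isomorphism of affine varieties if it is bijective and is
  induced by an isomorphism \<open>\<Phi>\<close> of \<open>\<complex>\<close>-algebras (the comorphism \<open>f \<mapsto> f \<circ> h\<close>) between the
  coordinate rings.\<close>

definition affine_isomorphism ::
  "('p \<Rightarrow> 'q) \<Rightarrow> ('p, 'r) affine_variety \<Rightarrow> ('q, 's) affine_variety \<Rightarrow> bool" where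
  "affine_isomorphism h X Y \<longleftrightarrow>
     bij_betw h (points X) (points Y) \<and>
     (\<exists>\<Phi> \<in> ring_iso (coord_ring Y) (coord_ring X).
        (\<forall>k. \<Phi> (scalar Y k) = scalar X k) \<and>
        (\<forall>f \<in> carrier (coord_ring Y). \<forall>x \<in> points X. val X (\<Phi> f) x = val Y f (h x)))"


section \<open>The varieties \<open>Z\<^sub>\<gamma>\<close> and \<open>Z\<^sub>\<gamma>\<degree>\<close>\<close>

text \<open>Generic over the ring, so that \<open>F\<close> is used both for complex numbers and for polynomials.
  Indices run from 1; the convention \<open>Q\<^sub>n = 0\<close> is built in.\<close>

definition F :: "nat \<Rightarrow> nat \<Rightarrow> (nat \<Rightarrow> 'a::comm_ring_1) \<Rightarrow> (nat \<Rightarrow> 'a) \<Rightarrow> 'a" where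
  "F n i z Q = (\<Sum>I | I \<subseteq> {1..n} \<and> card I = i.
     (\<Prod>j\<in>I. z j) * (\<Prod>j | j \<in> I \<and> j + 1 \<notin> I. 1 - (if j = n then 0 else Q j)))"

text \<open>\<open>\<complex>\<^bsup>2n-1\<^esup>\<close>, with coordinates \<open>z\<^sub>1, \<dots>, z\<^sub>n\<close> and \<open>Q\<^sub>1, \<dots>, Q\<^bsub>n-1\<^esub>\<close>.\<close>

definition affine_space_zQ :: "nat \<Rightarrow> ((nat \<Rightarrow> complex) \<times> (nat \<Rightarrow> complex)) set" where
  "affine_space_zQ n = ({1..n} \<rightarrow>\<^sub>E UNIV) \<times> ({1..n-1} \<rightarrow>\<^sub>E UNIV)"

definition Z_points ::
  "nat \<Rightarrow> (nat \<Rightarrow> complex) \<Rightarrow> ((nat \<Rightarrow> complex) \<times> (nat \<Rightarrow> complex)) set" where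
  "Z_points n \<gamma> = {(z, Q) \<in> affine_space_zQ n. \<forall>i\<in>{1..n}. F n i z Q = \<gamma> i}"

definition Zo_points ::
  "nat \<Rightarrow> (nat \<Rightarrow> complex) \<Rightarrow> ((nat \<Rightarrow> complex) \<times> (nat \<Rightarrow> complex)) set" where
  "Zo_points n \<gamma> = {(z, Q) \<in> Z_points n \<gamma>. \<forall>i\<in>{1..n-1}. Q i \<noteq> 0}"

text \<open>The coordinate ring of \<open>Z\<^sub>\<gamma>\<degree>\<close> is the localization of
  \<open>\<complex>[z, Q] / \<langle>F\<^sub>i(z,Q) - \<gamma>\<^sub>i\<rangle>\<close> at \<open>Q\<^sub>1 \<cdots> Q\<^bsub>n-1\<^esub>\<close>, presented with an additional variable
  \<open>U\<close> that inverts this product: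
  \<open>\<complex>[z, Q, U] / \<langle>F\<^sub>i(z,Q) - \<gamma>\<^sub>i, U Q\<^sub>1 \<cdots> Q\<^bsub>n-1\<^esub> - 1\<rangle>\<close>.\<close>

datatype zQ_var = Zv nat | Qv nat | Uv

definition zQU_ring :: "nat \<Rightarrow> zQ_var cpoly ring" where
  "zQU_ring n = ring_on (polys_in (Zv ` {1..n} \<union> Qv ` {1..n-1} \<union> {Uv}))"

definition Zo_ideal :: "nat \<Rightarrow> (nat \<Rightarrow> complex) \<Rightarrow> zQ_var cpoly set" where
  "Zo_ideal n \<gamma> = genideal (zQU_ring n)
     ({F n i (\<lambda>j. Var (Zv j)) (\<lambda>j. Var (Qv j)) - Const (\<gamma> i) | i. i \<in> {1..n}}
      \<union> {Var Uv * (\<Prod>j\<in>{1..n-1}. Var (Qv j)) - 1})"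

fun zQU_assignment :: "nat \<Rightarrow> (nat \<Rightarrow> complex) \<times> (nat \<Rightarrow> complex) \<Rightarrow> zQ_var \<Rightarrow> complex" where
  "zQU_assignment n (z, Q) (Zv i) = z i"
| "zQU_assignment n (z, Q) (Qv i) = Q i"
| "zQU_assignment n (z, Q) Uv = inverse (\<Prod>j\<in>{1..n-1}. Q j)"

text \<open>All polynomials in a residue class take the same value at a point of \<open>Z\<^sub>\<gamma>\<degree>\<close>.\<close>

definition Zo_variety :: "nat \<Rightarrow> (nat \<Rightarrow> complex) \<Rightarrow>
    ((nat \<Rightarrow> complex) \<times> (nat \<Rightarrow> complex), zQ_var cpoly set) affine_variety" where
  "Zo_variety n \<gamma> =
     \<lparr>points = Zo_points n \<gamma>,
      coord_ring = zQU_ring n Quot Zo_ideal n \<gamma>,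
      scalar = (\<lambda>k. Zo_ideal n \<gamma> +>\<^bsub>zQU_ring n\<^esub> Const k),
      val = (\<lambda>C x. the_elem (peval (zQU_assignment n x) ` C))\<rparr>"


section \<open>The algebra \<open>\<O>\<^sub>\<gamma>\<close>, its projectivization and \<open>Y\<^sub>\<gamma>\<degree>\<close>\<close>

definition f_poly :: "nat \<Rightarrow> (nat \<Rightarrow> complex) \<Rightarrow> complex poly" where
  "f_poly n \<gamma> = Polynomial.monom 1 n
     + (\<Sum>i\<in>{1..n}. Polynomial.monom ((-1) ^ i * \<gamma> i) (n - i))"

definition f_ideal :: "nat \<Rightarrow> (nat \<Rightarrow> complex) \<Rightarrow> complex poly set" where
  "f_ideal n \<gamma> = genideal (ring_on UNIV) {f_poly n \<gamma>}"

definition O_alg :: "nat \<Rightarrow> (nat \<Rightarrow> complex) \<Rightarrow> complex poly set ring" where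
  "O_alg n \<gamma> = ring_on UNIV Quot f_ideal n \<gamma>"

definition residue_class :: "nat \<Rightarrow> (nat \<Rightarrow> complex) \<Rightarrow> complex poly \<Rightarrow> complex poly set" where
  "residue_class n \<gamma> p = f_ideal n \<gamma> +>\<^bsub>ring_on UNIV\<^esub> p"

definition scale_O ::
  "nat \<Rightarrow> (nat \<Rightarrow> complex) \<Rightarrow> complex \<Rightarrow> complex poly set \<Rightarrow> complex poly set" where
  "scale_O n \<gamma> k \<phi> = residue_class n \<gamma> [:k:] \<otimes>\<^bsub>O_alg n \<gamma>\<^esub> \<phi>"

definition is_linear_iso ::
  "nat \<Rightarrow> (nat \<Rightarrow> complex) \<Rightarrow> (complex poly set \<Rightarrow> complex vec) \<Rightarrow> bool" where
  "is_linear_iso n \<gamma> c \<longleftrightarrow>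
     bij_betw c (carrier (O_alg n \<gamma>)) (carrier_vec n) \<and>
     (\<forall>\<phi>\<in>carrier (O_alg n \<gamma>). \<forall>\<psi>\<in>carrier (O_alg n \<gamma>).
        c (\<phi> \<oplus>\<^bsub>O_alg n \<gamma>\<^esub> \<psi>) = c \<phi> + c \<psi>) \<and>
     (\<forall>k. \<forall>\<phi>\<in>carrier (O_alg n \<gamma>). c (scale_O n \<gamma> k \<phi>) = k \<cdot>\<^sub>v c \<phi>)"

text \<open>The point \<open>[\<phi>]\<close> of projective space is the line spanned by \<open>\<phi>\<close>, for \<open>\<phi> \<noteq> 0\<close>.\<close>

definition line :: "nat \<Rightarrow> (nat \<Rightarrow> complex) \<Rightarrow> complex poly set \<Rightarrow> complex poly set set" where
  "line n \<gamma> \<phi> = {scale_O n \<gamma> k \<phi> | k. True}"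

definition proj_O :: "nat \<Rightarrow> (nat \<Rightarrow> complex) \<Rightarrow> complex poly set set set" where
  "proj_O n \<gamma> = {line n \<gamma> \<phi> | \<phi>. \<phi> \<in> carrier (O_alg n \<gamma>) \<and> \<phi> \<noteq> \<zero>\<^bsub>O_alg n \<gamma>\<^esub>}"

definition a_col ::
  "nat \<Rightarrow> (nat \<Rightarrow> complex) \<Rightarrow> (complex poly set \<Rightarrow> complex vec) \<Rightarrow> nat \<Rightarrow> complex vec" where
  "a_col n \<gamma> c j = c (residue_class n \<gamma> (Polynomial.monom 1 j))"

definition b_col :: "nat \<Rightarrow> (nat \<Rightarrow> complex) \<Rightarrow> (complex poly set \<Rightarrow> complex vec) \<Rightarrow>
    complex poly set \<Rightarrow> nat \<Rightarrow> complex vec" where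
  "b_col n \<gamma> c \<phi> j = c (\<phi> \<otimes>\<^bsub>O_alg n \<gamma>\<^esub> residue_class n \<gamma> (Polynomial.monom 1 j))"

definition T :: "nat \<Rightarrow> (nat \<Rightarrow> complex) \<Rightarrow> (complex poly set \<Rightarrow> complex vec) \<Rightarrow>
    nat \<Rightarrow> complex poly set \<Rightarrow> complex" where
  "T n \<gamma> c i \<phi> = det (mat_of_cols n
     (map (b_col n \<gamma> c \<phi>) [0..<i] @ map (a_col n \<gamma> c) [i-1..<n-1]))"

definition S :: "nat \<Rightarrow> (nat \<Rightarrow> complex) \<Rightarrow> (complex poly set \<Rightarrow> complex vec) \<Rightarrow>
    nat \<Rightarrow> complex poly set \<Rightarrow> complex" where
  "S n \<gamma> c i \<phi> = det (mat_of_cols n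
     (map (b_col n \<gamma> c \<phi>) [0..<i] @ map (a_col n \<gamma> c) [i..<n]))"

definition Yo_points :: "nat \<Rightarrow> (nat \<Rightarrow> complex) \<Rightarrow> (complex poly set \<Rightarrow> complex vec) \<Rightarrow>
    complex poly set set set" where
  "Yo_points n \<gamma> c = {p \<in> proj_O n \<gamma>. \<exists>\<phi>\<in>carrier (O_alg n \<gamma>). p = line n \<gamma> \<phi> \<and>
     (\<forall>i\<in>{1..n}. T n \<gamma> c i \<phi> \<noteq> 0 \<and> S n \<gamma> c i \<phi> \<noteq> 0)}"

text \<open>\<open>Y\<^sub>\<gamma>\<degree>\<close> is the principal open subset of \<open>\<P>(\<O>\<^sub>\<gamma>)\<close> where the homogeneous polynomial
  \<open>D = T\<^sub>1 S\<^sub>1 \<cdots> T\<^sub>n S\<^sub>n\<close> does not vanish.  Both \<open>T\<^sub>i\<close> and \<open>S\<^sub>i\<close> have degree \<open>i\<close>, so \<open>D\<close> has degree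
  \<open>n (n + 1)\<close>.  The coordinate ring consists of the functions \<open>G / D\<^sup>N\<close> with \<open>G\<close> homogeneous of
  degree \<open>N n (n + 1)\<close> in the linear coordinates \<open>c\<close> on \<open>\<O>\<^sub>\<gamma>\<close>.\<close>

definition Yo_functions :: "nat \<Rightarrow> (nat \<Rightarrow> complex) \<Rightarrow> (complex poly set \<Rightarrow> complex vec) \<Rightarrow>
    (complex poly set set \<Rightarrow> complex) set" where
  "Yo_functions n \<gamma> c = {f \<in> extensional (Yo_points n \<gamma> c).
     \<exists>N. \<exists>G \<in> polys_in {0..<n}. homogeneous (N * (n * (n + 1))) G \<and>
       (\<forall>\<phi>\<in>carrier (O_alg n \<gamma>). line n \<gamma> \<phi> \<in> Yo_points n \<gamma> c \<longrightarrow>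
          f (line n \<gamma> \<phi>) =
            peval (\<lambda>j. c \<phi> $ j) G / (\<Prod>i\<in>{1..n}. T n \<gamma> c i \<phi> * S n \<gamma> c i \<phi>) ^ N)}"

definition Yo_variety :: "nat \<Rightarrow> (nat \<Rightarrow> complex) \<Rightarrow> (complex poly set \<Rightarrow> complex vec) \<Rightarrow>
    (complex poly set set, complex poly set set \<Rightarrow> complex) affine_variety" where
  "Yo_variety n \<gamma> c =
     \<lparr>points = Yo_points n \<gamma> c,
      coord_ring =
        \<lparr>carrier = Yo_functions n \<gamma> c,
         monoid.mult = (\<lambda>f g. restrict (\<lambda>y. f y * g y) (Yo_points n \<gamma> c)),
         one = restrict (\<lambda>y. 1) (Yo_points n \<gamma> c),
         zero = restrict (\<lambda>y. 0) (Yo_points n \<gamma> c),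
         add = (\<lambda>f g. restrict (\<lambda>y. f y + g y) (Yo_points n \<gamma> c))\<rparr>,
      scalar = (\<lambda>k. restrict (\<lambda>y. k) (Yo_points n \<gamma> c)),
      val = (\<lambda>f y. f y)\<rparr>"


section \<open>The map \<open>\<alpha>\<close>\<close>

text \<open>Matrix indices start at 0: the entry at \<open>(i, j)\<close> is the coefficient of
  \<open>E\<^bsub>i+1,j+1\<^esub>\<close>.\<close>

definition A_mat :: "nat \<Rightarrow> (nat \<Rightarrow> complex) \<Rightarrow> complex mat" where
  "A_mat n z = mat n n (\<lambda>(i, j). if i = j then z (i + 1) else if j = i + 1 then -1 else 0)"

definition B_mat :: "nat \<Rightarrow> (nat \<Rightarrow> complex) \<Rightarrow> (nat \<Rightarrow> complex) \<Rightarrow> complex mat" where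
  "B_mat n z Q = mat n n (\<lambda>(i, j). if i = j then 1
     else if i = j + 1 then - (Q (j + 1) * z (j + 1)) else 0)"

definition Delta11 :: "nat \<Rightarrow> (nat \<Rightarrow> complex) \<Rightarrow> (nat \<Rightarrow> complex) \<Rightarrow> complex poly" where
  "Delta11 n z Q = det (mat_delete
     (Polynomial.monom 1 1 \<cdot>\<^sub>m map_mat (\<lambda>k. [:k:]) (B_mat n z Q)
       - map_mat (\<lambda>k. [:k:]) (A_mat n z)) 0 0)"

definition \<alpha> :: "nat \<Rightarrow> (nat \<Rightarrow> complex) \<Rightarrow> (nat \<Rightarrow> complex) \<times> (nat \<Rightarrow> complex) \<Rightarrow>
    complex poly set set" where
  "\<alpha> n \<gamma> = (\<lambda>(z, Q). line n \<gamma> (residue_class n \<gamma> (Delta11 n z Q)))"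

end

theory Submission
  imports Defs
begin

text \<open>
The matrix \<open>\<zeta>B - A\<close> is tridiagonal, so its trailing principal minors \<open>p\<^sub>k\<close> (delete the first \<open>k\<close> rows
and columns) satisfy the three-term recursion
\<open>p\<^bsub>k-1\<^esub> = (\<zeta> - z\<^sub>k) p\<^sub>k + Q\<^sub>k z\<^sub>k \<zeta> p\<^bsub>k+1\<^esub>\<close>, with \<open>p\<^sub>0 = f\<close> on \<open>Z\<^sub>\<gamma>\<close> and \<open>p\<^sub>1 = \<Delta>\<^sub>1\<^sub>1\<close>.  The map \<open>\<alpha>\<close> thus sends
\<open>(z, Q)\<close> to a fraction \<open>\<Delta>\<^sub>1\<^sub>1 / f\<close>, and \<open>(z, Q)\<close> are the coefficients of its expansion into a continued
fraction.  The theorem says that \<open>S\<close> and \<open>T\<close> are the determinants that control this expansion, just as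
Hankel determinants control the expansion into a classical continued fraction.

The link is the congruence \<open>R\<^sub>k \<Delta>\<^sub>1\<^sub>1 \<equiv> \<plusminus>(\<Prod>\<^bsub>j\<le>k\<^esub> Q\<^sub>j z\<^sub>j) \<zeta>\<^sup>k p\<^bsub>k+1\<^esub>\<close> modulo \<open>f\<close>, in which \<open>R\<^sub>k\<close> is the
leading principal minor of size \<open>k\<close>, monic of degree \<open>k\<close> (\<open>lead_poly_times_tail\<close>).  It writes the
column \<open>b\<^sub>k\<close> in terms of the other columns of the matrix of \<open>S\<^sub>k\<close>, and Cramer's rule
turns the constant term and the leading coefficient of \<open>p\<^bsub>k+1\<^esub>\<close>, multiplied by
\<open>\<plusminus>\<Prod>\<^bsub>j\<le>k\<^esub> Q\<^sub>j z\<^sub>j\<close>, into the quotients \<open>S\<^bsub>k+1\<^esub> / S\<^sub>k\<close> and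
\<open>T\<^bsub>k+1\<^esub> / S\<^sub>k\<close> (\<open>det_division_step\<close>).  Hence, with \<open>c\<^sub>k = \<Prod>\<^bsub>j\<le>k\<^esub> Q\<^sub>j z\<^sub>j\<close>,
\<open>T\<^sub>i = (-1)\<^bsup>n-1\<^esup> c\<^bsub>i-1\<^esub> S\<^bsub>i-1\<^esub>\<close> and \<open>S\<^sub>i = z\<^bsub>i+1\<^esub> \<cdots> z\<^sub>n T\<^sub>i\<close> (\<open>tail_S_T\<close>).  As \<open>z\<^sub>1 \<cdots> z\<^sub>n = 1\<close> on \<open>Z\<^sub>\<gamma>\<close>, this gives the
inverse of \<open>\<alpha>\<close>, if \<open>S\<close> and \<open>T\<close> are taken in the basis \<open>1, \<zeta>, \<dots>, \<zeta>\<^bsup>n-1\<^esup>\<close> and \<open>S\<^sub>0 = T\<^sub>0 = 1\<close>: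
\<open>z\<^sub>i = S\<^bsub>i-1\<^esub> T\<^sub>i / (T\<^bsub>i-1\<^esub> S\<^sub>i)\<close> and \<open>Q\<^sub>i = T\<^bsub>i+1\<^esub> T\<^bsub>i-1\<^esub> / T\<^sub>i\<^sup>2\<close>; moreover
\<open>1 / (Q\<^sub>1 \<cdots> Q\<^bsub>n-1\<^esub>) = T\<^sub>1 T\<^bsub>n-1\<^esub> / T\<^sub>n\<close>.  Conversely, if no \<open>S\<^sub>i\<close> and no \<open>T\<^sub>i\<close> vanishes at \<open>\<phi>\<close>, the division
process that produces the continued fraction of \<open>\<phi> / f\<close> never breaks down
(\<open>continued_fraction_exists\<close>), so \<open>\<alpha>\<close> is onto \<open>Y\<^sub>\<gamma>\<degree>\<close>.

Bijectivity on points does not suffice, because the coordinate ring of \<open>Z\<^sub>\<gamma>\<degree>\<close> is a quotient by an ideal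
that is not known to be radical.  Therefore the formulas for \<open>S\<^sub>i\<close> and \<open>T\<^sub>i\<close> are proved over an arbitrary commutative
ring and applied to the variables themselves: the coefficients of the polynomial \<open>\<Delta>\<^sub>1\<^sub>1\<close> formed from the
variables \<open>z\<^sub>i\<close>, \<open>Q\<^sub>i\<close> constitute a universal point, at which the product \<open>D\<close> of all \<open>S\<^sub>i\<close> and \<open>T\<^sub>i\<close>
is a unit modulo the ideal.  By the formulas for \<open>z\<^sub>i\<close>, \<open>Q\<^sub>i\<close> and \<open>U\<close>, every polynomial \<open>p\<close> in these
variables satisfies \<open>D\<^sup>N p \<equiv> G\<close> at the universal point, for some form \<open>G\<close> of the same degree as \<open>D\<^sup>N\<close>
(\<open>fraction_polys_in\<close>).  This exhibits \<open>p\<close> as the regular function \<open>G / D\<^sup>N\<close> on \<open>Y\<^sub>\<gamma>\<degree>\<close>.  If \<open>p\<close> vanishes at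
all points of \<open>Z\<^sub>\<gamma>\<degree>\<close>, then \<open>G D\<close> vanishes on the whole affine space and is the zero polynomial;
substituting the universal point gives \<open>D\<^bsup>N+1\<^esup> p \<equiv> 0\<close>, so \<open>p\<close> lies in the ideal
(\<open>vanishing_imp_cong_0\<close>).  So both coordinate rings consist of the same functions.
\<close>

section \<open>Polynomials in several variables\<close>

subsection \<open>Evaluation\<close>

text \<open>The scalars pass through a homomorphism \<open>h\<close>, so that the same construction gives the value
\<open>peval\<close> at a complex point and the substitution of polynomials for the variables.\<close>

definition eval_via :: "(complex \<Rightarrow> 'a::comm_ring_1) \<Rightarrow> ('v \<Rightarrow> 'a) \<Rightarrow> 'v cpoly \<Rightarrow> 'a" where
  "eval_via h x p = (\<Sum>m \<in> Poly_Mapping.keys p. h (Poly_Mapping.lookup p m) *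
     (\<Prod>v \<in> Poly_Mapping.keys m. x v ^ Poly_Mapping.lookup m v))"

lemma peval_eq_eval_via: "peval = eval_via (\<lambda>k. k)"
  by (simp add: fun_eq_iff peval_def eval_via_def)

lemma monomial_prod_superset:
  assumes "finite A" "Poly_Mapping.keys m \<subseteq> A"
  shows "(\<Prod>v \<in> Poly_Mapping.keys m. x v ^ Poly_Mapping.lookup m v)
       = (\<Prod>v \<in> A. (x v :: 'a::comm_ring_1) ^ Poly_Mapping.lookup m v)"
  using assms by (intro prod.mono_neutral_left) (auto simp: in_keys_iff)

lemma monomial_prod_add:
  "(\<Prod>v \<in> Poly_Mapping.keys (m + m'). (x v :: 'a::comm_ring_1) ^ Poly_Mapping.lookup (m + m') v)
   = (\<Prod>v \<in> Poly_Mapping.keys m. x v ^ Poly_Mapping.lookup m v)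
   * (\<Prod>v \<in> Poly_Mapping.keys m'. x v ^ Poly_Mapping.lookup m' v)"
proof -
  let ?A = "Poly_Mapping.keys m \<union> Poly_Mapping.keys m'"
  have eq: "(\<Prod>v \<in> Poly_Mapping.keys q. x v ^ Poly_Mapping.lookup q v) = (\<Prod>v \<in> ?A. x v ^ Poly_Mapping.lookup q v)"
    if "Poly_Mapping.keys q \<subseteq> ?A" for q
    using that by (intro monomial_prod_superset) auto
  show ?thesis
    unfolding eq[OF Poly_Mapping.keys_add] eq[OF Un_upper1] eq[OF Un_upper2]
    by (simp add: lookup_add power_add prod.distrib)
qed

context
  fixes h :: "complex \<Rightarrow> 'a::comm_ring_1"
  assumes h: "comm_ring_hom h"
begin

interpretation h: comm_ring_hom h by (rule h)

lemma eval_via_superset: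
  assumes "finite A" "Poly_Mapping.keys p \<subseteq> A"
  shows "eval_via h x p = (\<Sum>m \<in> A. h (Poly_Mapping.lookup p m) *
     (\<Prod>v \<in> Poly_Mapping.keys m. x v ^ Poly_Mapping.lookup m v))"
  unfolding eval_via_def using assms
  by (intro sum.mono_neutral_left) (auto simp: in_keys_iff)

lemma eval_via_add: "eval_via h x (p + q) = eval_via h x p + eval_via h x q"
proof -
  let ?A = "Poly_Mapping.keys p \<union> Poly_Mapping.keys q"
  have "Poly_Mapping.keys (p + q) \<subseteq> ?A" by (rule Poly_Mapping.keys_add)
  then show ?thesis
    by (simp add: eval_via_superset[of ?A] lookup_add h.hom_add distrib_right sum.distrib)
qed

lemma eval_via_0: "eval_via h x 0 = 0"
  by (simp add: eval_via_def)

lemma eval_via_sum: "eval_via h x (sum f A) = (\<Sum>i\<in>A. eval_via h x (f i))"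
  by (induction A rule: infinite_finite_induct) (simp_all add: eval_via_0 eval_via_add)

lemma eval_via_single:
  "eval_via h x (Poly_Mapping.single m k)
     = h k * (\<Prod>v \<in> Poly_Mapping.keys m. x v ^ Poly_Mapping.lookup m v)"
  by (cases "k = 0") (simp_all add: eval_via_def)

end

lemma cpoly_sum_monomials:
  "p = (\<Sum>m \<in> Poly_Mapping.keys p. Poly_Mapping.single m (Poly_Mapping.lookup p m))"
  for p :: "'v cpoly"
proof (rule poly_mapping_eqI)
  fix k
  have "Poly_Mapping.lookup (\<Sum>m \<in> Poly_Mapping.keys p. Poly_Mapping.single m (Poly_Mapping.lookup p m)) k
      = (\<Sum>m \<in> Poly_Mapping.keys p. if m = k then Poly_Mapping.lookup p m else 0)"
    by (simp add: lookup_sum lookup_single when_def)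
  also have "\<dots> = Poly_Mapping.lookup p k"
    by (simp add: in_keys_iff)
  finally show "Poly_Mapping.lookup p k = Poly_Mapping.lookup (\<Sum>m \<in> Poly_Mapping.keys p. Poly_Mapping.single m (Poly_Mapping.lookup p m)) k" ..
qed

lemma eval_via_mult:
  assumes h: "comm_ring_hom h"
  shows "eval_via h x (p * q) = eval_via h x p * eval_via h x q"
proof -
  interpret h: comm_ring_hom h by (rule h)
  let ?s = "\<lambda>p m. Poly_Mapping.single m (Poly_Mapping.lookup p m)"
  have "eval_via h x (p * q)
      = eval_via h x ((\<Sum>m \<in> Poly_Mapping.keys p. ?s p m) * (\<Sum>m \<in> Poly_Mapping.keys q. ?s q m))"
    by (simp flip: cpoly_sum_monomials)
  also have "\<dots> = (\<Sum>m \<in> Poly_Mapping.keys p. \<Sum>m' \<in> Poly_Mapping.keys q.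
      eval_via h x (?s p m) * eval_via h x (?s q m'))"
    by (simp add: sum_product eval_via_sum[OF h] eval_via_single[OF h] mult_single h.hom_mult
        monomial_prod_add algebra_simps)
  also have "\<dots> = eval_via h x p * eval_via h x q"
    unfolding eval_via_single[OF h] by (simp add: sum_product eval_via_def)
  finally show ?thesis .
qed

lemma eval_via_hom:
  assumes h: "comm_ring_hom h"
  shows "comm_ring_hom (eval_via h x)"
proof -
  interpret h: comm_ring_hom h by (rule h)
  show ?thesis
  proof
    show "eval_via h x 1 = 1"
      using eval_via_single[OF h, of x 0 1] by (simp add: h.hom_one)
  qed (simp_all add: eval_via_0[OF h] eval_via_add[OF h] eval_via_mult[OF h])
qed

lemma eval_via_Const:
  assumes "comm_ring_hom h" shows "eval_via h x (Const k) = h k"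
  by (simp add: Const_def eval_via_single[OF assms])

lemma eval_via_Var:
  assumes "comm_ring_hom h" shows "eval_via h x (Var v) = x v"
proof -
  interpret h: comm_ring_hom h by (rule assms)
  show ?thesis by (simp add: Var_def eval_via_single[OF assms] h.hom_one)
qed

lemma hom_eval_via:
  assumes "comm_ring_hom g"
  shows "g (eval_via h x p) = eval_via (g \<circ> h) (g \<circ> x) p"
proof -
  interpret g: comm_ring_hom g by (rule assms)
  show ?thesis by (simp add: eval_via_def hom_distribs)
qed

lemma eval_via_cong:
  assumes "p \<in> polys_in V" "\<And>v. v \<in> V \<Longrightarrow> x v = y v"
  shows "eval_via h x p = eval_via h y p"
  unfolding eval_via_def
proof (rule sum.cong)
  fix m assume "m \<in> Poly_Mapping.keys p"
  then have "Poly_Mapping.keys m \<subseteq> V" using assms(1) by (auto simp: polys_in_def)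
  then have "(\<Prod>v\<in>Poly_Mapping.keys m. x v ^ Poly_Mapping.lookup m v)
      = (\<Prod>v\<in>Poly_Mapping.keys m. y v ^ Poly_Mapping.lookup m v)"
    using assms(2) by (intro prod.cong) auto
  then show "h (Poly_Mapping.lookup p m) * (\<Prod>v\<in>Poly_Mapping.keys m. x v ^ Poly_Mapping.lookup m v)
      = h (Poly_Mapping.lookup p m) * (\<Prod>v\<in>Poly_Mapping.keys m. y v ^ Poly_Mapping.lookup m v)"
    by simp
qed simp

lemma identity_hom: "comm_ring_hom (\<lambda>k :: 'a::comm_ring_1. k)"
  by unfold_locales simp_all

lemma Const_hom: "comm_ring_hom (Const :: complex \<Rightarrow> 'v cpoly)"
  by unfold_locales (simp_all add: Const_def single_add mult_single)

interpretation Const: comm_ring_hom "Const :: complex \<Rightarrow> 'v cpoly" by (rule Const_hom)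

lemma peval_hom: "comm_ring_hom (peval x)"
  unfolding peval_eq_eval_via by (intro eval_via_hom identity_hom)

subsection \<open>Polynomials in a given set of variables\<close>

lemma polys_in_add: "p \<in> polys_in V \<Longrightarrow> q \<in> polys_in V \<Longrightarrow> p + q \<in> polys_in V"
  unfolding polys_in_def using Poly_Mapping.keys_add[of p q] by blast

lemma polys_in_mult: "p \<in> polys_in V \<Longrightarrow> q \<in> polys_in V \<Longrightarrow> p * q \<in> polys_in V"
proof (unfold polys_in_def, intro CollectI ballI)
  fix m assume "p \<in> {p. \<forall>m\<in>Poly_Mapping.keys p. Poly_Mapping.keys m \<subseteq> V}"
    "q \<in> {p. \<forall>m\<in>Poly_Mapping.keys p. Poly_Mapping.keys m \<subseteq> V}" "m \<in> Poly_Mapping.keys (p * q)"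
  moreover from this obtain a b where "m = a + b" "a \<in> Poly_Mapping.keys p" "b \<in> Poly_Mapping.keys q"
    using Poly_Mapping.keys_mult[of p q] by blast
  ultimately show "Poly_Mapping.keys m \<subseteq> V"
    using Poly_Mapping.keys_add[of a b] by blast
qed

lemma polys_in_Const: "Const k \<in> polys_in V"
  by (simp add: polys_in_def Const_def)

lemma polys_in_Var: "v \<in> V \<Longrightarrow> Var v \<in> polys_in V"
  by (simp add: polys_in_def Var_def)

lemma polys_in_0: "0 \<in> polys_in V" and polys_in_1: "1 \<in> polys_in V"
  using polys_in_Const[of 0 V] polys_in_Const[of 1 V] by simp_all

lemma polys_in_uminus: "p \<in> polys_in V \<Longrightarrow> - p \<in> polys_in V"
  by (simp add: polys_in_def in_keys_iff)

lemma polys_in_diff: "p \<in> polys_in V \<Longrightarrow> q \<in> polys_in V \<Longrightarrow> p - q \<in> polys_in V"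
  using polys_in_add[of p V "- q"] polys_in_uminus[of q V] by simp

lemma polys_in_sum: "(\<And>i. i \<in> A \<Longrightarrow> f i \<in> polys_in V) \<Longrightarrow> sum f A \<in> polys_in V"
  by (induction A rule: infinite_finite_induct) (simp_all add: polys_in_0 polys_in_add)

lemma polys_in_prod: "(\<And>i. i \<in> A \<Longrightarrow> f i \<in> polys_in V) \<Longrightarrow> prod f A \<in> polys_in V"
  by (induction A rule: infinite_finite_induct) (simp_all add: polys_in_1 polys_in_mult)

lemma polys_in_power: "p \<in> polys_in V \<Longrightarrow> p ^ k \<in> polys_in V"
  by (induction k) (simp_all add: polys_in_1 polys_in_mult)

lemmas polys_in_intros = polys_in_add polys_in_mult polys_in_Const polys_in_Var polys_in_0 polys_in_1
  polys_in_uminus polys_in_diff polys_in_sum polys_in_prod polys_in_power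

lemma single_monomial_eq_prod:
  "Poly_Mapping.single m k
     = Const k * (\<Prod>v \<in> Poly_Mapping.keys m. Var v ^ Poly_Mapping.lookup m v)"
proof -
  have Var_power: "Var v ^ e = Poly_Mapping.single (Poly_Mapping.single v e) 1" for v :: 'v and e
    by (induction e) (simp_all add: Var_def mult_single single_add[symmetric])
  have "(\<Prod>v \<in> A. Var v ^ Poly_Mapping.lookup m v)
      = Poly_Mapping.single (\<Sum>v \<in> A. Poly_Mapping.single v (Poly_Mapping.lookup m v)) 1"
    if "finite A" for A
    using that by (induction A) (simp_all add: Var_power mult_single)
  moreover have "m = (\<Sum>v \<in> Poly_Mapping.keys m. Poly_Mapping.single v (Poly_Mapping.lookup m v))"
    by (rule poly_mapping_eqI) (simp add: lookup_sum lookup_single when_def in_keys_iff)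
  ultimately show ?thesis by (simp add: Const_def mult_single)
qed

text \<open>A property that is closed under the ring operations and holds for constants and variables holds for
all polynomials.\<close>

lemma polys_in_induct [consumes 1, case_names Const Var add mult]:
  assumes p: "p \<in> polys_in V"
    and Const: "\<And>k. P (Const k)" and Var: "\<And>v. v \<in> V \<Longrightarrow> P (Var v)"
    and add: "\<And>p q. P p \<Longrightarrow> P q \<Longrightarrow> P (p + q)" and mult: "\<And>p q. P p \<Longrightarrow> P q \<Longrightarrow> P (p * q)"
  shows "P p"
proof -
  have P0: "P 0" and P1: "P 1" using Const[of 0] Const[of 1] by simp_all
  have pw: "P (q ^ e)" if "P q" for q e
    using that by (induction e) (simp_all add: P1 mult)
  have pr: "P (prod f A)" if "\<And>i. i \<in> A \<Longrightarrow> P (f i)" for f and A :: "'a set"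
    using that by (induction A rule: infinite_finite_induct) (simp_all add: P1 mult)
  have sm: "P (sum f A)" if "\<And>i. i \<in> A \<Longrightarrow> P (f i)" for f and A :: "('a \<Rightarrow>\<^sub>0 nat) set"
    using that by (induction A rule: infinite_finite_induct) (simp_all add: P0 add)
  have "P (\<Sum>m \<in> Poly_Mapping.keys p. Poly_Mapping.single m (Poly_Mapping.lookup p m))"
  proof (rule sm)
    fix m assume "m \<in> Poly_Mapping.keys p"
    then have "Poly_Mapping.keys m \<subseteq> V" using p by (auto simp: polys_in_def)
    then show "P (Poly_Mapping.single m (Poly_Mapping.lookup p m))"
      unfolding single_monomial_eq_prod by (intro mult Const pr pw Var) auto
  qed
  then show ?thesis by (simp flip: cpoly_sum_monomials)
qed

subsection \<open>Homogeneous polynomials\<close>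

definition mdeg :: "('v \<Rightarrow>\<^sub>0 nat) \<Rightarrow> nat" where
  "mdeg m = (\<Sum>v \<in> Poly_Mapping.keys m. Poly_Mapping.lookup m v)"

lemma homogeneous_iff: "homogeneous d p \<longleftrightarrow> (\<forall>m \<in> Poly_Mapping.keys p. mdeg m = d)"
  by (simp add: homogeneous_def mdeg_def)

lemma mdeg_add: "mdeg (m + m') = mdeg m + mdeg m'"
proof -
  let ?A = "Poly_Mapping.keys m \<union> Poly_Mapping.keys m'"
  have "mdeg q = (\<Sum>v \<in> ?A. Poly_Mapping.lookup q v)" if "Poly_Mapping.keys q \<subseteq> ?A" for q
    unfolding mdeg_def using that by (intro sum.mono_neutral_left) (auto simp: in_keys_iff)
  then show ?thesis
    using Poly_Mapping.keys_add[of m m'] by (simp add: lookup_add sum.distrib)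
qed

lemma homogeneous_add: "homogeneous d p \<Longrightarrow> homogeneous d q \<Longrightarrow> homogeneous d (p + q)"
  unfolding homogeneous_iff using Poly_Mapping.keys_add[of p q] by blast

lemma homogeneous_mult: "homogeneous d p \<Longrightarrow> homogeneous e q \<Longrightarrow> homogeneous (d + e) (p * q)"
  unfolding homogeneous_iff
proof
  fix m assume "\<forall>m\<in>Poly_Mapping.keys p. mdeg m = d" "\<forall>m\<in>Poly_Mapping.keys q. mdeg m = e"
    "m \<in> Poly_Mapping.keys (p * q)"
  moreover from this obtain a b where "m = a + b" "a \<in> Poly_Mapping.keys p" "b \<in> Poly_Mapping.keys q"
    using Poly_Mapping.keys_mult[of p q] by blast
  ultimately show "mdeg m = d + e" by (simp add: mdeg_add)
qed

lemma homogeneous_0: "homogeneous d 0"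
  by (simp add: homogeneous_iff)

lemma homogeneous_Const: "homogeneous 0 (Const k)"
  by (simp add: homogeneous_iff Const_def mdeg_def)

lemma homogeneous_1: "homogeneous 0 1"
  using homogeneous_Const[of 1] by simp

lemma homogeneous_Var: "homogeneous 1 (Var v)"
  by (simp add: homogeneous_iff Var_def mdeg_def)

lemma homogeneous_sum: "(\<And>i. i \<in> A \<Longrightarrow> homogeneous d (f i)) \<Longrightarrow> homogeneous d (sum f A)"
  by (induction A rule: infinite_finite_induct) (simp_all add: homogeneous_0 homogeneous_add)

lemma homogeneous_prod:
  "finite A \<Longrightarrow> (\<And>i. i \<in> A \<Longrightarrow> homogeneous (d i) (f i)) \<Longrightarrow> homogeneous (sum d A) (prod f A)"
  by (induction A rule: finite_induct) (simp_all add: homogeneous_1 homogeneous_mult)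

lemma homogeneous_power: "homogeneous d p \<Longrightarrow> homogeneous (k * d) (p ^ k)"
  by (induction k) (simp_all add: homogeneous_1 homogeneous_mult)

lemma homogeneous_Const_mult: "homogeneous d p \<Longrightarrow> homogeneous d (Const k * p)"
  using homogeneous_mult[OF homogeneous_Const] by fastforce

lemma homogeneous_diff: "homogeneous d p \<Longrightarrow> homogeneous d q \<Longrightarrow> homogeneous d (p - q)"
  using homogeneous_add[of d p "Const (-1) * q"] homogeneous_Const_mult[of d q "-1"]
  by (simp add: Const.hom_uminus)

lemma peval_homogeneous:
  assumes "homogeneous d p"
  shows "peval (\<lambda>v. k * x v) p = k ^ d * peval x p"
proof -
  have "(\<Prod>v \<in> Poly_Mapping.keys m. (k * x v) ^ Poly_Mapping.lookup m v)
      = k ^ d * (\<Prod>v \<in> Poly_Mapping.keys m. x v ^ Poly_Mapping.lookup m v)"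
    if "m \<in> Poly_Mapping.keys p" for m
    using assms that by (simp add: homogeneous_def power_mult_distrib prod.distrib flip: power_sum)
  then show ?thesis by (simp add: peval_def sum_distrib_left mult_ac)
qed

subsection \<open>Polynomials that vanish everywhere\<close>

text \<open>Exponents below a base \<open>B\<close> are recovered from the number of which they are the digits; this makes the
Kronecker substitution in the next lemma injective on monomials.\<close>

lemma base_digits_unique:
  fixes B :: nat
  assumes "\<forall>j<n. a j < B" "\<forall>j<n. b j < B" "(\<Sum>j<n. a j * B ^ j) = (\<Sum>j<n. b j * B ^ j)"
  shows "\<forall>j<n. a j = b j"
  using assms
proof (induction n arbitrary: a b)
  case (Suc n)
  have split: "(\<Sum>j<Suc n. c j * B ^ j) = c 0 + B * (\<Sum>j<n. c (Suc j) * B ^ j)" for c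
    by (simp only: sum.lessThan_Suc_shift) (simp add: sum_distrib_left mult_ac)
  have eq: "a 0 + B * (\<Sum>j<n. a (Suc j) * B ^ j) = b 0 + B * (\<Sum>j<n. b (Suc j) * B ^ j)"
    using Suc.prems(3) unfolding split .
  have B: "a 0 < B" "b 0 < B" using Suc.prems by simp_all
  have "a 0 = b 0" using arg_cong[OF eq, of "\<lambda>k. k mod B"] B by simp
  moreover have "(\<Sum>j<n. a (Suc j) * B ^ j) = (\<Sum>j<n. b (Suc j) * B ^ j)"
    using eq B \<open>a 0 = b 0\<close> by simp
  then have "\<forall>j<n. a (Suc j) = b (Suc j)"
    using Suc.prems by (intro Suc.IH) auto
  ultimately show ?case using less_Suc_eq_0_disj by auto
qed simp

text \<open>Kronecker substitution: putting \<open>x\<^sub>j = t\<^bsup>B^j\<^esup>\<close> with \<open>B\<close> larger than all exponents sends distinct monomials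
to distinct powers of \<open>t\<close>, so a univariate polynomial with the same coefficients vanishes
everywhere.\<close>

lemma cpoly_vanishing_imp_zero:
  fixes n :: nat
  assumes p: "p \<in> polys_in {0..<n}" and van: "\<And>x. peval x p = 0"
  shows "p = 0"
proof -
  define B where "B = Suc (\<Sum>m \<in> Poly_Mapping.keys p. \<Sum>j<n. Poly_Mapping.lookup m j)"
  have digit: "Poly_Mapping.lookup m j < B" if "m \<in> Poly_Mapping.keys p" "j < n" for m j
  proof -
    have "Poly_Mapping.lookup m j \<le> (\<Sum>j<n. Poly_Mapping.lookup m j)"
      using that by (intro member_le_sum) auto
    also have "\<dots> \<le> (\<Sum>m \<in> Poly_Mapping.keys p. \<Sum>j<n. Poly_Mapping.lookup m j)"
      using that(1) by (intro member_le_sum[of _ _ "\<lambda>m. \<Sum>j<n. Poly_Mapping.lookup m j"]) auto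
    finally show ?thesis by (simp add: B_def)
  qed
  define e where "e m = (\<Sum>j<n. Poly_Mapping.lookup m j * B ^ j)" for m
  have keys: "Poly_Mapping.keys m \<subseteq> {0..<n}" if "m \<in> Poly_Mapping.keys p" for m
    using p that by (auto simp: polys_in_def)
  have inj: "inj_on e (Poly_Mapping.keys p)"
  proof (rule inj_onI)
    fix m m' assume m: "m \<in> Poly_Mapping.keys p" "m' \<in> Poly_Mapping.keys p" "e m = e m'"
    have "\<forall>j<n. Poly_Mapping.lookup m j = Poly_Mapping.lookup m' j"
      using m digit unfolding e_def by (intro base_digits_unique) auto
    moreover have "Poly_Mapping.lookup m j = Poly_Mapping.lookup m' j" if "\<not> j < n" for j
      using keys[OF m(1)] keys[OF m(2)] that
      by (metis atLeastLessThan_iff in_keys_iff subsetD)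
    ultimately show "m = m'" by (intro poly_mapping_eqI) blast
  qed
  define q where "q = (\<Sum>m \<in> Poly_Mapping.keys p. Polynomial.monom (Poly_Mapping.lookup p m) (e m))"
  have "poly q t = peval (\<lambda>j. t ^ (B ^ j)) p" for t
  proof -
    have "(\<Prod>v \<in> Poly_Mapping.keys m. (t ^ (B ^ v)) ^ Poly_Mapping.lookup m v) = t ^ e m"
      if "m \<in> Poly_Mapping.keys p" for m
      unfolding monomial_prod_superset[OF finite_atLeastLessThan keys[OF that]]
      by (simp add: e_def power_sum mult_ac lessThan_atLeast0 flip: power_mult)
    then show ?thesis by (simp add: q_def poly_sum poly_monom peval_def)
  qed
  then have "q = 0" using van poly_all_0_iff_0 by metis
  have "Poly_Mapping.keys p = {}"
  proof (rule ccontr)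
    assume "Poly_Mapping.keys p \<noteq> {}"
    then obtain m where m: "m \<in> Poly_Mapping.keys p" by blast
    have "coeff q (e m) = (\<Sum>m' \<in> Poly_Mapping.keys p. if m' = m then Poly_Mapping.lookup p m else 0)"
      unfolding q_def coeff_sum using inj m
      by (intro sum.cong) (auto simp: coeff_monom inj_on_def)
    also have "\<dots> = Poly_Mapping.lookup p m" using m by simp
    finally show False using m \<open>q = 0\<close> by (simp add: in_keys_iff)
  qed
  then show ?thesis by simp
qed

section \<open>Reduction modulo a monic polynomial\<close>

text \<open>Vectors are functions on \<open>nat\<close> of which the first \<open>n\<close> values are the coordinates with respect to
\<open>1, \<zeta>, \<dots>, \<zeta>\<^bsup>n-1\<^esup>\<close>; \<open>f\<close> lists the coefficients of a monic polynomial of degree \<open>n\<close>.  On these coordinates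
\<open>times_zeta\<close> is multiplication by \<open>\<zeta>\<close> modulo that polynomial, that is, the companion matrix.\<close>

definition times_zeta :: "nat \<Rightarrow> (nat \<Rightarrow> 'a::comm_ring_1) \<Rightarrow> (nat \<Rightarrow> 'a) \<Rightarrow> nat \<Rightarrow> 'a" where
  "times_zeta n f v i = (if i = 0 then 0 else v (i - 1)) - f i * v (n - 1)"

text \<open>The coordinates of the residue class of a polynomial, by the Horner scheme.  In contrast to division with
remainder this makes sense over every commutative ring and commutes with ring homomorphisms.\<close>

definition reduce :: "nat \<Rightarrow> (nat \<Rightarrow> 'a::comm_ring_1) \<Rightarrow> 'a poly \<Rightarrow> nat \<Rightarrow> 'a" where
  "reduce n f p = fold_coeffs (\<lambda>a v i. (if i = 0 then a else 0) + times_zeta n f v i) p (\<lambda>i. 0)"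

lemma times_zeta_add: "times_zeta n f (\<lambda>i. u i + v i) j = times_zeta n f u j + times_zeta n f v j"
  by (simp add: times_zeta_def algebra_simps)

lemma times_zeta_smult: "times_zeta n f (\<lambda>i. k * v i) j = k * times_zeta n f v j"
  by (simp add: times_zeta_def algebra_simps)

lemma times_zeta_0: "times_zeta n f (\<lambda>i. 0) j = 0"
  by (simp add: times_zeta_def)

lemma times_zeta_sum:
  "times_zeta n f (\<lambda>i. \<Sum>k\<in>A. v k i) j = (\<Sum>k\<in>A. times_zeta n f (v k) j)"
  by (simp add: times_zeta_def sum_subtractf sum_distrib_left)

lemma reduce_0: "reduce n f 0 i = 0"
  by (simp add: reduce_def)

lemma reduce_pCons:
  "reduce n f (pCons a p) i = (if i = 0 then a else 0) + times_zeta n f (reduce n f p) i"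
  by (cases "p = 0 \<and> a = 0") (auto simp: reduce_def times_zeta_0)

lemma reduce_add: "reduce n f (p + q) i = reduce n f p i + reduce n f q i"
proof (induction p q arbitrary: i rule: poly_induct2)
  case (pCons a p b q)
  have "reduce n f (p + q) = (\<lambda>i. reduce n f p i + reduce n f q i)" using pCons by blast
  then show ?case by (simp add: reduce_pCons times_zeta_add)
qed (simp add: reduce_0)

lemma reduce_smult: "reduce n f (smult k p) i = k * reduce n f p i"
proof (induction p arbitrary: i)
  case (pCons a p)
  have "reduce n f (smult k p) = (\<lambda>i. k * reduce n f p i)" using pCons by blast
  then show ?case by (simp add: reduce_pCons times_zeta_smult algebra_simps)
qed (simp add: reduce_0)

lemma reduce_diff: "reduce n f (p - q) i = reduce n f p i - reduce n f q i"
  using reduce_add[of n f p "smult (-1) q" i] by (simp only: reduce_smult) simp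

lemma reduce_low_degree:
  assumes "\<And>i. i \<ge> n \<Longrightarrow> coeff p i = 0"
  shows "reduce n f p = coeff p"
  using assms
proof (induction p)
  case (pCons a p)
  have "coeff p i = 0" if "i \<ge> n" for i
    using pCons.prems[of "Suc i"] that by simp
  then have "reduce n f p = coeff p" by (rule pCons.IH)
  moreover have "coeff p (n - 1) = 0"
    using pCons.prems[of n] pCons.prems[of "Suc (n - 1)"] by (cases n) simp_all
  ultimately show ?case
    by (auto simp: fun_eq_iff reduce_pCons times_zeta_def coeff_pCons split: nat.splits)
qed (auto simp: reduce_0 fun_eq_iff)

text \<open>The companion matrix satisfies its own polynomial: after the first \<open>n\<close> steps of the Horner scheme the leading
coefficient 1 is carried over, and it cancels all coefficients at once.\<close>

lemma reduce_modulus: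
  assumes "n > 0" "coeff g n = 1" "degree g \<le> n"
  shows "reduce n (coeff g) g i = 0"
proof (cases g)
  case (pCons a q)
  have "coeff q i = 0" if "i \<ge> n" for i
  proof -
    have "coeff g (Suc i) = 0" using that assms(3) by (intro coeff_eq_0) simp
    then show ?thesis by (simp add: pCons)
  qed
  then have q: "reduce n f q = coeff q" for f by (rule reduce_low_degree)
  have "coeff q (n - 1) = coeff g n" using assms(1) pCons by (cases n) simp_all
  with assms have top: "coeff q (n - 1) = 1" by simp
  have "reduce n (coeff g) g i = reduce n (coeff g) (pCons a q) i" by (simp add: pCons)
  also have "\<dots> = 0"
    using top by (simp add: reduce_pCons q times_zeta_def) (simp add: pCons coeff_pCons split: nat.splits)
  finally show ?thesis .
qed

lemma reduce_mult:
  assumes "degree q \<le> d"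
  shows "reduce n f (q * p) i = (\<Sum>j\<le>d. coeff q j * (times_zeta n f ^^ j) (reduce n f p) i)"
  using assms
proof (induction q arbitrary: d i)
  case 0
  show ?case by (simp add: reduce_0)
next
  case (pCons a q)
  show ?case
  proof (cases d)
    case 0
    then have "q = 0" using pCons.prems by (simp split: if_splits)
    then show ?thesis using 0 by (simp add: reduce_smult)
  next
    case (Suc e)
    have "degree q \<le> e" using pCons.prems Suc by (simp split: if_splits)
    then have IH: "reduce n f (q * p)
        = (\<lambda>i. \<Sum>j\<le>e. coeff q j * (times_zeta n f ^^ j) (reduce n f p) i)"
      using pCons.IH by blast
    have "reduce n f (pCons a q * p) i = a * reduce n f p i + times_zeta n f (reduce n f (q * p)) i"
      by (simp add: reduce_add reduce_smult reduce_pCons)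
    also have "times_zeta n f (reduce n f (q * p)) i
        = (\<Sum>j\<le>e. coeff q j * (times_zeta n f ^^ Suc j) (reduce n f p) i)"
      unfolding IH times_zeta_sum by (simp add: times_zeta_smult)
    also have "a * reduce n f p i + \<dots>
        = (\<Sum>j\<le>Suc e. coeff (pCons a q) j * (times_zeta n f ^^ j) (reduce n f p) i)"
      unfolding sum.atMost_Suc_shift by simp
    finally show ?thesis using Suc by simp
  qed
qed

lemma reduce_dvd_eq_0:
  assumes "n > 0" "coeff g n = 1" "degree g \<le> n" "g dvd p"
  shows "reduce n (coeff g) p i = 0"
proof -
  obtain q where p: "p = q * g" using assms(4) by (metis dvdE mult.commute)
  have "reduce n (coeff g) g = (\<lambda>i. 0)" using reduce_modulus[OF assms(1,2,3)] by blast
  moreover have "(times_zeta n (coeff g) ^^ j) (\<lambda>i. 0) = (\<lambda>i. 0)" for j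
    by (induction j) (simp_all add: times_zeta_0[abs_def])
  ultimately show ?thesis by (simp add: p reduce_mult[OF order_refl])
qed

section \<open>The determinants S and T over a commutative ring\<close>

text \<open>The matrices of \<open>S\<^sub>k\<close> and \<open>T\<^sub>k\<close> in the basis \<open>1, \<dots>, \<zeta>\<^bsup>n-1\<^esup>\<close>: the first \<open>k\<close> columns are \<open>\<phi>, \<phi>\<zeta>, \<dots>\<close>, where
\<open>w\<close> holds the coordinates of \<open>\<phi>\<close>; they are followed by unit vectors, starting with \<open>\<zeta>\<^sup>k\<close> in \<open>S\<^sub>k\<close> and
with \<open>\<zeta>\<^bsup>k-1\<^esup>\<close> in \<open>T\<^sub>k\<close>.\<close>

definition S_mat :: "nat \<Rightarrow> (nat \<Rightarrow> 'a::comm_ring_1) \<Rightarrow> (nat \<Rightarrow> 'a) \<Rightarrow> nat \<Rightarrow> 'a mat" where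
  "S_mat n f w k = mat n n (\<lambda>(i, j). if j < k then (times_zeta n f ^^ j) w i
     else if i = j then 1 else 0)"

definition T_mat :: "nat \<Rightarrow> (nat \<Rightarrow> 'a::comm_ring_1) \<Rightarrow> (nat \<Rightarrow> 'a) \<Rightarrow> nat \<Rightarrow> 'a mat" where
  "T_mat n f w k = mat n n (\<lambda>(i, j). if j < k then (times_zeta n f ^^ j) w i
     else if Suc i = j then 1 else 0)"

definition S_det :: "nat \<Rightarrow> (nat \<Rightarrow> 'a::comm_ring_1) \<Rightarrow> (nat \<Rightarrow> 'a) \<Rightarrow> nat \<Rightarrow> 'a" where
  "S_det n f w k = det (S_mat n f w k)"

text \<open>The value 1 at index 0 makes the formulas for \<open>z\<^sub>1\<close> and \<open>Q\<^sub>1\<close> instances of the general ones.\<close>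

definition T_det :: "nat \<Rightarrow> (nat \<Rightarrow> 'a::comm_ring_1) \<Rightarrow> (nat \<Rightarrow> 'a) \<Rightarrow> nat \<Rightarrow> 'a" where
  "T_det n f w k = (if k = 0 then 1 else det (T_mat n f w k))"

lemma S_det_0: "S_det n f w 0 = 1"
proof -
  have "S_mat n f w 0 = 1\<^sub>m n" by (rule eq_matI) (auto simp: S_mat_def)
  then show ?thesis by (simp add: S_det_def)
qed

text \<open>The hypothesis expresses the column \<open>b\<^sub>k\<close> through the columns of the matrix of \<open>S\<^sub>k\<close>, with coefficients
\<open>x\<close>.  Passing to \<open>S\<^bsub>k+1\<^esub>\<close> replaces the column \<open>a\<^sub>k\<close> by \<open>b\<^sub>k\<close>, so Cramer's rule yields the factor \<open>x\<^sub>k\<close>.  Passing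
to \<open>T\<^bsub>k+1\<^esub>\<close> inserts \<open>b\<^sub>k\<close> at position \<open>k\<close> and drops the last column \<open>a\<^bsub>n-1\<^esub>\<close>, which yields the factor \<open>x\<^bsub>n-1\<^esub>\<close>
and the sign of a cyclic permutation.\<close>

lemma det_column_recursion:
  assumes k: "k < n"
    and col: "\<And>i. i < n \<Longrightarrow> (times_zeta n f ^^ k) w i
      = (\<Sum>j<k. x j * (times_zeta n f ^^ j) w i) + (if k \<le> i then x i else 0)"
  shows "S_det n f w (Suc k) = x k * S_det n f w k"
    and "T_det n f w (Suc k) = (-1) ^ (n - 1 + k) * x (n - 1) * S_det n f w k"
proof -
  let ?S = "S_mat n f w k"
  have S: "?S \<in> carrier_mat n n" by (simp add: S_mat_def)
  have Sx: "(\<Sum>l<n. ?S $$ (i, l) * x l) = (times_zeta n f ^^ k) w i" if i: "i < n" for i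
  proof -
    have "(\<Sum>l<n. ?S $$ (i, l) * x l)
        = (\<Sum>l<n. (if l < k then x l * (times_zeta n f ^^ l) w i else 0)
            + (if l = i then (if k \<le> i then x i else 0) else 0))"
      using i by (intro sum.cong) (auto simp: S_mat_def)
    also have "\<dots> = (\<Sum>l<k. x l * (times_zeta n f ^^ l) w i) + (if k \<le> i then x i else 0)"
    proof -
      have "(\<Sum>l<n. if l < k then x l * (times_zeta n f ^^ l) w i else 0)
          = (\<Sum>l<k. x l * (times_zeta n f ^^ l) w i)"
        using k by (intro sum.mono_neutral_cong_right) auto
      then show ?thesis using i by (simp add: sum.distrib)
    qed
    finally show ?thesis using col[OF i] by simp
  qed
  have "S_mat n f w (Suc k) = replace_col ?S (?S *\<^sub>v vec n x) k"
  proof (rule eq_matI)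
    fix i j assume "i < dim_row (replace_col ?S (?S *\<^sub>v vec n x) k)"
      "j < dim_col (replace_col ?S (?S *\<^sub>v vec n x) k)"
    then have ij: "i < n" "j < n" using S by (simp_all add: replace_col_def)
    have "(?S *\<^sub>v vec n x) $ i = (\<Sum>l<n. ?S $$ (i, l) * x l)"
      using ij S by (simp add: scalar_prod_def lessThan_atLeast0)
    then show "S_mat n f w (Suc k) $$ (i, j) = replace_col ?S (?S *\<^sub>v vec n x) k $$ (i, j)"
      using ij S Sx[OF ij(1)] by (auto simp: replace_col_def S_mat_def)
  qed (auto simp: replace_col_def S_mat_def)
  then show "S_det n f w (Suc k) = x k * S_det n f w k"
    using cramer_lemma_mat[OF S _ k, of "vec n x"] k by (simp add: S_det_def)

  \<comment> \<open>The last row of this change of columns has a single entry, and deleting its row and column leaves the identity matrix.\<close>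
  define X where "X = mat n n (\<lambda>(i, j). if j < k then if i = j then 1 else 0
    else if j = k then x i else if Suc i = j then 1 else 0)"
  have X: "X \<in> carrier_mat n n" by (simp add: X_def)
  have "T_mat n f w (Suc k) = ?S * X"
  proof (rule eq_matI)
    fix i j assume "i < dim_row (?S * X)" "j < dim_col (?S * X)"
    then have ij: "i < n" "j < n" using S X by simp_all
    have "(?S * X) $$ (i, j) = (\<Sum>l<n. ?S $$ (i, l) * X $$ (l, j))"
      using ij S X by (simp add: scalar_prod_def lessThan_atLeast0)
    also have "\<dots> = T_mat n f w (Suc k) $$ (i, j)"
    proof (cases "j = k")
      case True
      then have "(\<Sum>l<n. ?S $$ (i, l) * X $$ (l, j)) = (\<Sum>l<n. ?S $$ (i, l) * x l)"
        using k by (intro sum.cong) (auto simp: X_def)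
      then show ?thesis using Sx[OF ij(1)] True ij by (simp add: T_mat_def)
    next
      case False
      define l' where "l' = (if j < k then j else j - 1)"
      have l': "l' < n" using ij by (auto simp: l'_def)
      have "(\<Sum>l<n. ?S $$ (i, l) * X $$ (l, j)) = (\<Sum>l<n. if l = l' then ?S $$ (i, l') else 0)"
        using False ij by (intro sum.cong) (auto simp: X_def l'_def)
      also have "\<dots> = ?S $$ (i, l')" using l' by simp
      also have "\<dots> = T_mat n f w (Suc k) $$ (i, j)"
        using ij False l' by (auto simp: S_mat_def T_mat_def l'_def)
      finally show ?thesis .
    qed
    finally show "T_mat n f w (Suc k) $$ (i, j) = (?S * X) $$ (i, j)" ..
  qed (auto simp: T_mat_def S_mat_def X_def)
  then have T: "T_det n f w (Suc k) = det X * S_det n f w k"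
    using det_mult[OF S X] by (simp add: T_det_def S_det_def mult.commute)
  have "det X = (\<Sum>j<n. X $$ (n - 1, j) * cofactor X (n - 1) j)"
    using k by (intro laplace_expansion_row[OF X]) simp
  also have "\<dots> = (\<Sum>j<n. if j = k then x (n - 1) * cofactor X (n - 1) k else 0)"
    using k by (intro sum.cong) (auto simp: X_def)
  also have "\<dots> = x (n - 1) * cofactor X (n - 1) k" using k by simp
  also have "mat_delete X (n - 1) k = 1\<^sub>m (n - 1)"
    using k by (intro eq_matI) (auto simp: mat_delete_def X_def)
  then have "cofactor X (n - 1) k = (-1) ^ (n - 1 + k)" by (simp add: cofactor_def)
  finally show "T_det n f w (Suc k) = (-1) ^ (n - 1 + k) * x (n - 1) * S_det n f w k"
    using T by (simp add: mult_ac)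
qed

text \<open>One step of the continued fraction: \<open>R \<phi> \<equiv> \<zeta>\<^sup>k P\<close> with \<open>R\<close> monic of degree \<open>k\<close> says that \<open>b\<^sub>k\<close> is a combination of
\<open>b\<^sub>0, \<dots>, b\<^bsub>k-1\<^esub>\<close> and \<open>a\<^sub>k, \<dots>, a\<^bsub>n-1\<^esub>\<close> in which \<open>a\<^bsub>k+j\<^esub>\<close> has as its coefficient the \<open>j\<close>-th coefficient of \<open>P\<close>.\<close>

lemma det_division_step:
  fixes g :: "'a::comm_ring_1 poly"
  assumes g: "coeff g n = 1" "degree g \<le> n"
    and \<phi>: "\<And>i. i \<ge> n \<Longrightarrow> coeff \<phi> i = 0"
    and k: "k < n"
    and R: "coeff R k = 1" "degree R \<le> k"
    and P: "\<And>i. i \<ge> n - k \<Longrightarrow> coeff P i = 0"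
    and cong: "g dvd R * \<phi> - Polynomial.monom 1 k * P"
  shows "S_det n (coeff g) (coeff \<phi>) (Suc k) = coeff P 0 * S_det n (coeff g) (coeff \<phi>) k"
    and "T_det n (coeff g) (coeff \<phi>) (Suc k)
           = (-1) ^ (n - 1 + k) * coeff P (n - 1 - k) * S_det n (coeff g) (coeff \<phi>) k"
proof -
  let ?b = "\<lambda>j. (times_zeta n (coeff g) ^^ j) (coeff \<phi>)"
  define x where "x j = (if j < k then - coeff R j else coeff P (j - k))" for j
  have "?b k i = (\<Sum>j<k. x j * ?b j i) + (if k \<le> i then x i else 0)" for i
  proof -
    have "reduce n (coeff g) (R * \<phi>) i = (\<Sum>j\<le>k. coeff R j * ?b j i)"
      by (simp add: reduce_mult[OF R(2)] reduce_low_degree[OF \<phi>])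
    also have "\<dots> = (\<Sum>j<k. coeff R j * ?b j i) + ?b k i"
      by (simp add: R(1) flip: lessThan_Suc_atMost)
    finally have "(\<Sum>j<k. coeff R j * ?b j i) + ?b k i = reduce n (coeff g) (Polynomial.monom 1 k * P) i"
      using reduce_dvd_eq_0[OF _ g cong, of i] k by (simp add: reduce_diff)
    also have "\<dots> = (if k \<le> i then coeff P (i - k) else 0)"
    proof -
      have "coeff (Polynomial.monom 1 k * P) i = 0" if "i \<ge> n" for i
        using P[of "i - k"] that by (simp add: coeff_monom_mult)
      then have "reduce n (coeff g) (Polynomial.monom 1 k * P) = coeff (Polynomial.monom 1 k * P)"
        by (rule reduce_low_degree)
      then show ?thesis by (simp add: coeff_monom_mult)
    qed
    finally show ?thesis by (simp add: x_def sum_negf algebra_simps)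
  qed
  note rec = det_column_recursion[OF k this]
  have "x k = coeff P 0" "x (n - 1) = coeff P (n - 1 - k)" using k by (auto simp: x_def)
  with rec show "S_det n (coeff g) (coeff \<phi>) (Suc k) = coeff P 0 * S_det n (coeff g) (coeff \<phi>) k"
    and "T_det n (coeff g) (coeff \<phi>) (Suc k)
           = (-1) ^ (n - 1 + k) * coeff P (n - 1 - k) * S_det n (coeff g) (coeff \<phi>) k"
    by simp_all
qed

section \<open>The trailing principal minors of \<open>\<zeta>B - A\<close>\<close>

text \<open>The summand of \<open>F\<^sub>i\<close> that belongs to \<open>I\<close>.\<close>

definition tail_weight :: "nat \<Rightarrow> (nat \<Rightarrow> 'a::comm_ring_1) \<Rightarrow> (nat \<Rightarrow> 'a) \<Rightarrow> nat set \<Rightarrow> 'a" where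
  "tail_weight n z Q I = (\<Prod>j\<in>I. z j) * (\<Prod>j | j \<in> I \<and> j + 1 \<notin> I. 1 - (if j = n then 0 else Q j))"

lemma F_eq_sum_tail_weight:
  "F n i z Q = (\<Sum>I | I \<subseteq> {1..n} \<and> card I = i. tail_weight n z Q I)"
  by (simp add: F_def tail_weight_def)

text \<open>The determinant of \<open>\<zeta>B - A\<close> without its first \<open>k\<close> rows and columns, expanded by subsets.  For \<open>k = 0\<close> the
coefficients are the signed \<open>F\<^sub>i\<close>; for \<open>k = 1\<close> this is \<open>\<Delta>\<^sub>1\<^sub>1\<close>.\<close>

definition tail_poly :: "nat \<Rightarrow> (nat \<Rightarrow> 'a::comm_ring_1) \<Rightarrow> (nat \<Rightarrow> 'a) \<Rightarrow> nat \<Rightarrow> 'a poly" where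
  "tail_poly n z Q k = (\<Sum>I \<in> Pow {Suc k..n}.
     Polynomial.monom ((-1) ^ card I * tail_weight n z Q I) (n - k - card I))"

lemma tail_poly_n: "tail_poly n z Q n = 1"
  by (simp add: tail_poly_def tail_weight_def one_pCons monom_0)

lemma tail_weight_insert:
  assumes "finite I" "\<forall>j\<in>I. k < j"
  shows "tail_weight n z Q (insert k I)
    = (if Suc k \<in> I then 1 else 1 - (if k = n then 0 else Q k)) * z k * tail_weight n z Q I"
proof -
  have "k \<notin> I" using assms by auto
  have "{j. j \<in> insert k I \<and> j + 1 \<notin> insert k I}
      = (if Suc k \<in> I then {} else {k}) \<union> {j. j \<in> I \<and> j + 1 \<notin> I}"
    using assms by auto
  then show ?thesis
    using assms \<open>k \<notin> I\<close> by (auto simp: tail_weight_def mult_ac)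
qed

text \<open>Subsets of \<open>{k..n}\<close> without \<open>k\<close> contribute \<open>\<zeta> p\<^sub>k\<close>.  Those that contain \<open>k\<close> have an additional factor \<open>-z\<^sub>k\<close>, and
also \<open>1 - Q\<^sub>k\<close> if \<open>k + 1\<close> is missing; the part with \<open>-Q\<^sub>k\<close> runs over the subsets of \<open>{k+2..n}\<close> and gives
\<open>Q\<^sub>k z\<^sub>k \<zeta> p\<^bsub>k+1\<^esub>\<close>.\<close>

lemma tail_poly_rec:
  assumes "1 \<le> k" "k \<le> n"
  shows "tail_poly n z Q (k - 1) = [:- z k, 1:] * tail_poly n z Q k
    + Polynomial.monom ((if k = n then 0 else Q k) * z k) 1 * tail_poly n z Q (k + 1)"
proof -
  define q where "q = (if k = n then 0 else Q k)"
  define t where "t d I = Polynomial.monom ((-1) ^ card I * tail_weight n z Q I) (d - card I)" for d I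
  let ?P = "Pow {Suc k..n}"
  have card: "card I \<le> n - k" if "I \<in> ?P" for I
    using card_mono[of "{Suc k..n}" I] that by auto
  have fin: "finite I" if "I \<in> ?P" for I using that finite_subset by blast
  have "{Suc (k - 1)..n} = insert k {Suc k..n}" using assms by auto
  then have "Pow {Suc (k - 1)..n} = ?P \<union> insert k ` ?P" by (simp add: Pow_insert)
  moreover have "?P \<inter> insert k ` ?P = {}" by auto
  moreover have inj: "inj_on (insert k) ?P"
  proof (rule inj_onI)
    fix I J assume "I \<in> ?P" "J \<in> ?P" "insert k I = insert k J"
    moreover from this have "k \<notin> I" "k \<notin> J" by auto
    ultimately show "I = J" by (metis insert_ident)
  qed
  moreover have tail: "tail_poly n z Q k' = (\<Sum>I\<in>Pow {Suc k'..n}. t (n - k') I)" for k'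
    by (simp only: tail_poly_def t_def)
  ultimately have "tail_poly n z Q (k - 1) = (\<Sum>I\<in>?P. t (n - (k - 1)) I) + (\<Sum>I\<in>?P. t (n - (k - 1)) (insert k I))"
    by (simp add: sum.union_disjoint sum.reindex)
  also have "(\<Sum>I\<in>?P. t (n - (k - 1)) I) = (\<Sum>I\<in>?P. Polynomial.monom 1 1 * t (n - k) I)"
  proof (rule sum.cong)
    fix I assume "I \<in> ?P"
    then have eq: "n - (k - 1) - card I = Suc (n - k - card I)" using card[of I] assms by linarith
    show "t (n - (k - 1)) I = Polynomial.monom 1 1 * t (n - k) I"
      unfolding t_def eq by (simp add: mult_monom)
  qed simp
  also have "(\<Sum>I\<in>?P. t (n - (k - 1)) (insert k I))
      = (\<Sum>I\<in>?P. smult (- z k) (t (n - k) I) + (if Suc k \<in> I then 0 else smult (q * z k) (t (n - k) I)))"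
  proof (rule sum.cong)
    fix I assume I: "I \<in> ?P"
    then have "k \<notin> I" by auto
    have "t (n - (k - 1)) (insert k I)
        = Polynomial.monom ((-1) ^ Suc (card I) * tail_weight n z Q (insert k I)) (n - k - card I)"
      using \<open>k \<notin> I\<close> fin[OF I] card[OF I] assms by (simp add: t_def Suc_diff_le)
    also have "tail_weight n z Q (insert k I) = (if Suc k \<in> I then 1 else 1 - q) * z k * tail_weight n z Q I"
      using I fin[OF I] by (subst tail_weight_insert) (auto simp: q_def)
    finally show "t (n - (k - 1)) (insert k I)
        = smult (- z k) (t (n - k) I) + (if Suc k \<in> I then 0 else smult (q * z k) (t (n - k) I))"
      by (simp add: t_def smult_monom add_monom algebra_simps)
  qed simp
  also have "\<dots> = smult (- z k) (\<Sum>I\<in>?P. t (n - k) I)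
      + (\<Sum>I\<in>?P. if Suc k \<in> I then 0 else smult (q * z k) (t (n - k) I))"
  proof -
    have "smult a (sum g A) = (\<Sum>i\<in>A. smult a (g i))" for a :: 'a and g and A :: "nat set set"
      by (induction A rule: infinite_finite_induct) (simp_all add: smult_add_right)
    then show ?thesis by (simp only: sum.distrib)
  qed
  also have "(\<Sum>I\<in>?P. if Suc k \<in> I then 0 else smult (q * z k) (t (n - k) I))
      = (\<Sum>I\<in>Pow {Suc (Suc k)..n}. smult (q * z k) (t (n - k) I))"
  proof (rule sum.mono_neutral_cong_right)
    show "\<forall>I\<in>?P - Pow {Suc (Suc k)..n}. (if Suc k \<in> I then 0 else smult (q * z k) (t (n - k) I)) = 0"
    proof
      fix I assume I: "I \<in> ?P - Pow {Suc (Suc k)..n}"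
      then obtain x where "x \<in> I" "x \<notin> {Suc (Suc k)..n}" by blast
      moreover from this I have "x \<in> {Suc k..n}" by blast
      ultimately have "Suc k \<in> I" by (cases "x = Suc k") auto
      then show "(if Suc k \<in> I then 0 else smult (q * z k) (t (n - k) I)) = 0" by simp
    qed
  qed auto
  also have "\<dots> = (\<Sum>I\<in>Pow {Suc (Suc k)..n}. Polynomial.monom (q * z k) 1 * t (n - Suc k) I)"
  proof (rule sum.cong)
    fix I assume "I \<in> Pow {Suc (Suc k)..n}"
    then have "card I \<le> n - Suc k" using card_mono[of "{Suc (Suc k)..n}" I] by auto
    then have "n - k - card I = Suc (n - Suc k - card I)" if "k < n" using that by linarith
    moreover have "q = 0" if "\<not> k < n" using that assms by (simp add: q_def)
    ultimately show "smult (q * z k) (t (n - k) I) = Polynomial.monom (q * z k) 1 * t (n - Suc k) I"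
      by (cases "k < n") (simp_all add: t_def smult_monom mult_monom)
  qed simp
  finally have "tail_poly n z Q (k - 1) = Polynomial.monom 1 1 * tail_poly n z Q k
      + (smult (- z k) (tail_poly n z Q k) + Polynomial.monom (q * z k) 1 * tail_poly n z Q (Suc k))"
    by (simp only: tail sum_distrib_left)
  then show ?thesis by (simp add: q_def[symmetric] monom_altdef)
qed

lemma degree_tail_poly: "degree (tail_poly n z Q k) \<le> n - k"
  unfolding tail_poly_def
  by (intro degree_sum_le) (auto intro!: order.trans[OF degree_monom_le])

lemma coeff_tail_poly_beyond: "i > n - k \<Longrightarrow> coeff (tail_poly n z Q k) i = 0"
  using degree_tail_poly[of n z Q k] by (intro coeff_eq_0) simp

lemma tail_poly_ends:
  assumes "k \<le> n"
  shows "coeff (tail_poly n z Q k) (n - k) = 1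
    \<and> coeff (tail_poly n z Q k) 0 = (-1) ^ (n - k) * (\<Prod>j\<in>{Suc k..n}. z j)"
  using assms
proof (induction rule: inc_induct)
  case base
  show ?case by (simp add: tail_poly_n)
next
  case (step k)
  let ?q = "if Suc k = n then 0 else Q (Suc k)"
  have rec: "tail_poly n z Q k = [:- z (Suc k), 1:] * tail_poly n z Q (Suc k)
    + Polynomial.monom (?q * z (Suc k)) 1 * tail_poly n z Q (Suc (Suc k))"
    using tail_poly_rec[of "Suc k" n z Q] step.hyps by simp
  have nk: "n - k = Suc (n - Suc k)" using step.hyps by simp
  have "coeff (tail_poly n z Q k) (Suc (n - Suc k)) = 1"
    unfolding rec using step.IH coeff_tail_poly_beyond[of n "Suc k" "Suc (n - Suc k)" z Q]
      coeff_tail_poly_beyond[of n "Suc (Suc k)" "n - Suc k" z Q] step.hyps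
    by (auto simp: coeff_monom_mult coeff_pCons)
  moreover have "coeff (tail_poly n z Q k) 0 = - z (Suc k) * coeff (tail_poly n z Q (Suc k)) 0"
    unfolding rec by (simp add: coeff_monom_mult coeff_mult)
  moreover have "{Suc k..n} = insert (Suc k) {Suc (Suc k)..n}" using step.hyps by auto
  ultimately show ?case using step.IH by (simp add: nk)
qed

lemma coeff_tail_poly_0:
  assumes "i \<le> n"
  shows "coeff (tail_poly n z Q 0) (n - i) = (-1) ^ i * F n i z Q"
proof -
  have "coeff (tail_poly n z Q 0) (n - i)
      = (\<Sum>I\<in>Pow {1..n}. if card I = i then (-1) ^ i * tail_weight n z Q I else 0)"
    unfolding tail_poly_def coeff_sum
  proof (rule sum.cong)
    fix I assume "I \<in> Pow {1..n}"
    then have "card I \<le> n" using card_mono[of "{1..n}" I] by auto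
    then show "coeff (Polynomial.monom ((-1) ^ card I * tail_weight n z Q I) (n - 0 - card I)) (n - i)
        = (if card I = i then (-1) ^ i * tail_weight n z Q I else 0)"
      using assms by (auto simp: coeff_monom)
  qed simp
  also have "\<dots> = (\<Sum>I | I \<subseteq> {1..n} \<and> card I = i. (-1) ^ i * tail_weight n z Q I)"
    by (rule sum.mono_neutral_cong_right) auto
  finally show ?thesis by (simp add: F_eq_sum_tail_weight sum_distrib_left)
qed

section \<open>S and T at \<open>\<Delta>\<^sub>1\<^sub>1\<close>\<close>

text \<open>The leading principal minors of \<open>\<zeta>B - A\<close>, which are the denominators of the convergents of the continued
fraction.\<close>

fun lead_poly :: "(nat \<Rightarrow> 'a::comm_ring_1) \<Rightarrow> (nat \<Rightarrow> 'a) \<Rightarrow> nat \<Rightarrow> 'a poly" where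
  "lead_poly z Q 0 = 1"
| "lead_poly z Q (Suc 0) = [:- z 1, 1:]"
| "lead_poly z Q (Suc (Suc k)) = [:- z (Suc (Suc k)), 1:] * lead_poly z Q (Suc k)
     + Polynomial.monom (Q (Suc k) * z (Suc k)) 1 * lead_poly z Q k"

lemma lead_poly_monic: "degree (lead_poly z Q k) \<le> k \<and> coeff (lead_poly z Q k) k = 1"
proof (induction z Q k rule: lead_poly.induct)
  case (3 z Q k)
  have "coeff (lead_poly z Q (Suc (Suc k))) i = (if i = Suc (Suc k) then 1 else 0)" if "i \<ge> Suc (Suc k)" for i
    using 3 that by (cases i) (auto simp: coeff_monom_mult coeff_pCons coeff_eq_0)
  then show ?case by (auto intro!: degree_le simp del: lead_poly.simps)
qed simp_all

text \<open>The two sides of the congruence satisfy the same three-term recursion in \<open>k\<close>: the left one by definition of \<open>lead_poly\<close>, the right one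
because \<open>(\<zeta> - z\<^bsub>k+2\<^esub>) p\<^bsub>k+2\<^esub> - p\<^bsub>k+1\<^esub> = -Q\<^bsub>k+2\<^esub> z\<^bsub>k+2\<^esub> \<zeta> p\<^bsub>k+3\<^esub>\<close>.\<close>

lemma lead_poly_times_tail:
  assumes "k < n"
  shows "tail_poly n z Q 0 dvd lead_poly z Q k * tail_poly n z Q 1
    - Polynomial.monom 1 k * smult ((-1) ^ k * (\<Prod>j\<in>{1..k}. Q j * z j)) (tail_poly n z Q (Suc k))"
  using assms
proof (induction z Q k rule: lead_poly.induct)
  case (2 z Q)
  have "lead_poly z Q (Suc 0) * tail_poly n z Q 1
      - Polynomial.monom 1 (Suc 0) * smult ((-1) ^ Suc 0 * (\<Prod>j\<in>{1..Suc 0}. Q j * z j)) (tail_poly n z Q (Suc (Suc 0)))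
      = tail_poly n z Q 0"
    using tail_poly_rec[of 1 n z Q] 2 by (simp add: monom_altdef)
  then show ?case by simp
next
  case (3 z Q k)
  let ?p = "tail_poly n z Q" and ?c = "\<lambda>k. (-1) ^ k * (\<Prod>j\<in>{1..k}. Q j * z j)"
  let ?d = "\<lambda>k. lead_poly z Q k * ?p 1 - Polynomial.monom 1 k * smult (?c k) (?p (Suc k))"
  let ?z = "z (Suc (Suc k))" and ?q = "Q (Suc k) * z (Suc k)" and ?q' = "Q (Suc (Suc k)) * z (Suc (Suc k))"
  have rec: "?p (Suc k) = [:- ?z, 1:] * ?p (Suc (Suc k)) + Polynomial.monom ?q' 1 * ?p (Suc (Suc (Suc k)))"
    using tail_poly_rec[of "Suc (Suc k)" n z Q] 3 by simp
  have c: "?c (Suc k) = - ?q * ?c k" "?c (Suc (Suc k)) = - ?q' * ?c (Suc k)"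
    by simp_all
  let ?X = "Polynomial.monom (1::'a) 1"
  have eq: "((X - [:b:]) * l1 + [:q:] * X * l0) * p - X * (X * Xk) * smult (- q' * (- q * c)) r3
      = (X - [:b:]) * (l1 * p - X * Xk * smult (- q * c) r2) + [:q:] * X * (l0 * p - Xk * smult c r1)"
    if "r1 = (X - [:b:]) * r2 + [:q':] * X * r3"
    for X l1 l0 p Xk r1 r2 r3 :: "'a poly" and b q q' c
  proof -
    have s: "smult (- q' * (- q * c)) r3 = [:q':] * [:q:] * [:c:] * r3"
      "smult (- q * c) r2 = - ([:q:] * [:c:] * r2)" "smult c r1 = [:c:] * r1"
      by (simp_all add: mult_ac)
    have "((X - b) * l1 + q * X * l0) * p - X * (X * Xk) * (q' * q * c * r3)
        = (X - b) * (l1 * p - X * Xk * (- (q * c * r2)))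
          + q * X * (l0 * p - Xk * (c * ((X - b) * r2 + q' * X * r3)))"
      for b q q' c :: "'a poly"
      by (simp add: algebra_simps)
    then show ?thesis unfolding s unfolding that .
  qed
  have z: "[:- ?z, 1:] = ?X - [:?z:]" and q: "Polynomial.monom ?q 1 = [:?q:] * ?X"
    and q': "Polynomial.monom ?q' 1 = [:?q':] * ?X"
    by (simp_all add: monom_altdef)
  have pow: "Polynomial.monom (1::'a) (Suc i) = ?X * Polynomial.monom 1 i" for i
    by (simp add: mult_monom)
  have "?d (Suc (Suc k)) = [:- ?z, 1:] * ?d (Suc k) + Polynomial.monom ?q 1 * ?d k"
    unfolding c(2) unfolding c(1) lead_poly.simps z q pow
    by (rule eq[OF rec[unfolded z q']])
  moreover have "?p 0 dvd ?d (Suc k)" "?p 0 dvd ?d k" using 3 by simp_all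
  ultimately show ?case by (simp only: dvd_add dvd_mult)
qed simp

context
  fixes n :: nat and z Q :: "nat \<Rightarrow> 'a::comm_ring_1"
begin

text \<open>The instance of \<open>det_division_step\<close> given by the leading minor \<open>R\<^bsub>i-1\<^esub>\<close> and the trailing minor \<open>p\<^sub>i\<close>; the
latter is monic with constant term \<open>(-1)\<^bsup>n-i\<^esup> z\<^bsub>i+1\<^esub> \<cdots> z\<^sub>n\<close>.\<close>

lemma tail_S_T:
  defines "f \<equiv> coeff (tail_poly n z Q 0)" and "w \<equiv> coeff (tail_poly n z Q 1)"
  assumes "1 \<le> i" "i \<le> n"
  shows "T_det n f w i = (-1) ^ (n - 1) * (\<Prod>j\<in>{1..i-1}. Q j * z j) * S_det n f w (i - 1)"
    and "S_det n f w i = (\<Prod>j\<in>{Suc i..n}. z j) * T_det n f w i"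
proof -
  define k where "k = i - 1"
  have k: "k < n" "i = Suc k" using assms by (simp_all add: k_def)
  let ?c = "\<Prod>j\<in>{1..k}. Q j * z j"
  let ?P = "smult ((-1) ^ k * ?c) (tail_poly n z Q (Suc k))"
  have P: "coeff ?P j = 0" if "j \<ge> n - k" for j
    using coeff_tail_poly_beyond[of n "Suc k" j z Q] that k by simp
  have \<phi>: "coeff (tail_poly n z Q 1) j = 0" if "j \<ge> n" for j
    using coeff_tail_poly_beyond[of n 1 j z Q] that k by simp
  have g: "coeff (tail_poly n z Q 0) n = 1" "degree (tail_poly n z Q 0) \<le> n"
    using tail_poly_ends[of 0 n z Q] degree_tail_poly[of n z Q 0] by simp_all
  have R: "coeff (lead_poly z Q k) k = 1" "degree (lead_poly z Q k) \<le> k"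
    using lead_poly_monic[of z Q k] by simp_all
  note step = det_division_step[OF g \<phi> k(1) R P lead_poly_times_tail[OF k(1)]]
  have S: "S_det n f w (Suc k) = coeff ?P 0 * S_det n f w k"
    unfolding f_def w_def by (rule step(1))
  have T: "T_det n f w (Suc k) = (-1) ^ (n - 1 + k) * coeff ?P (n - 1 - k) * S_det n f w k"
    unfolding f_def w_def by (rule step(2))
  have "coeff ?P (n - 1 - k) = (-1) ^ k * ?c"
    using tail_poly_ends[of "Suc k" n z Q] k by simp
  then have T': "T_det n f w (Suc k) = (-1) ^ (n - 1) * ?c * S_det n f w k"
    unfolding T by (simp only: power_add mult.assoc left_minus_one_mult_self)
  then show "T_det n f w i = (-1) ^ (n - 1) * (\<Prod>j\<in>{1..i-1}. Q j * z j) * S_det n f w (i - 1)"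
    by (simp add: k)
  have "(-1::'a) ^ k * (-1) ^ (n - Suc k) = (-1) ^ (n - 1)"
    using k by (simp flip: power_add)
  note sgn = this
  have "coeff ?P 0 = (-1) ^ k * ?c * ((-1) ^ (n - Suc k) * (\<Prod>j\<in>{Suc (Suc k)..n}. z j))"
    using tail_poly_ends[of "Suc k" n z Q] k by simp
  then show "S_det n f w i = (\<Prod>j\<in>{Suc i..n}. z j) * T_det n f w i"
    by (simp only: k(2) S T' sgn[symmetric] mult_ac)
qed

end

section \<open>\<open>\<Delta>\<^sub>1\<^sub>1\<close> as a trailing minor\<close>

text \<open>The tridiagonal matrix \<open>\<zeta>B - A\<close> without its first \<open>k\<close> rows and columns.\<close>

definition tail_mat :: "nat \<Rightarrow> (nat \<Rightarrow> 'a::comm_ring_1) \<Rightarrow> (nat \<Rightarrow> 'a) \<Rightarrow> nat \<Rightarrow> 'a poly mat" where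
  "tail_mat n z Q k = mat (n - k) (n - k) (\<lambda>(i, j). if i = j then [:- z (k + i + 1), 1:]
     else if j = i + 1 then 1
     else if i = j + 1 then Polynomial.monom (- (Q (k + j + 1) * z (k + j + 1))) 1 else 0)"

lemma det_tail_mat:
  assumes "k \<le> n"
  shows "det (tail_mat n z Q k) = tail_poly n z Q k"
  using assms
proof (induction "n - k" arbitrary: k rule: less_induct)
  case less
  let ?M = "tail_mat n z Q k"
  have M: "?M \<in> carrier_mat (n - k) (n - k)" by (simp add: tail_mat_def)
  consider "k = n" | "Suc k = n" | "Suc (Suc k) \<le> n" using less.prems by linarith
  then show ?case
  proof cases
    case 1
    then show ?thesis by (simp add: tail_poly_n tail_mat_def det_dim_zero)
  next
    case 2
    then have "det ?M = [:- z n, 1:]"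
      by (subst det_single) (auto simp: tail_mat_def)
    then show ?thesis using tail_poly_rec[of n n z Q] 2 by (auto simp: tail_poly_n)
  next
    case 3
    let ?N = "mat_delete ?M 0 1"
    have N: "?N \<in> carrier_mat (n - k - 1) (n - k - 1)" using M by (rule mat_delete_carrier)
    have "det ?M = (\<Sum>j<n - k. ?M $$ (0, j) * cofactor ?M 0 j)"
      using 3 by (intro laplace_expansion_row[OF M]) simp
    also have "\<dots> = (\<Sum>j\<in>{0, 1}. ?M $$ (0, j) * cofactor ?M 0 j)"
      using 3 by (intro sum.mono_neutral_right) (auto simp: tail_mat_def)
    also have "\<dots> = [:- z (Suc k), 1:] * det (mat_delete ?M 0 0) - det ?N"
      using 3 by (simp add: tail_mat_def cofactor_def)
    also have "mat_delete ?M 0 0 = tail_mat n z Q (Suc k)"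
      using 3 by (intro eq_matI) (auto simp: mat_delete_def tail_mat_def)
    also have "det (tail_mat n z Q (Suc k)) = tail_poly n z Q (Suc k)"
      using 3 by (intro less.hyps) auto
    also have "det ?N = (\<Sum>i<n - k - 1. ?N $$ (i, 0) * cofactor ?N i 0)"
      using 3 by (intro laplace_expansion_column[OF N]) simp
    also have "\<dots> = (\<Sum>i\<in>{0}. ?N $$ (i, 0) * cofactor ?N i 0)"
      using 3 by (intro sum.mono_neutral_right) (auto simp: tail_mat_def mat_delete_def split: if_splits)
    also have "\<dots> = Polynomial.monom (- (Q (Suc k) * z (Suc k))) 1 * det (mat_delete ?N 0 0)"
      using 3 by (simp add: tail_mat_def cofactor_def mat_delete_def)
    also have "mat_delete ?N 0 0 = tail_mat n z Q (Suc (Suc k))"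
      using 3 by (intro eq_matI) (auto simp: mat_delete_def tail_mat_def)
    also have "det (tail_mat n z Q (Suc (Suc k))) = tail_poly n z Q (Suc (Suc k))"
      using 3 by (intro less.hyps) auto
    finally show ?thesis
      using tail_poly_rec[of "Suc k" n z Q] 3 by (simp add: monom_altdef)
  qed
qed

lemma Delta11_eq_tail_poly:
  assumes "n \<ge> 1"
  shows "Delta11 n z Q = tail_poly n z Q 1"
proof -
  have "mat_delete (Polynomial.monom 1 1 \<cdot>\<^sub>m map_mat (\<lambda>k. [:k:]) (B_mat n z Q)
       - map_mat (\<lambda>k. [:k:]) (A_mat n z)) 0 0 = tail_mat n z Q 1"
    using assms by (intro eq_matI)
      (auto simp: mat_delete_def tail_mat_def A_mat_def B_mat_def monom_altdef one_pCons)
  then show ?thesis using det_tail_mat[OF assms, of z Q] by (simp add: Delta11_def)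
qed

section \<open>Existence of the continued fraction\<close>

text \<open>From two consecutive remainders \<open>a\<close>, \<open>b\<close> of degrees \<open>n - k\<close> and \<open>n - k - 1\<close> the next one is
\<open>((\<zeta> - z) b + q a) / \<zeta>\<close>: the number \<open>q\<close> is chosen to cancel the leading term and \<open>z\<close> to cancel the constant
term.\<close>

definition next_remainder :: "nat \<Rightarrow> nat \<Rightarrow> 'a::field poly \<Rightarrow> 'a poly \<Rightarrow> 'a poly" where
  "next_remainder n k a b = poly_shift 1
     ([:- (- coeff b (n - Suc k) / coeff a (n - k) * coeff a 0 / coeff b 0), 1:] * b
      + smult (- coeff b (n - Suc k) / coeff a (n - k)) a)"

fun remainder_seq :: "nat \<Rightarrow> 'a::field poly \<Rightarrow> 'a poly \<Rightarrow> nat \<Rightarrow> 'a poly" where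
  "remainder_seq n g \<phi> 0 = g"
| "remainder_seq n g \<phi> (Suc 0) = \<phi>"
| "remainder_seq n g \<phi> (Suc (Suc k)) =
     next_remainder n k (remainder_seq n g \<phi> k) (remainder_seq n g \<phi> (Suc k))"

text \<open>The remainders \<open>P\<^sub>k\<close> are, up to the scalars \<open>l\<^sub>k\<close>, the trailing minors of the matrix to be found.  The division can
only break down if a remainder has a vanishing leading coefficient or constant term; by \<open>det_division_step\<close>
these numbers are \<open>\<plusminus>T\<^bsub>k+1\<^esub> / S\<^sub>k\<close> and \<open>S\<^bsub>k+1\<^esub> / S\<^sub>k\<close>.\<close>

lemma continued_fraction_exists:
  fixes g \<phi> :: "'a::field poly"
  assumes g: "coeff g n = 1" "degree g \<le> n" "coeff g 0 \<noteq> 0"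
    and \<phi>: "\<And>i. i \<ge> n \<Longrightarrow> coeff \<phi> i = 0"
    and nz: "\<And>i. 1 \<le> i \<Longrightarrow> i \<le> n \<Longrightarrow>
      S_det n (coeff g) (coeff \<phi>) i \<noteq> 0 \<and> T_det n (coeff g) (coeff \<phi>) i \<noteq> 0"
    and n: "n \<ge> 1"
  obtains z Q l where "l \<noteq> 0" "\<And>i. 1 \<le> i \<Longrightarrow> i < n \<Longrightarrow> Q i \<noteq> 0"
    "\<phi> = smult l (tail_poly n z Q 1)" "g = tail_poly n z Q 0"
proof -
  define P where "P = remainder_seq n g \<phi>"
  define l where "l k = coeff (P k) (n - k)" for k
  define q where "q k = - l (Suc k) / l k" for k
  define zz where "zz k = q k * coeff (P k) 0 / coeff (P (Suc k)) 0" for k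
  define z where "z k = zz (k - 1)" for k
  define Q where "Q k = q k / z k" for k
  have P_simps: "P 0 = g" "P (Suc 0) = \<phi>" by (simp_all add: P_def)
  have P_rec: "P (Suc (Suc k)) = poly_shift 1 ([:- zz k, 1:] * P (Suc k) + smult (q k) (P k))" for k
    by (simp add: P_def next_remainder_def zz_def q_def l_def)

  \<comment> \<open>Along the induction: \<open>low\<close> bounds the degrees, \<open>ends\<close> excludes a breakdown, and \<open>good\<close> is the hypothesis of \<open>det_division_step\<close>.\<close>
  define low where "low k \<longleftrightarrow> (\<forall>i. i > n - k \<longrightarrow> coeff (P k) i = 0)" for k
  define ends where "ends k \<longleftrightarrow> l k \<noteq> 0 \<and> coeff (P k) 0 \<noteq> 0" for k
  define good where "good k \<longleftrightarrow>
    g dvd lead_poly z Q k * \<phi> - Polynomial.monom 1 k * P (Suc k)" for k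

  have coeff_next: "coeff (P (Suc (Suc k))) i
      = coeff (P (Suc k)) i - zz k * coeff (P (Suc k)) (Suc i) + q k * coeff (P k) (Suc i)" for k i
    by (simp add: P_rec coeff_poly_shift)
  have const_next: "coeff ([:- zz k, 1:] * P (Suc k) + smult (q k) (P k)) 0 = 0" if "ends (Suc k)" for k
    using that by (simp add: zz_def ends_def)
  have division: "[:- zz k, 1:] * P (Suc k) + smult (q k) (P k) = Polynomial.monom 1 1 * P (Suc (Suc k))"
    if "ends (Suc k)" for k
  proof (rule poly_eqI)
    fix i
    show "coeff ([:- zz k, 1:] * P (Suc k) + smult (q k) (P k)) i
        = coeff (Polynomial.monom 1 1 * P (Suc (Suc k))) i"
      using const_next[OF that]
      by (cases i) (simp_all add: coeff_monom_mult P_rec coeff_poly_shift)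
  qed
  have degree_next: "coeff (P (Suc (Suc k))) i = 0"
    if "k < n" "ends k" "low k" "low (Suc k)" "i \<ge> n - Suc k" for k i
  proof (cases "i = n - Suc k")
    case True
    then have "Suc i = n - k" using that by simp
    then have "coeff (P (Suc k)) (Suc i) = 0" "coeff (P k) (Suc i) = l k" "coeff (P (Suc k)) i = l (Suc k)"
      using that True by (auto simp: low_def l_def)
    then show ?thesis using that(2) by (simp add: coeff_next q_def ends_def)
  next
    case False
    then show ?thesis using that by (auto simp: coeff_next low_def)
  qed

  have low_good_ends: "ends (Suc k)"
    if "k < n" "low (Suc k)" "good k" "degree (lead_poly z Q k) \<le> k" "coeff (lead_poly z Q k) k = 1" for k
  proof -
    have "coeff (P (Suc k)) i = 0" if "i \<ge> n - k" for i
      using that \<open>low (Suc k)\<close> \<open>k < n\<close> by (simp add: low_def)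
    note P = this
    have S: "S_det n (coeff g) (coeff \<phi>) (Suc k) = coeff (P (Suc k)) 0 * S_det n (coeff g) (coeff \<phi>) k"
      and T: "T_det n (coeff g) (coeff \<phi>) (Suc k)
           = (-1) ^ (n - 1 + k) * coeff (P (Suc k)) (n - 1 - k) * S_det n (coeff g) (coeff \<phi>) k"
      using det_division_step[OF g(1,2) \<phi> that(1,5,4) P] that(3) unfolding good_def by blast+
    with nz[of "Suc k"] \<open>k < n\<close> show ?thesis by (auto simp: ends_def l_def)
  qed

  have Qz: "Q (Suc k) * z (Suc k) = q (Suc k)" if "ends k" "ends (Suc k)" for k
    using that by (simp add: Q_def z_def zz_def q_def ends_def)

  have main: "low k \<and> low (Suc k) \<and> (\<forall>j\<le>Suc k. ends j) \<and> (\<forall>j\<le>k. good j)" if "k < n" for k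
    using that
  proof (induction k)
    case 0
    have "low 0" "ends 0" using g by (auto simp: low_def ends_def l_def P_simps coeff_eq_0)
    moreover have "low (Suc 0)" using \<phi> n by (auto simp: low_def P_simps)
    moreover have "good 0" by (simp add: good_def P_simps)
    moreover have "ends (Suc 0)" using calculation n by (intro low_good_ends) simp_all
    ultimately show ?case by (auto simp: le_Suc_eq)
  next
    case (Suc k)
    then have IH: "low k" "low (Suc k)" "\<forall>j\<le>Suc k. ends j" "\<forall>j\<le>k. good j" and k: "k < n" by simp_all
    have low: "low (Suc (Suc k))"
      using degree_next[OF k _ IH(1,2)] IH(3) Suc.prems unfolding low_def by auto
    have good: "good (Suc k)"
    proof (cases k)
      case 0
      have "lead_poly z Q (Suc 0) * \<phi> - Polynomial.monom 1 (Suc 0) * P (Suc (Suc 0)) = smult (- q 0) g"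
        using division[of 0] IH(3) 0 by (simp add: P_simps z_def algebra_simps)
      then show ?thesis using 0 by (simp only: good_def dvd_smult dvd_refl)
    next
      case (Suc j)
      let ?X = "Polynomial.monom (1::'a) 1"
      let ?d = "\<lambda>m. lead_poly z Q m * \<phi> - Polynomial.monom 1 m * P (Suc m)"
      have eq: "(b * l1 + c * X * l0) * p - X * (X * Xk) * r3
          = b * (l1 * p - X * Xk * r2) + c * X * (l0 * p - Xk * r1)"
        if "b * r2 + c * r1 = X * r3" for X Xk l0 l1 p b c r1 r2 r3 :: "'a poly"
      proof -
        have "(b * l1 + c * X * l0) * p - (X * Xk) * (X * r3)
            = b * (l1 * p - X * Xk * r2) + c * X * (l0 * p - Xk * r1)"
          unfolding that[symmetric] by (simp add: algebra_simps)
        then show ?thesis by (simp add: mult_ac)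
      qed
      have pow: "Polynomial.monom (1::'a) (Suc i) = ?X * Polynomial.monom 1 i" for i
        by (simp add: mult_monom)
      have Qzk: "Polynomial.monom (Q (Suc j) * z (Suc j)) 1 = [:q k:] * ?X" "z (Suc (Suc j)) = zz k"
        using Qz[of j] IH(3) Suc by (simp_all add: monom_altdef z_def)
      have "?d (Suc (Suc j)) = [:- zz k, 1:] * ?d (Suc j) + [:q k:] * ?X * ?d j"
        unfolding lead_poly.simps pow Qzk
        by (rule eq) (use division[of k] IH(3) Suc in simp)
      moreover have "g dvd ?d (Suc j)" "g dvd ?d j" using IH(4) Suc by (simp_all add: good_def)
      ultimately show ?thesis unfolding good_def Suc by (simp only: dvd_add dvd_mult)
    qed
    moreover have "ends (Suc (Suc k))"
      using Suc.prems low good lead_poly_monic[of z Q "Suc k"] by (intro low_good_ends) simp_all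
    ultimately show ?case using IH low by (simp add: le_Suc_eq)
  qed

  \<comment> \<open>The process ends here: the degree bound leaves no coefficient.\<close>
  have last: "P (Suc n) = 0"
  proof (rule poly_eqI)
    fix i
    obtain m where m: "n = Suc m" using n by (cases n) auto
    show "coeff (P (Suc n)) i = coeff 0 i"
      using degree_next[of m i] main[of m] m by simp
  qed

  \<comment> \<open>Normalized to be monic, the remainders satisfy the recursion \<open>tail_poly_rec\<close>, which determines the minors downwards from the index \<open>n\<close>.\<close>
  have tails: "P k = smult (l k) (tail_poly n z Q k)
      \<and> (k < n \<longrightarrow> P (Suc k) = smult (l (Suc k)) (tail_poly n z Q (Suc k)))" if "k \<le> n" for k
    using that
  proof (induction rule: inc_induct)
    case base
    obtain m where m: "n = Suc m" using n by (cases n) auto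
    have "P n = [:l n:]"
      using main[of m] m by (intro poly_eqI) (auto simp: low_def l_def coeff_pCons split: nat.splits)
    then show ?case by (simp add: tail_poly_n)
  next
    case (step k)
    have IH: "P (Suc k) = smult (l (Suc k)) (tail_poly n z Q (Suc k))"
      and IH': "Suc k < n \<Longrightarrow> P (Suc (Suc k)) = smult (l (Suc (Suc k))) (tail_poly n z Q (Suc (Suc k)))"
      using step.IH by simp_all
    have k: "k < n" "ends k" "ends (Suc k)" using main[of k] step.hyps by simp_all
    let ?q = "if Suc k = n then 0 else Q (Suc k)"
    have lq: "l (Suc k) \<noteq> 0" "l k \<noteq> 0" "q k * l k = - l (Suc k)" using k by (simp_all add: ends_def q_def)
    have next': "P (Suc (Suc k)) = smult (- l (Suc k) * (?q * z (Suc k))) (tail_poly n z Q (Suc (Suc k)))"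
    proof (cases "Suc k = n")
      case False
      then show ?thesis using IH' Qz[of k] k by (simp add: q_def ends_def)
    qed (use last in simp)
    have "smult (q k) (P k) = Polynomial.monom 1 1 * P (Suc (Suc k)) - [:- zz k, 1:] * P (Suc k)"
      using division[OF k(3)] by (simp add: algebra_simps)
    also have "\<dots> = smult (- l (Suc k)) (tail_poly n z Q k)"
    proof -
      have eq: "X * smult (- L * a) t2 - b * smult L t1 = smult (- L) (b * t1 + smult a X * t2)"
        for X b t1 t2 :: "'a poly" and L a
        by (simp add: smult_add_right mult.commute)
      have "tail_poly n z Q k = [:- zz k, 1:] * tail_poly n z Q (Suc k)
          + smult (?q * z (Suc k)) (Polynomial.monom 1 1) * tail_poly n z Q (Suc (Suc k))"
        using tail_poly_rec[of "Suc k" n z Q] k(1) by (simp add: smult_monom z_def)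
      then show ?thesis unfolding next' IH by (simp only: eq)
    qed
    also have "\<dots> = smult (q k) (smult (l k) (tail_poly n z Q k))" by (simp only: smult_smult lq(3))
    finally have "smult (q k) (P k) = smult (q k) (smult (l k) (tail_poly n z Q k))" .
    moreover have "q k \<noteq> 0" using lq by auto
    ultimately have "P k = smult (l k) (tail_poly n z Q k)" by (rule smult_cancel[rotated])
    then show ?case using IH by simp
  qed

  show thesis
  proof (rule that)
    show "l 1 \<noteq> 0" using main[of 0] n by (simp add: ends_def)
    show "Q i \<noteq> 0" if "1 \<le> i" "i < n" for i
      using main[of i] main[of "i - 1"] that by (simp add: Q_def z_def zz_def q_def ends_def)
    show "\<phi> = smult (l 1) (tail_poly n z Q 1)" using tails[of 0] n by (simp add: P_simps)
    show "g = tail_poly n z Q 0" using tails[of 0] g by (simp add: P_simps l_def)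
  qed
qed

section \<open>Expressing z, Q and U through S and T\<close>

context
  fixes n :: nat and z Q f w
  defines "f \<equiv> coeff (tail_poly n z Q 0)" and "w \<equiv> coeff (tail_poly n z Q 1)"
  assumes n: "n \<ge> 2"
begin

text \<open>Both sides are \<open>(-1)\<^sup>n\<close> times the constant term of \<open>tail_poly n z Q 0\<close>.\<close>

lemma prod_z_eq: "F n n z Q = (\<Prod>j\<in>{1..n}. z j)"
proof -
  have "(-1) ^ n * F n n z Q = (-1) ^ n * (\<Prod>j\<in>{1..n}. z j)"
    using coeff_tail_poly_0[of n n z Q] tail_poly_ends[of 0 n z Q] by simp
  then have "(-1) ^ n * ((-1) ^ n * F n n z Q) = (-1) ^ n * ((-1) ^ n * (\<Prod>j\<in>{1..n}. z j))" by simp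
  then show ?thesis by (simp only: left_minus_one_mult_self)
qed

lemma T_det_1: "T_det n f w 1 = (-1) ^ (n - 1)"
  using tail_S_T(1)[of 1 n z Q] n by (simp add: f_def w_def S_det_0)

text \<open>\<open>S\<^sub>i / T\<^sub>i = z\<^bsub>i+1\<^esub> \<cdots> z\<^sub>n\<close>, and two consecutive quotients differ by the factor \<open>z\<^sub>i\<close>.  For \<open>i = 1\<close> the convention
\<open>S\<^sub>0 / T\<^sub>0 = 1\<close> replaces \<open>z\<^sub>1 \<cdots> z\<^sub>n\<close>, which accounts for the last factor.\<close>

lemma tail_z_relation:
  assumes "1 \<le> i" "i \<le> n"
  shows "T_det n f w (i - 1) * S_det n f w i * z i
    = S_det n f w (i - 1) * T_det n f w i * (if i = 1 then \<Prod>j\<in>{1..n}. z j else 1)"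
proof -
  have S: "S_det n f w i = (\<Prod>j\<in>{Suc i..n}. z j) * T_det n f w i"
    unfolding f_def w_def using assms by (rule tail_S_T(2))
  have split: "(\<Prod>j\<in>{i..n}. z j) = z i * (\<Prod>j\<in>{Suc i..n}. z j)"
    using assms by (simp add: prod.atLeast_Suc_atMost)
  show ?thesis
  proof (cases "i = 1")
    case True
    then show ?thesis using S split by (simp add: T_det_def S_det_0 mult_ac)
  next
    case False
    have "S_det n f w (i - 1) = (\<Prod>j\<in>{Suc (i - 1)..n}. z j) * T_det n f w (i - 1)"
      unfolding f_def w_def using assms False by (intro tail_S_T(2)) auto
    then show ?thesis using S split False assms by (simp add: mult_ac)
  qed
qed

lemma T_det_step:
  assumes "1 \<le> i" "i < n"
  shows "T_det n f w (Suc i) = (-1) ^ (n - 1) * (\<Prod>j\<in>{1..i}. Q j * z j) * (\<Prod>j\<in>{Suc i..n}. z j) * T_det n f w i"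
  using tail_S_T(1)[of "Suc i" n z Q] tail_S_T(2)[of i n z Q] assms
  by (simp add: f_def w_def mult_ac)

text \<open>By \<open>T_det_step\<close>, \<open>T\<^bsub>i+1\<^esub> / T\<^sub>i\<close> is \<open>\<plusminus>c\<^sub>i z\<^bsub>i+1\<^esub> \<cdots> z\<^sub>n\<close> with \<open>c\<^sub>i = \<Prod>\<^bsub>j\<le>i\<^esub> Q\<^sub>j z\<^sub>j\<close>; from \<open>i - 1\<close> to \<open>i\<close> it is multiplied by
\<open>Q\<^sub>i\<close>.  The last factor again comes from the convention \<open>T\<^sub>0 = 1\<close>.\<close>

lemma tail_Q_relation:
  assumes "1 \<le> i" "i < n"
  shows "T_det n f w (Suc i) * T_det n f w (i - 1)
    = (T_det n f w i)\<^sup>2 * Q i * (if i = 1 then \<Prod>j\<in>{1..n}. z j else 1)"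
proof (cases "i = 1")
  case True
  have split: "(\<Prod>j\<in>{1..n}. z j) = z 1 * (\<Prod>j\<in>{Suc 1..n}. z j)"
    using n by (simp add: prod.atLeast_Suc_atMost)
  have "T_det n f w (Suc 1) = T_det n f w 1 * (Q 1 * z 1) * (\<Prod>j\<in>{Suc 1..n}. z j) * T_det n f w 1"
    using T_det_step[of 1] n unfolding T_det_1 by simp
  then show ?thesis unfolding True split by (simp add: power2_eq_square mult_ac T_det_def)
next
  case False
  then obtain m where m: "i = Suc m" "1 \<le> m" using assms by (cases i) auto
  have split: "(\<Prod>j\<in>{i..n}. z j) = z i * (\<Prod>j\<in>{Suc i..n}. z j)"
    "(\<Prod>j\<in>{1..i}. Q j * z j) = (\<Prod>j\<in>{1..m}. Q j * z j) * (Q i * z i)"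
    using assms m by (simp_all add: prod.atLeast_Suc_atMost)
  have T: "T_det n f w i = (-1) ^ (n - 1) * (\<Prod>j\<in>{1..m}. Q j * z j) * (\<Prod>j\<in>{i..n}. z j) * T_det n f w m"
    using T_det_step[of m] m assms by simp
  have "T_det n f w (Suc i) * T_det n f w m
      = (-1) ^ (n - 1) * (\<Prod>j\<in>{1..i}. Q j * z j) * (\<Prod>j\<in>{Suc i..n}. z j) * T_det n f w i * T_det n f w m"
    using T_det_step[OF assms] by simp
  also have "\<dots> = ((-1) ^ (n - 1) * (\<Prod>j\<in>{1..m}. Q j * z j) * (\<Prod>j\<in>{i..n}. z j) * T_det n f w m)
      * (T_det n f w i * Q i)"
    unfolding split by (simp only: mult_ac)
  also have "\<dots> = T_det n f w i * (T_det n f w i * Q i)" unfolding T[symmetric] ..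
  finally show ?thesis using False m by (simp add: power2_eq_square mult_ac)
qed

lemma tail_U_relation:
  "T_det n f w n = T_det n f w 1 * T_det n f w (n - 1) * (\<Prod>j\<in>{1..n-1}. Q j) * (\<Prod>j\<in>{1..n}. z j)"
proof -
  obtain m where m: "n = Suc m" "m \<ge> 1" using n by (cases n) auto
  then show ?thesis using T_det_step[of m] T_det_1 by (simp add: prod.distrib mult_ac)
qed

end

section \<open>Ring homomorphisms and congruences\<close>

lemma tail_weight_cong:
  assumes "\<And>j. j \<in> {1..n} \<Longrightarrow> z j = z' j" "\<And>j. j \<in> {1..n-1} \<Longrightarrow> Q j = Q' j" "I \<subseteq> {1..n}"
  shows "tail_weight n z Q I = tail_weight n z' Q' I"
proof -
  have "(\<Prod>j\<in>I. z j) = (\<Prod>j\<in>I. z' j)" using assms(1,3) by (intro prod.cong) auto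
  moreover have "1 - (if j = n then 0 else Q j) = 1 - (if j = n then 0 else Q' j)" if "j \<in> I" for j
  proof -
    have "j \<in> {1..n}" using that assms(3) by blast
    then show ?thesis using assms(2)[of j] by auto
  qed
  then have "(\<Prod>j | j \<in> I \<and> j + 1 \<notin> I. 1 - (if j = n then 0 else Q j))
      = (\<Prod>j | j \<in> I \<and> j + 1 \<notin> I. 1 - (if j = n then 0 else Q' j))"
    by (intro prod.cong) auto
  ultimately show ?thesis by (simp only: tail_weight_def)
qed

lemma tail_poly_cong:
  assumes "\<And>j. j \<in> {1..n} \<Longrightarrow> z j = z' j" "\<And>j. j \<in> {1..n-1} \<Longrightarrow> Q j = Q' j"
  shows "tail_poly n z Q k = tail_poly n z' Q' k"
proof -
  have "tail_weight n z Q I = tail_weight n z' Q' I" if "I \<in> Pow {Suc k..n}" for I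
    using that by (intro tail_weight_cong assms) auto
  then show ?thesis unfolding tail_poly_def by (intro sum.cong) auto
qed

lemma F_cong:
  assumes "\<And>j. j \<in> {1..n} \<Longrightarrow> z j = z' j" "\<And>j. j \<in> {1..n-1} \<Longrightarrow> Q j = Q' j"
  shows "F n i z Q = F n i z' Q'"
  unfolding F_eq_sum_tail_weight by (intro sum.cong tail_weight_cong assms) auto

context
  fixes h :: "'a::comm_ring_1 \<Rightarrow> 'b::comm_ring_1"
  assumes h: "comm_ring_hom h"
begin

interpretation h: comm_ring_hom h by (rule h)

lemma hom_tail_weight:
  "h (tail_weight n z Q I) = tail_weight n (\<lambda>i. h (z i)) (\<lambda>i. h (Q i)) I"
  by (auto simp: tail_weight_def hom_distribs intro!: prod.cong arg_cong2[where f = "(*)"])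

lemma hom_coeff_tail_poly:
  "h (coeff (tail_poly n z Q k) j) = coeff (tail_poly n (\<lambda>i. h (z i)) (\<lambda>i. h (Q i)) k) j"
  by (simp add: tail_poly_def coeff_sum coeff_monom hom_distribs hom_tail_weight if_distrib[of h]
      cong: if_cong)

lemma hom_F: "h (F n i z Q) = F n i (\<lambda>j. h (z j)) (\<lambda>j. h (Q j))"
  by (simp add: F_eq_sum_tail_weight hom_distribs hom_tail_weight)

lemma hom_times_zeta_iterate:
  "h ((times_zeta n f ^^ k) w i) = (times_zeta n (\<lambda>i. h (f i)) ^^ k) (\<lambda>i. h (w i)) i"
  by (induction k arbitrary: i) (simp_all add: times_zeta_def hom_distribs)

lemma hom_S_det: "h (S_det n f w k) = S_det n (\<lambda>i. h (f i)) (\<lambda>i. h (w i)) k"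
proof -
  have "map_mat h (S_mat n f w k) = S_mat n (\<lambda>i. h (f i)) (\<lambda>i. h (w i)) k"
    by (rule eq_matI) (auto simp: S_mat_def hom_times_zeta_iterate)
  then show ?thesis by (simp add: S_det_def flip: h.hom_det)
qed

lemma hom_T_det: "h (T_det n f w k) = T_det n (\<lambda>i. h (f i)) (\<lambda>i. h (w i)) k"
proof -
  have "map_mat h (T_mat n f w k) = T_mat n (\<lambda>i. h (f i)) (\<lambda>i. h (w i)) k"
    by (rule eq_matI) (auto simp: T_mat_def hom_times_zeta_iterate)
  then show ?thesis by (simp add: T_det_def flip: h.hom_det)
qed

end

text \<open>The quotient rings in question depend on \<open>n\<close> and \<open>\<gamma>\<close>, so they are not types; calculations in them are
carried out with representatives.\<close>

locale ring_congruence =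
  fixes R :: "'a::comm_ring_1 \<Rightarrow> 'a \<Rightarrow> bool" (infix \<open>\<approx>\<close> 50)
  assumes refl [simp, intro]: "x \<approx> x"
    and sym: "x \<approx> y \<Longrightarrow> y \<approx> x"
    and trans [trans]: "x \<approx> y \<Longrightarrow> y \<approx> u \<Longrightarrow> x \<approx> u"
    and add: "x \<approx> y \<Longrightarrow> u \<approx> v \<Longrightarrow> x + u \<approx> y + v"
    and mult: "x \<approx> y \<Longrightarrow> u \<approx> v \<Longrightarrow> x * u \<approx> y * v"
begin

lemma uminus: "x \<approx> y \<Longrightarrow> - x \<approx> - y"
  using mult[of "-1" "-1" x y] by simp

lemma diff: "x \<approx> y \<Longrightarrow> u \<approx> v \<Longrightarrow> x - u \<approx> y - v"
  using add[of x y "- u" "- v"] uminus[of u v] by simp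

lemma sum: "(\<And>i. i \<in> A \<Longrightarrow> g i \<approx> g' i) \<Longrightarrow> sum g A \<approx> sum g' A"
  by (induction A rule: infinite_finite_induct) (simp_all add: add)

lemma prod: "(\<And>i. i \<in> A \<Longrightarrow> g i \<approx> g' i) \<Longrightarrow> prod g A \<approx> prod g' A"
  by (induction A rule: infinite_finite_induct) (simp_all add: mult)

lemma power: "x \<approx> y \<Longrightarrow> x ^ k \<approx> y ^ k"
  by (induction k) (simp_all add: mult)

lemma det_mat:
  assumes "\<And>i j. i < n \<Longrightarrow> j < n \<Longrightarrow> A (i, j) \<approx> B (i, j)"
  shows "det (mat n n A) \<approx> det (mat n n B)"
proof -
  have "signof p * (\<Prod>i = 0..<n. mat n n A $$ (i, p i)) \<approx> signof p * (\<Prod>i = 0..<n. mat n n B $$ (i, p i))"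
    if "p permutes {0..<n}" for p
    using permutes_in_image[OF that] assms by (intro mult prod refl) auto
  then show ?thesis
    unfolding det_def'[OF mat_carrier] by (intro sum) blast
qed

lemma times_zeta_iterate:
  assumes "\<And>i. f i \<approx> f' i" "\<And>i. w i \<approx> w' i"
  shows "(times_zeta n f ^^ k) w i \<approx> (times_zeta n f' ^^ k) w' i"
  by (induction k arbitrary: i) (auto simp: times_zeta_def assms intro!: diff mult uminus)

lemma S_det:
  assumes "\<And>i. f i \<approx> f' i" "\<And>i. w i \<approx> w' i"
  shows "S_det n f w k \<approx> S_det n f' w' k"
  unfolding S_det_def S_mat_def by (intro det_mat) (auto intro: times_zeta_iterate assms)

lemma T_det:
  assumes "\<And>i. f i \<approx> f' i" "\<And>i. w i \<approx> w' i"
  shows "T_det n f w k \<approx> T_det n f' w' k"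
  unfolding T_det_def T_mat_def by (auto intro!: det_mat times_zeta_iterate assms)

definition unit :: "'a \<Rightarrow> bool" where
  "unit x \<longleftrightarrow> (\<exists>y. x * y \<approx> 1)"

lemma unit_1: "unit 1" unfolding unit_def by (rule exI[of _ 1]) simp

lemma unit_cong: "x \<approx> y \<Longrightarrow> unit x \<longleftrightarrow> unit y"
  unfolding unit_def by (meson mult refl sym trans)

lemma unit_mult: "unit x \<Longrightarrow> unit y \<Longrightarrow> unit (x * y)"
proof -
  assume "unit x" "unit y"
  then obtain x' y' where "x * x' \<approx> 1" "y * y' \<approx> 1" unfolding unit_def by blast
  then have "(x * x') * (y * y') \<approx> 1 * 1" by (rule mult)
  then show ?thesis unfolding unit_def by (intro exI[of _ "x' * y'"]) (simp add: mult_ac)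
qed

lemma unit_factor: "unit (x * y) \<Longrightarrow> unit x"
  unfolding unit_def by (auto simp: mult.assoc)

lemma unit_prod: "(\<And>i. i \<in> A \<Longrightarrow> unit (g i)) \<Longrightarrow> unit (prod g A)"
  by (induction A rule: infinite_finite_induct) (simp_all add: unit_1 unit_mult)

lemma unit_prod_factor:
  assumes "unit (prod g A)" "finite A" "i \<in> A"
  shows "unit (g i)"
  using assms by (metis prod.remove unit_factor)

lemma unit_minus_one_power: "unit ((-1) ^ k)"
  unfolding unit_def by (intro exI[of _ "(-1) ^ k"]) simp

lemma unit_cancel:
  assumes "unit x" "x * y \<approx> x * u"
  shows "y \<approx> u"
proof -
  obtain x' where x': "x * x' \<approx> 1" using assms(1) unfolding unit_def by blast
  have "v \<approx> x' * (x * v)" for v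
    using mult[OF x' refl, of v] sym by (simp add: mult_ac)
  then show ?thesis using mult[OF refl assms(2), of x'] by (meson sym trans)
qed

lemma times_one: "p \<approx> 1 \<Longrightarrow> x * p \<approx> x"
  using mult[of x x p 1] by simp

end

text \<open>By \<open>tail_S_T\<close> the determinants are, up to sign, products of the \<open>z\<^sub>j\<close> and \<open>Q\<^sub>j\<close>.\<close>

lemma (in ring_congruence) tail_units:
  assumes "n \<ge> 2" "\<And>j. j \<in> {1..n} \<Longrightarrow> unit (z j)" "\<And>j. j \<in> {1..n-1} \<Longrightarrow> unit (Q j)" "i \<in> {1..n}"
  defines "f \<equiv> coeff (tail_poly n z Q 0)" and "w \<equiv> coeff (tail_poly n z Q 1)"
  shows "unit (T_det n f w i) \<and> unit (S_det n f w i)"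
proof -
  have "1 \<le> i" "i \<le> n" using assms by simp_all
  then show ?thesis
  proof (induction rule: dec_induct)
    case base
    have "unit (T_det n f w 1)"
      unfolding f_def w_def T_det_1[OF \<open>n \<ge> 2\<close>] by (rule unit_minus_one_power)
    then show ?case
      using tail_S_T(2)[of 1 n z Q] assms(1,2) by (auto simp: f_def w_def intro!: unit_mult unit_prod)
  next
    case (step i)
    have "unit (T_det n f w (Suc i))"
      using tail_S_T(1)[of "Suc i" n z Q] assms(2,3) step
      by (auto simp: f_def w_def intro!: unit_mult unit_prod unit_minus_one_power)
    then show ?case
      using tail_S_T(2)[of "Suc i" n z Q] assms(2) step
      by (auto simp: f_def w_def intro!: unit_mult unit_prod)
  qed
qed

section \<open>Quotients of subrings of a commutative ring\<close>

lemma ring_on_simps [simp]: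
  "carrier (ring_on A) = A" "x \<otimes>\<^bsub>ring_on A\<^esub> y = x * y" "x \<oplus>\<^bsub>ring_on A\<^esub> y = x + y"
  "\<zero>\<^bsub>ring_on A\<^esub> = 0" "\<one>\<^bsub>ring_on A\<^esub> = 1"
  by (simp_all add: ring_on_def)

lemma ring_on_cring:
  assumes "0 \<in> A" "1 \<in> A" "\<And>x y. x \<in> A \<Longrightarrow> y \<in> A \<Longrightarrow> x + y \<in> A"
    "\<And>x y. x \<in> A \<Longrightarrow> y \<in> A \<Longrightarrow> x * y \<in> A" "\<And>x. x \<in> A \<Longrightarrow> - x \<in> A"
  shows "cring (ring_on A)"
proof (intro cringI abelian_groupI comm_monoidI)
  fix x assume "x \<in> carrier (ring_on A)"
  then show "\<exists>y\<in>carrier (ring_on A). y \<oplus>\<^bsub>ring_on A\<^esub> x = \<zero>\<^bsub>ring_on A\<^esub>"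
    using assms(5) by (intro bexI[of _ "- x"]) simp_all
qed (simp_all add: assms algebra_simps)

context
  fixes A :: "'a::comm_ring_1 set" and J
  assumes cring: "cring (ring_on A)" and ideal: "ideal J (ring_on A)"
begin

interpretation cring "ring_on A" by (rule cring)
interpretation ideal J "ring_on A" by (rule ideal)

lemma ring_on_minus:
  assumes "x \<in> A" "y \<in> A" shows "x \<ominus>\<^bsub>ring_on A\<^esub> y = x - y"
proof -
  have y: "\<ominus>\<^bsub>ring_on A\<^esub> y \<in> A" using assms abelian_group.a_inv_closed[OF is_abelian_group, of y] by simp
  have "\<ominus>\<^bsub>ring_on A\<^esub> y + y = 0" using l_neg[of y] assms by simp
  then have "\<ominus>\<^bsub>ring_on A\<^esub> y = - y" by (simp add: eq_neg_iff_add_eq_0)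
  then show ?thesis by (simp add: a_minus_def)
qed

lemma ring_on_coset_eq_iff:
  assumes "x \<in> A" "y \<in> A"
  shows "J +>\<^bsub>ring_on A\<^esub> x = J +>\<^bsub>ring_on A\<^esub> y \<longleftrightarrow> x - y \<in> J"
  using quotient_eq_iff_same_a_r_cos[OF ideal, of x y] ring_on_minus[OF assms] assms by simp

lemma ring_on_coset: "J +>\<^bsub>ring_on A\<^esub> x = (\<lambda>i. i + x) ` J"
  by (auto simp: a_r_coset_def')

lemma ring_on_Quot_carrier: "carrier (ring_on A Quot J) = (\<lambda>x. J +>\<^bsub>ring_on A\<^esub> x) ` A"
  by (auto simp: FactRing_def A_RCOSETS_def')

lemma ring_on_Quot_hom:
  assumes "x \<in> A" "y \<in> A"
  shows "(J +>\<^bsub>ring_on A\<^esub> x) \<otimes>\<^bsub>ring_on A Quot J\<^esub> (J +>\<^bsub>ring_on A\<^esub> y) = J +>\<^bsub>ring_on A\<^esub> (x * y)"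
    and "(J +>\<^bsub>ring_on A\<^esub> x) \<oplus>\<^bsub>ring_on A Quot J\<^esub> (J +>\<^bsub>ring_on A\<^esub> y) = J +>\<^bsub>ring_on A\<^esub> (x + y)"
    and "\<one>\<^bsub>ring_on A Quot J\<^esub> = J +>\<^bsub>ring_on A\<^esub> 1"
  using ring_hom_mult[OF rcos_ring_hom, of x y] ring_hom_add[OF rcos_ring_hom, of x y]
    ring_hom_one[OF rcos_ring_hom] assms by simp_all

lemma ring_on_ideal_closed:
  shows "J \<subseteq> A" and "0 \<in> J" and "x \<in> J \<Longrightarrow> y \<in> J \<Longrightarrow> x + y \<in> J"
    and "x \<in> J \<Longrightarrow> p \<in> A \<Longrightarrow> p * x \<in> J"
  using a_subset zero_closed a_closed[of x y] I_l_closed[of x p] by simp_all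

end

section \<open>The coordinate ring of Z\<close>

definition zQU_vars :: "nat \<Rightarrow> zQ_var set" where
  "zQU_vars n = Zv ` {1..n} \<union> Qv ` {1..n-1} \<union> {Uv}"

lemma zQU_ring_eq: "zQU_ring n = ring_on (polys_in (zQU_vars n))"
  by (simp add: zQU_ring_def zQU_vars_def)

lemma polys_in_cring: "cring (ring_on (polys_in V))"
  by (intro ring_on_cring polys_in_intros) auto

text \<open>A retraction onto the polynomials in the variables of \<open>Z\<^sub>\<gamma>\<degree>\<close>.  It extends congruence modulo the ideal to all
polynomials of the type, so that no membership in the subring has to be tracked.\<close>

definition restrict_vars :: "nat \<Rightarrow> zQ_var cpoly \<Rightarrow> zQ_var cpoly" where
  "restrict_vars n = eval_via Const (\<lambda>v. if v \<in> zQU_vars n then Var v else 0)"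

lemma restrict_vars_hom: "comm_ring_hom (restrict_vars n)"
  unfolding restrict_vars_def by (intro eval_via_hom Const_hom)

interpretation restrict_vars: comm_ring_hom "restrict_vars n" for n by (rule restrict_vars_hom)

lemma restrict_vars_Const: "restrict_vars n (Const k) = Const k"
  by (simp add: restrict_vars_def eval_via_Const[OF Const_hom])

lemma restrict_vars_Var: "restrict_vars n (Var v) = (if v \<in> zQU_vars n then Var v else 0)"
  by (simp add: restrict_vars_def eval_via_Var[OF Const_hom])

lemma restrict_vars_polys_in: "restrict_vars n p \<in> polys_in (zQU_vars n)"
  unfolding restrict_vars_def eval_via_def by (intro polys_in_intros) (auto intro: polys_in_intros)

lemma restrict_vars_id: "p \<in> polys_in (zQU_vars n) \<Longrightarrow> restrict_vars n p = p"
  by (induction rule: polys_in_induct)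
    (simp_all add: restrict_vars_Const restrict_vars_Var hom_distribs)

definition point_eval :: "nat \<Rightarrow> (nat \<Rightarrow> complex) \<times> (nat \<Rightarrow> complex) \<Rightarrow> zQ_var cpoly \<Rightarrow> complex" where
  "point_eval n x p = peval (zQU_assignment n x) (restrict_vars n p)"

lemma point_eval_hom: "comm_ring_hom (point_eval n x)"
proof -
  interpret peval: comm_ring_hom "peval (zQU_assignment n x)" by (rule peval_hom)
  show ?thesis by unfold_locales (simp_all add: point_eval_def hom_distribs)
qed

interpretation point_eval: comm_ring_hom "point_eval n x" for n x by (rule point_eval_hom)

lemma point_eval_polys_in:
  "p \<in> polys_in (zQU_vars n) \<Longrightarrow> point_eval n x p = peval (zQU_assignment n x) p"
  by (simp add: point_eval_def restrict_vars_id)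

lemma point_eval_restrict_vars: "point_eval n x (restrict_vars n p) = point_eval n x p"
  by (simp add: point_eval_def restrict_vars_id restrict_vars_polys_in)

lemma point_eval_Const: "point_eval n x (Const k) = k"
  by (simp add: point_eval_def restrict_vars_Const peval_eq_eval_via eval_via_Const[OF identity_hom])

lemma point_eval_Var:
  "v \<in> zQU_vars n \<Longrightarrow> point_eval n x (Var v) = zQU_assignment n x v"
  by (simp add: point_eval_def restrict_vars_Var peval_eq_eval_via eval_via_Var[OF identity_hom])

abbreviation "zV \<equiv> \<lambda>j. Var (Zv j)"
abbreviation "QV \<equiv> \<lambda>j. Var (Qv j)"

definition Zo_gens :: "nat \<Rightarrow> (nat \<Rightarrow> complex) \<Rightarrow> zQ_var cpoly set" where
  "Zo_gens n \<gamma> = {F n i zV QV - Const (\<gamma> i) | i. i \<in> {1..n}}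
      \<union> {Var Uv * (\<Prod>j\<in>{1..n-1}. QV j) - 1}"

lemma Zo_gens_polys_in: "Zo_gens n \<gamma> \<subseteq> polys_in (zQU_vars n)"
proof -
  have var: "Var v \<in> polys_in (zQU_vars n)" if "v \<in> zQU_vars n" for v
    using that by (rule polys_in_Var)
  have "F n i zV QV \<in> polys_in (zQU_vars n)" for i
  proof -
    have "F n i (\<lambda>j. restrict_vars n (zV j)) (\<lambda>j. restrict_vars n (QV j)) = F n i zV QV"
      by (rule F_cong) (auto simp: restrict_vars_Var zQU_vars_def)
    then show ?thesis
      using restrict_vars_polys_in[of n "F n i zV QV"] by (simp add: hom_F[OF restrict_vars_hom])
  qed
  then show ?thesis
    by (auto simp: Zo_gens_def zQU_vars_def intro!: polys_in_intros)
qed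

lemma Zo_ideal_eq: "Zo_ideal n \<gamma> = genideal (ring_on (polys_in (zQU_vars n))) (Zo_gens n \<gamma>)"
  by (simp add: Zo_ideal_def Zo_gens_def zQU_ring_eq)

lemma Zo_ideal_ideal: "ideal (Zo_ideal n \<gamma>) (ring_on (polys_in (zQU_vars n)))"
  unfolding Zo_ideal_eq using Zo_gens_polys_in
  by (intro ring.genideal_ideal cring.axioms(1) polys_in_cring) simp

lemma Zo_gens_in_ideal: "Zo_gens n \<gamma> \<subseteq> Zo_ideal n \<gamma>"
  unfolding Zo_ideal_eq using Zo_gens_polys_in
  by (intro ring.genideal_self cring.axioms(1) polys_in_cring) simp

lemmas Zo_ideal_closed = ring_on_ideal_closed[OF polys_in_cring Zo_ideal_ideal]

lemma point_eval_F:
  "point_eval n (z, Q) (F n i zV QV) = F n i z Q"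
  unfolding hom_F[OF point_eval_hom]
  by (intro F_cong) (simp_all add: point_eval_Var zQU_vars_def)

text \<open>The polynomials that vanish at a point form an ideal, which contains the generators.\<close>

lemma Zo_ideal_vanishes:
  assumes x: "x \<in> Zo_points n \<gamma>" and p: "p \<in> Zo_ideal n \<gamma>"
  shows "point_eval n x p = 0"
proof -
  let ?R = "ring_on (polys_in (zQU_vars n))" and ?C = "ring_on (UNIV :: complex set)"
  have C: "cring ?C" by (rule ring_on_cring) simp_all
  interpret ring_hom_ring ?R ?C "point_eval n x"
    by (rule ring_hom_ringI)
      (simp_all add: cring.axioms(1) polys_in_cring C hom_distribs)
  obtain z Q where zQ: "x = (z, Q)" by (cases x)
  have "(\<Prod>j\<in>{1..n-1}. point_eval n x (QV j)) = (\<Prod>j\<in>{1..n-1}. Q j)"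
    by (intro prod.cong) (auto simp: zQ point_eval_Var zQU_vars_def)
  moreover have "(\<Prod>j\<in>{1..n-1}. Q j) \<noteq> 0" using x by (auto simp: Zo_points_def zQ)
  ultimately have "point_eval n x (Var Uv * (\<Prod>j\<in>{1..n-1}. QV j) - 1) = 0"
    by (simp add: hom_distribs point_eval_Var zQU_vars_def zQ)
  moreover have "point_eval n x (F n i zV QV - Const (\<gamma> i)) = 0" if "i \<in> {1..n}" for i
    using x that by (auto simp: zQ hom_distribs point_eval_F point_eval_Const Zo_points_def Z_points_def)
  ultimately have "point_eval n x g = 0" if "g \<in> Zo_gens n \<gamma>" for g
    using that unfolding Zo_gens_def by blast
  then have "Zo_gens n \<gamma> \<subseteq> a_kernel ?R ?C (point_eval n x)"
    using Zo_gens_polys_in[of n \<gamma>] unfolding a_kernel_def' ring_on_simps by blast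
  then have "Zo_ideal n \<gamma> \<subseteq> a_kernel ?R ?C (point_eval n x)"
    unfolding Zo_ideal_eq by (intro R.genideal_minimal kernel_is_ideal)
  then show ?thesis using p unfolding a_kernel_def' ring_on_simps by blast
qed

definition zQ_cong :: "nat \<Rightarrow> (nat \<Rightarrow> complex) \<Rightarrow> zQ_var cpoly \<Rightarrow> zQ_var cpoly \<Rightarrow> bool" where
  "zQ_cong n \<gamma> p q \<longleftrightarrow> restrict_vars n (p - q) \<in> Zo_ideal n \<gamma>"

interpretation zQ_cong: ring_congruence "zQ_cong n \<gamma>" for n \<gamma>
proof
  have mult: "p * q \<in> Zo_ideal n \<gamma>" if "q \<in> Zo_ideal n \<gamma>" "p = restrict_vars n p'" for p q p'
    using that restrict_vars_polys_in Zo_ideal_closed(4) by blast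
  fix x y u v
  show "zQ_cong n \<gamma> x x" by (simp add: zQ_cong_def Zo_ideal_closed(2) hom_distribs)
  show "zQ_cong n \<gamma> y x" if "zQ_cong n \<gamma> x y"
    using mult[of "restrict_vars n (x - y)" "- 1" "- 1"] that by (simp add: zQ_cong_def hom_distribs)
  show "zQ_cong n \<gamma> x u" if "zQ_cong n \<gamma> x y" "zQ_cong n \<gamma> y u"
    using Zo_ideal_closed(3)[OF that[unfolded zQ_cong_def]] by (simp add: zQ_cong_def hom_distribs)
  show "zQ_cong n \<gamma> (x + u) (y + v)" if "zQ_cong n \<gamma> x y" "zQ_cong n \<gamma> u v"
    using Zo_ideal_closed(3)[OF that[unfolded zQ_cong_def]]
    by (simp add: zQ_cong_def hom_distribs algebra_simps)
  show "zQ_cong n \<gamma> (x * u) (y * v)" if "zQ_cong n \<gamma> x y" "zQ_cong n \<gamma> u v"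
  proof -
    have "restrict_vars n u * restrict_vars n (x - y) + restrict_vars n y * restrict_vars n (u - v)
        \<in> Zo_ideal n \<gamma>"
      using that by (intro Zo_ideal_closed(3) mult) (auto simp: zQ_cong_def)
    then show ?thesis by (simp add: zQ_cong_def hom_distribs algebra_simps)
  qed
qed

lemma zQ_cong_gens: "p - q \<in> Zo_gens n \<gamma> \<Longrightarrow> zQ_cong n \<gamma> p q"
  unfolding zQ_cong_def
  by (subst restrict_vars_id) (use Zo_gens_in_ideal Zo_gens_polys_in in blast)+

lemma zQ_cong_F: "i \<in> {1..n} \<Longrightarrow> zQ_cong n \<gamma> (F n i zV QV) (Const (\<gamma> i))"
  by (rule zQ_cong_gens) (auto simp: Zo_gens_def)

lemma zQ_cong_U: "zQ_cong n \<gamma> (Var Uv * (\<Prod>j\<in>{1..n-1}. QV j)) 1"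
  by (rule zQ_cong_gens) (auto simp: Zo_gens_def)

lemma zQ_cong_polys_in:
  "p \<in> polys_in (zQU_vars n) \<Longrightarrow> q \<in> polys_in (zQU_vars n) \<Longrightarrow> zQ_cong n \<gamma> p q \<longleftrightarrow> p - q \<in> Zo_ideal n \<gamma>"
  by (simp add: zQ_cong_def restrict_vars_id polys_in_diff)

lemma zQ_cong_point_eval:
  assumes "x \<in> Zo_points n \<gamma>" "zQ_cong n \<gamma> p q"
  shows "point_eval n x p = point_eval n x q"
proof -
  have "point_eval n x (restrict_vars n (p - q)) = 0"
    using assms by (intro Zo_ideal_vanishes) (auto simp: zQ_cong_def)
  then show ?thesis by (simp add: point_eval_restrict_vars hom_distribs)
qed

section \<open>The universal point of Z\<close>

lemma coeff_f_poly:
  assumes "i \<in> {1..n}" shows "coeff (f_poly n \<gamma>) (n - i) = (-1) ^ i * \<gamma> i"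
proof -
  have "coeff (f_poly n \<gamma>) (n - i) = (\<Sum>k\<in>{1..n}. if k = i then (-1) ^ i * \<gamma> i else 0)"
  proof -
    have "n - k = n - i \<longleftrightarrow> k = i" if "k \<in> {1..n}" for k using that assms by auto
    then have "(\<Sum>k\<in>{1..n}. coeff (Polynomial.monom ((-1) ^ k * \<gamma> k) (n - k)) (n - i))
        = (\<Sum>k\<in>{1..n}. if k = i then (-1) ^ i * \<gamma> i else 0)"
      by (intro sum.cong) (auto simp: coeff_monom)
    moreover have "n \<noteq> n - i" using assms by auto
    ultimately show ?thesis unfolding f_poly_def coeff_add coeff_sum by (simp add: coeff_monom)
  qed
  then show ?thesis using assms by simp
qed

lemma f_poly_monic: "coeff (f_poly n \<gamma>) n = 1" and degree_f_poly: "degree (f_poly n \<gamma>) \<le> n"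
proof -
  have "coeff (\<Sum>i\<in>{1..n}. Polynomial.monom ((-1) ^ i * \<gamma> i) (n - i)) j = 0" if "j \<ge> n" for j
    using that by (auto simp: coeff_sum coeff_monom intro!: sum.neutral)
  then show "coeff (f_poly n \<gamma>) n = 1" "degree (f_poly n \<gamma>) \<le> n"
    by (auto simp: f_poly_def coeff_monom intro!: degree_le)
qed

text \<open>The variable type is left open: these constants are needed both in the coordinates of \<open>Z\<^sub>\<gamma>\<degree>\<close> and in those
of \<open>\<O>\<^sub>\<gamma>\<close>.\<close>

definition univ_f :: "nat \<Rightarrow> (nat \<Rightarrow> complex) \<Rightarrow> nat \<Rightarrow> 'v cpoly" where
  "univ_f n \<gamma> i = Const (coeff (f_poly n \<gamma>) i)"

definition univ_w :: "nat \<Rightarrow> nat \<Rightarrow> zQ_var cpoly" where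
  "univ_w n = coeff (tail_poly n zV QV 1)"

text \<open>Modulo the ideal, the monic polynomial with coefficients \<open>\<plusminus>F\<^sub>i(z, Q)\<close> becomes \<open>f_poly n \<gamma>\<close>.\<close>

lemma univ_f_cong: "zQ_cong n \<gamma> (coeff (tail_poly n zV QV 0) i) (univ_f n \<gamma> i)"
proof -
  consider "i > n" | "i = n" | "i < n" by linarith
  then show ?thesis
  proof cases
    case 1
    then show ?thesis
      using coeff_eq_0[of "f_poly n \<gamma>" i] degree_f_poly[of n \<gamma>]
      by (simp add: univ_f_def coeff_tail_poly_beyond)
  next
    case 2
    then show ?thesis using tail_poly_ends[of 0 n zV QV] by (simp add: univ_f_def f_poly_monic)
  next
    case 3
    define j where "j = n - i"
    have j: "j \<in> {1..n}" "i = n - j" using 3 by (auto simp: j_def)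
    have "zQ_cong n \<gamma> ((-1) ^ j * F n j zV QV) ((-1) ^ j * Const (\<gamma> j))"
      using j by (intro zQ_cong.mult zQ_cong_F) auto
    then show ?thesis
      using j coeff_tail_poly_0[of j n zV QV] coeff_f_poly[of j n \<gamma>]
      by (simp add: univ_f_def hom_distribs)
  qed
qed

definition univ_T :: "nat \<Rightarrow> (nat \<Rightarrow> complex) \<Rightarrow> nat \<Rightarrow> zQ_var cpoly" where
  "univ_T n \<gamma> i = T_det n (univ_f n \<gamma>) (univ_w n) i"

definition univ_S :: "nat \<Rightarrow> (nat \<Rightarrow> complex) \<Rightarrow> nat \<Rightarrow> zQ_var cpoly" where
  "univ_S n \<gamma> i = S_det n (univ_f n \<gamma>) (univ_w n) i"

context
  fixes n :: nat and \<gamma> :: "nat \<Rightarrow> complex"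
  assumes n: "n \<ge> 2" and \<gamma>: "\<gamma> n = 1"
begin

private abbreviation eqv (infix \<open>\<approx>\<close> 50) where "eqv \<equiv> zQ_cong n \<gamma>"

lemma univ_prod_z: "(\<Prod>j\<in>{1..n}. zV j) \<approx> 1"
proof -
  show ?thesis using zQ_cong_F[of n n \<gamma>] prod_z_eq[of n zV QV] n \<gamma> by simp
qed

text \<open>The identities for \<open>S\<close> and \<open>T\<close> hold exactly if one reduces modulo \<open>tail_poly n zV QV 0\<close>; this replaces that
polynomial by \<open>f_poly n \<gamma>\<close>.\<close>

lemma univ_T_cong: "T_det n (coeff (tail_poly n zV QV 0)) (univ_w n) i \<approx> univ_T n \<gamma> i"
  and univ_S_cong: "S_det n (coeff (tail_poly n zV QV 0)) (univ_w n) i \<approx> univ_S n \<gamma> i"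
  unfolding univ_T_def univ_S_def
  by (intro zQ_cong.T_det zQ_cong.S_det univ_f_cong zQ_cong.refl)+

lemma univ_z_relation:
  assumes "1 \<le> i" "i \<le> n"
  shows "univ_T n \<gamma> (i - 1) * univ_S n \<gamma> i * zV i \<approx> univ_S n \<gamma> (i - 1) * univ_T n \<gamma> i"
proof -
  let ?f = "coeff (tail_poly n zV QV 0)" and ?w = "univ_w n"
  have "univ_T n \<gamma> (i - 1) * univ_S n \<gamma> i * zV i \<approx> T_det n ?f ?w (i - 1) * S_det n ?f ?w i * zV i"
    by (intro zQ_cong.mult zQ_cong.sym[OF univ_T_cong] zQ_cong.sym[OF univ_S_cong] zQ_cong.refl)
  also have "\<dots> = S_det n ?f ?w (i - 1) * T_det n ?f ?w i * (if i = 1 then \<Prod>j\<in>{1..n}. zV j else 1)"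
    using tail_z_relation[OF n assms, of zV QV] by (simp add: univ_w_def)
  also have "\<dots> \<approx> S_det n ?f ?w (i - 1) * T_det n ?f ?w i"
    using univ_prod_z by (intro zQ_cong.times_one) simp
  also have "\<dots> \<approx> univ_S n \<gamma> (i - 1) * univ_T n \<gamma> i"
    by (intro zQ_cong.mult univ_T_cong univ_S_cong)
  finally show ?thesis .
qed

lemma univ_Q_relation:
  assumes "1 \<le> i" "i < n"
  shows "(univ_T n \<gamma> i)\<^sup>2 * QV i \<approx> univ_T n \<gamma> (Suc i) * univ_T n \<gamma> (i - 1)"
proof -
  let ?f = "coeff (tail_poly n zV QV 0)" and ?w = "univ_w n"
  have "(univ_T n \<gamma> i)\<^sup>2 * QV i \<approx> (T_det n ?f ?w i)\<^sup>2 * QV i"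
    by (intro zQ_cong.mult zQ_cong.power zQ_cong.sym[OF univ_T_cong] zQ_cong.refl)
  also have "\<dots> \<approx> (T_det n ?f ?w i)\<^sup>2 * QV i * (if i = 1 then \<Prod>j\<in>{1..n}. zV j else 1)"
    using univ_prod_z by (intro zQ_cong.sym[OF zQ_cong.times_one]) simp
  also have "\<dots> = T_det n ?f ?w (Suc i) * T_det n ?f ?w (i - 1)"
    using tail_Q_relation[OF n assms, of zV QV] by (simp add: univ_w_def)
  also have "\<dots> \<approx> univ_T n \<gamma> (Suc i) * univ_T n \<gamma> (i - 1)"
    by (intro zQ_cong.mult univ_T_cong)
  finally show ?thesis .
qed

lemma univ_U_relation: "univ_T n \<gamma> n * Var Uv \<approx> univ_T n \<gamma> 1 * univ_T n \<gamma> (n - 1)"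
proof -
  let ?f = "coeff (tail_poly n zV QV 0)" and ?w = "univ_w n"
  have "univ_T n \<gamma> n * Var Uv \<approx> T_det n ?f ?w n * Var Uv"
    by (intro zQ_cong.mult zQ_cong.sym[OF univ_T_cong] zQ_cong.refl)
  also have "\<dots> = T_det n ?f ?w 1 * T_det n ?f ?w (n - 1) * (Var Uv * (\<Prod>j\<in>{1..n-1}. QV j)) * (\<Prod>j\<in>{1..n}. zV j)"
    using tail_U_relation[OF n, of zV QV] by (simp add: univ_w_def mult_ac)
  also have "\<dots> \<approx> T_det n ?f ?w 1 * T_det n ?f ?w (n - 1) * (Var Uv * (\<Prod>j\<in>{1..n-1}. QV j))"
    using univ_prod_z by (rule zQ_cong.times_one)
  also have "\<dots> \<approx> T_det n ?f ?w 1 * T_det n ?f ?w (n - 1)"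
    using zQ_cong_U by (rule zQ_cong.times_one)
  also have "\<dots> \<approx> univ_T n \<gamma> 1 * univ_T n \<gamma> (n - 1)"
    by (intro zQ_cong.mult univ_T_cong)
  finally show ?thesis .
qed

text \<open>\<open>z\<^sub>1 \<cdots> z\<^sub>n \<equiv> 1\<close> and \<open>U Q\<^sub>1 \<cdots> Q\<^bsub>n-1\<^esub> \<equiv> 1\<close> make all variables units.\<close>

lemma univ_units:
  assumes "i \<in> {1..n}"
  shows "zQ_cong.unit n \<gamma> (univ_T n \<gamma> i)" and "zQ_cong.unit n \<gamma> (univ_S n \<gamma> i)"
proof -
  have "zQ_cong.unit n \<gamma> (\<Prod>j\<in>{1..n}. zV j)"
    using zQ_cong.unit_cong[OF univ_prod_z] zQ_cong.unit_1 by blast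
  then have z: "zQ_cong.unit n \<gamma> (zV j)" if "j \<in> {1..n}" for j
    using that by (intro zQ_cong.unit_prod_factor[where g = zV and A = "{1..n}"]) simp_all
  have "zQ_cong.unit n \<gamma> (Var Uv * (\<Prod>j\<in>{1..n-1}. QV j))"
    using zQ_cong.unit_cong[OF zQ_cong_U] zQ_cong.unit_1 by blast
  then have "zQ_cong.unit n \<gamma> ((\<Prod>j\<in>{1..n-1}. QV j) * Var Uv)" by (simp only: mult.commute)
  then have "zQ_cong.unit n \<gamma> (\<Prod>j\<in>{1..n-1}. QV j)" by (rule zQ_cong.unit_factor)
  then have Q: "zQ_cong.unit n \<gamma> (QV j)" if "j \<in> {1..n-1}" for j
    using that by (intro zQ_cong.unit_prod_factor[where g = QV and A = "{1..n-1}"]) simp_all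
  have "zQ_cong.unit n \<gamma> (T_det n (coeff (tail_poly n zV QV 0)) (univ_w n) i)
      \<and> zQ_cong.unit n \<gamma> (S_det n (coeff (tail_poly n zV QV 0)) (univ_w n) i)"
    unfolding univ_w_def by (rule zQ_cong.tail_units[OF n z Q assms])
  then show "zQ_cong.unit n \<gamma> (univ_T n \<gamma> i)" "zQ_cong.unit n \<gamma> (univ_S n \<gamma> i)"
    using zQ_cong.unit_cong[OF univ_T_cong, of i] zQ_cong.unit_cong[OF univ_S_cong, of i] by blast+
qed

end

section \<open>Coordinates on the algebra O\<close>

lemma complex_poly_cring: "cring (ring_on (UNIV :: complex poly set))"
  by (rule ring_on_cring) simp_all

lemma f_ideal_eq: "f_ideal n \<gamma> = {p. f_poly n \<gamma> dvd p}"
proof -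
  interpret cring "ring_on (UNIV :: complex poly set)" by (rule complex_poly_cring)
  have "f_ideal n \<gamma> = cgenideal (ring_on UNIV) (f_poly n \<gamma>)"
    unfolding f_ideal_def by (simp add: cgenideal_eq_genideal)
  then show ?thesis by (auto simp: cgenideal_def dvd_def mult.commute)
qed

lemma f_ideal_ideal: "ideal (f_ideal n \<gamma>) (ring_on UNIV)"
  unfolding f_ideal_def
  by (intro ring.genideal_ideal cring.axioms(1) complex_poly_cring) simp

lemma residue_class_eq_iff:
  "residue_class n \<gamma> p = residue_class n \<gamma> q \<longleftrightarrow> f_poly n \<gamma> dvd p - q"
  unfolding residue_class_def
  using ring_on_coset_eq_iff[OF complex_poly_cring f_ideal_ideal, of p q] by (simp add: f_ideal_eq)

lemma O_alg_carrier: "carrier (O_alg n \<gamma>) = range (residue_class n \<gamma>)"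
  unfolding O_alg_def residue_class_def
  by (rule ring_on_Quot_carrier[OF complex_poly_cring f_ideal_ideal])

lemma residue_class_mult:
  "residue_class n \<gamma> p \<otimes>\<^bsub>O_alg n \<gamma>\<^esub> residue_class n \<gamma> q = residue_class n \<gamma> (p * q)"
  and residue_class_add:
  "residue_class n \<gamma> p \<oplus>\<^bsub>O_alg n \<gamma>\<^esub> residue_class n \<gamma> q = residue_class n \<gamma> (p + q)"
  unfolding O_alg_def residue_class_def
  by (simp_all add: ring_on_Quot_hom[OF complex_poly_cring f_ideal_ideal])

lemma O_alg_zero: "\<zero>\<^bsub>O_alg n \<gamma>\<^esub> = residue_class n \<gamma> 0"
  by (simp add: O_alg_def FactRing_def residue_class_def
      ring_on_coset[OF complex_poly_cring f_ideal_ideal])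

lemma scale_residue_class: "scale_O n \<gamma> k (residue_class n \<gamma> p) = residue_class n \<gamma> (smult k p)"
  by (simp add: scale_O_def residue_class_mult)

lemma line_residue_class: "line n \<gamma> (residue_class n \<gamma> p) = {residue_class n \<gamma> (smult k p) | k. True}"
  by (simp add: line_def scale_residue_class)

abbreviation f_coeff :: "nat \<Rightarrow> (nat \<Rightarrow> complex) \<Rightarrow> nat \<Rightarrow> complex" where
  "f_coeff n \<gamma> \<equiv> coeff (f_poly n \<gamma>)"

definition coords :: "nat \<Rightarrow> (nat \<Rightarrow> complex) \<Rightarrow> complex poly \<Rightarrow> nat \<Rightarrow> complex" where
  "coords n \<gamma> p = reduce n (f_coeff n \<gamma>) p"

lemma coords_low_degree:
  assumes "\<And>i. i \<ge> n \<Longrightarrow> coeff p i = 0" shows "coords n \<gamma> p = coeff p"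
  unfolding coords_def using assms by (rule reduce_low_degree)

lemma coords_smult: "coords n \<gamma> (smult k p) = (\<lambda>i. k * coords n \<gamma> p i)"
  by (simp add: coords_def reduce_smult fun_eq_iff)

context
  fixes n :: nat and \<gamma> :: "nat \<Rightarrow> complex"
  assumes n: "n > 0"
begin

lemma coords_cong:
  assumes "residue_class n \<gamma> p = residue_class n \<gamma> q" shows "coords n \<gamma> p = coords n \<gamma> q"
proof
  fix i
  have "reduce n (f_coeff n \<gamma>) (p - q) i = 0"
    using assms by (intro reduce_dvd_eq_0 n f_poly_monic degree_f_poly) (simp add: residue_class_eq_iff)
  then show "coords n \<gamma> p i = coords n \<gamma> q i" by (simp add: coords_def reduce_diff)
qed

lemma f_poly_mod: "i \<ge> n \<Longrightarrow> coeff (p mod f_poly n \<gamma>) i = 0"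
proof -
  assume i: "i \<ge> n"
  have "f_poly n \<gamma> \<noteq> 0" using f_poly_monic[of n \<gamma>] by auto
  moreover have "degree (f_poly n \<gamma>) = n"
    using degree_f_poly[of n \<gamma>] le_degree[of "f_poly n \<gamma>" n] f_poly_monic[of n \<gamma>] by simp
  ultimately have "p mod f_poly n \<gamma> = 0 \<or> degree (p mod f_poly n \<gamma>) < n"
    using degree_mod_less[of "f_poly n \<gamma>" p] by simp
  then show ?thesis using i coeff_eq_0[of "p mod f_poly n \<gamma>" i] by auto
qed

lemma residue_class_mod: "residue_class n \<gamma> (p mod f_poly n \<gamma>) = residue_class n \<gamma> p"
  by (simp add: residue_class_eq_iff mod_eq_dvd_iff[symmetric])

lemma coords_eq_coeff_mod: "coords n \<gamma> p = coeff (p mod f_poly n \<gamma>)"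
  using coords_cong[OF residue_class_mod, of p] coords_low_degree[of n "p mod f_poly n \<gamma>" \<gamma>] f_poly_mod[of _ p]
  by simp

lemma residue_class_coords: "residue_class n \<gamma> (\<Sum>j<n. Polynomial.monom (coords n \<gamma> p j) j) = residue_class n \<gamma> p"
proof -
  have "(\<Sum>j<n. Polynomial.monom (coords n \<gamma> p j) j) = p mod f_poly n \<gamma>"
    using f_poly_mod[of _ p]
    by (intro poly_eqI) (auto simp: coeff_sum coeff_monom coords_eq_coeff_mod not_less)
  then show ?thesis by (simp add: residue_class_mod)
qed

lemma coords_beyond: "i \<ge> n \<Longrightarrow> coords n \<gamma> p i = 0"
  by (simp add: coords_eq_coeff_mod f_poly_mod)

lemma coords_monom_mult:
  "coords n \<gamma> (p * Polynomial.monom 1 j) = (times_zeta n (f_coeff n \<gamma>) ^^ j) (coords n \<gamma> p)"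
proof (induction j)
  case 0 then show ?case by (simp add: monom_0)
next
  case (Suc j)
  have "p * Polynomial.monom 1 (Suc j) = pCons 0 (p * Polynomial.monom 1 j)"
    by (simp add: monom_Suc)
  then show ?case
    by (intro ext) (simp add: coords_def reduce_pCons Suc[unfolded coords_def])
qed

end

text \<open>The matrix of \<open>c\<close> with respect to the basis \<open>1, \<zeta>, \<dots>, \<zeta>\<^bsup>n-1\<^esup>\<close>.\<close>

definition c_matrix :: "nat \<Rightarrow> (nat \<Rightarrow> complex) \<Rightarrow> (complex poly set \<Rightarrow> complex vec) \<Rightarrow> complex mat" where
  "c_matrix n \<gamma> c = mat n n (\<lambda>(i, j). c (residue_class n \<gamma> (Polynomial.monom 1 j)) $ i)"

context
  fixes n :: nat and \<gamma> :: "nat \<Rightarrow> complex" and c :: "complex poly set \<Rightarrow> complex vec"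
  assumes n: "n > 0" and c: "is_linear_iso n \<gamma> c"
begin

lemma c_bij: "bij_betw c (carrier (O_alg n \<gamma>)) (carrier_vec n)"
  and c_add: "c (residue_class n \<gamma> (p + q)) = c (residue_class n \<gamma> p) + c (residue_class n \<gamma> q)"
  and c_smult: "c (residue_class n \<gamma> (smult k p)) = k \<cdot>\<^sub>v c (residue_class n \<gamma> p)"
  and c_carrier: "c (residue_class n \<gamma> p) \<in> carrier_vec n"
proof -
  show bij: "bij_betw c (carrier (O_alg n \<gamma>)) (carrier_vec n)"
    using c by (simp add: is_linear_iso_def)
  have res: "residue_class n \<gamma> p \<in> carrier (O_alg n \<gamma>)" for p by (simp add: O_alg_carrier)
  show "c (residue_class n \<gamma> (p + q)) = c (residue_class n \<gamma> p) + c (residue_class n \<gamma> q)"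
    using c res[of p] res[of q] by (simp add: is_linear_iso_def flip: residue_class_add)
  show "c (residue_class n \<gamma> (smult k p)) = k \<cdot>\<^sub>v c (residue_class n \<gamma> p)"
    using c res[of p] by (simp add: is_linear_iso_def flip: scale_residue_class)
  show "c (residue_class n \<gamma> p) \<in> carrier_vec n"
    using bij_betw_apply[OF bij res] .
qed

lemma c_sum:
  assumes "finite A" "i < n"
  shows "c (residue_class n \<gamma> (\<Sum>j\<in>A. p j)) $ i = (\<Sum>j\<in>A. c (residue_class n \<gamma> (p j)) $ i)"
  using assms(1)
proof (induction A rule: finite_induct)
  case empty
  show ?case using c_smult[of 0 0] c_carrier[of 0] \<open>i < n\<close> by (metis carrier_vecD index_smult_vec(1) mult_zero_left smult_0_left sum.empty)
next
  case (insert j A)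
  then show ?case using c_carrier[of "sum p A"] \<open>i < n\<close> by (simp add: c_add)
qed

lemma c_eq_coords:
  assumes i: "i < n"
  shows "c (residue_class n \<gamma> p) $ i = (\<Sum>k<n. c_matrix n \<gamma> c $$ (i, k) * coords n \<gamma> p k)"
proof -
  have "c (residue_class n \<gamma> p) $ i
      = c (residue_class n \<gamma> (\<Sum>j<n. smult (coords n \<gamma> p j) (Polynomial.monom 1 j))) $ i"
    using residue_class_coords[OF n, of \<gamma> p] by (simp add: smult_monom)
  also have "\<dots> = (\<Sum>k<n. c_matrix n \<gamma> c $$ (i, k) * coords n \<gamma> p k)"
    using c_carrier i
    by (simp add: c_sum c_smult c_matrix_def mult.commute carrier_vecD[OF c_carrier])
  finally show ?thesis .
qed

lemma c_matrix_carrier: "c_matrix n \<gamma> c \<in> carrier_mat n n"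
  by (simp add: c_matrix_def)

lemma c_eq_c_matrix: "c (residue_class n \<gamma> p) = c_matrix n \<gamma> c *\<^sub>v vec n (coords n \<gamma> p)"
  using c_carrier[of p] c_matrix_carrier
  by (intro eq_vecI) (auto simp: c_eq_coords scalar_prod_def lessThan_atLeast0)

lemma det_c_matrix: "det (c_matrix n \<gamma> c) \<noteq> 0"
proof
  assume "det (c_matrix n \<gamma> c) = 0"
  then obtain v where v: "v \<in> carrier_vec n" "v \<noteq> 0\<^sub>v n" "c_matrix n \<gamma> c *\<^sub>v v = 0\<^sub>v n"
    using det_0_iff_vec_prod_zero_field[OF c_matrix_carrier] by blast
  define p where "p = (\<Sum>j<n. Polynomial.monom (v $ j) j)"
  have p: "coeff p i = (if i < n then v $ i else 0)" for i
    by (auto simp: p_def coeff_sum coeff_monom)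
  then have coords: "coords n \<gamma> p = coeff p" by (intro coords_low_degree) simp
  have "vec n (coords n \<gamma> p) = v" using v(1) by (intro eq_vecI) (auto simp: coords p)
  then have "c (residue_class n \<gamma> p) = 0\<^sub>v n" using v(3) by (simp add: c_eq_c_matrix)
  moreover have "c (residue_class n \<gamma> 0) = 0\<^sub>v n"
    using c_matrix_carrier by (simp add: c_eq_c_matrix coords_def reduce_0 vec_eq_iff scalar_prod_def)
  ultimately have "residue_class n \<gamma> p = residue_class n \<gamma> 0"
    by (intro inj_onD[OF bij_betw_imp_inj_on[OF c_bij]]) (simp_all add: O_alg_carrier)
  then have "coeff p = (\<lambda>i. 0)"
    using coords_cong[OF n] coords by (metis coords_def ext reduce_0)
  then have "v = 0\<^sub>v n" using v(1) p by (intro eq_vecI) (auto simp: fun_eq_iff split: if_splits)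
  with v(2) show False ..
qed

lemma c_matrix_left_inverse:
  "\<exists>M. \<forall>i<n. \<forall>j<n. (\<Sum>k<n. M $$ (i, k) * c_matrix n \<gamma> c $$ (k, j)) = (if i = j then 1 else 0)"
proof -
  let ?C = "c_matrix n \<gamma> c"
  obtain M where M: "M \<in> carrier_mat n n" and eq: "M * ?C = 1\<^sub>m n"
    using det_non_zero_imp_unit[OF c_matrix_carrier det_c_matrix, of "()"]
    by (auto simp: Units_def ring_mat_def)
  have "(\<Sum>k<n. M $$ (i, k) * ?C $$ (k, j)) = (if i = j then 1 else 0)" if "i < n" "j < n" for i j
  proof -
    have "(M * ?C) $$ (i, j) = (\<Sum>k<n. M $$ (i, k) * ?C $$ (k, j))"
      using that M c_matrix_carrier by (simp add: scalar_prod_def lessThan_atLeast0)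
    then show ?thesis using that by (simp add: eq)
  qed
  then show ?thesis by blast
qed

text \<open>A change of basis multiplies all these determinants by the same nonzero constant.\<close>

lemma T_S_eq_det:
  assumes i: "1 \<le> i" "i \<le> n"
  shows "T n \<gamma> c i (residue_class n \<gamma> p) = det (c_matrix n \<gamma> c) * T_det n (f_coeff n \<gamma>) (coords n \<gamma> p) i"
    and "S n \<gamma> c i (residue_class n \<gamma> p) = det (c_matrix n \<gamma> c) * S_det n (f_coeff n \<gamma>) (coords n \<gamma> p) i"
proof -
  let ?C = "c_matrix n \<gamma> c" and ?f = "f_coeff n \<gamma>" and ?w = "coords n \<gamma> p"
  have b: "b_col n \<gamma> c (residue_class n \<gamma> p) j = ?C *\<^sub>v vec n ((times_zeta n ?f ^^ j) ?w)" for j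
    by (simp add: b_col_def residue_class_mult c_eq_c_matrix coords_monom_mult[OF n])
  have a: "a_col n \<gamma> c j = ?C *\<^sub>v vec n (\<lambda>i. if i = j then 1 else 0)" if "j < n" for j
  proof -
    have "coords n \<gamma> (Polynomial.monom 1 j) = coeff (Polynomial.monom 1 j)"
      using that by (intro coords_low_degree) simp
    then have "coords n \<gamma> (Polynomial.monom 1 j) = (\<lambda>i. if i = j then 1 else 0)"
      by (auto simp: fun_eq_iff coeff_monom)
    then show ?thesis by (simp add: a_col_def c_eq_c_matrix)
  qed
  have entry: "(?C *\<^sub>v vec n u) $ k = (\<Sum>l<n. ?C $$ (k, l) * u l)" if "k < n" for k u
    using that c_matrix_carrier by (simp add: scalar_prod_def lessThan_atLeast0)
  have mult: "(?C * A) $$ (k, j) = (\<Sum>l<n. ?C $$ (k, l) * A $$ (l, j))"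
    if "k < n" "j < n" "A \<in> carrier_mat n n" for k j A
    using that c_matrix_carrier by (simp add: scalar_prod_def lessThan_atLeast0)
  have TC: "T_mat n ?f ?w i \<in> carrier_mat n n" and SC: "S_mat n ?f ?w i \<in> carrier_mat n n"
    by (simp_all add: T_mat_def S_mat_def)
  have "mat_of_cols n (map (b_col n \<gamma> c (residue_class n \<gamma> p)) [0..<i] @ map (a_col n \<gamma> c) [i-1..<n-1])
      = ?C * T_mat n ?f ?w i" (is "?L = ?R")
  proof (rule eq_matI)
    fix k j assume "k < dim_row ?R" "j < dim_col ?R"
    then have kj: "k < n" "j < n" using c_matrix_carrier TC by simp_all
    show "?L $$ (k, j) = ?R $$ (k, j)"
    proof (cases "j < i")
      case True
      then show ?thesis
        using kj i TC by (simp add: mat_of_cols_index nth_append b entry mult) (simp add: T_mat_def)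
    next
      case False
      then have "i - 1 + (j - i) = j - 1" using i by simp
      then show ?thesis
        using kj i TC False by (simp add: mat_of_cols_index nth_append a entry mult)
          (auto simp: T_mat_def intro!: sum.cong)
    qed
  qed (use i TC c_matrix_carrier in auto)
  then show "T n \<gamma> c i (residue_class n \<gamma> p) = det ?C * T_det n ?f ?w i"
    using det_mult[OF c_matrix_carrier TC] i by (simp add: T_def T_det_def)
  have "mat_of_cols n (map (b_col n \<gamma> c (residue_class n \<gamma> p)) [0..<i] @ map (a_col n \<gamma> c) [i..<n])
      = ?C * S_mat n ?f ?w i" (is "?L = ?R")
  proof (rule eq_matI)
    fix k j assume "k < dim_row ?R" "j < dim_col ?R"
    then have kj: "k < n" "j < n" using c_matrix_carrier SC by simp_all
    show "?L $$ (k, j) = ?R $$ (k, j)"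
    proof (cases "j < i")
      case True
      then show ?thesis
        using kj i SC by (simp add: mat_of_cols_index nth_append b entry mult) (simp add: S_mat_def)
    next
      case False
      then show ?thesis
        using kj i SC by (simp add: mat_of_cols_index nth_append a entry mult)
          (auto simp: S_mat_def intro!: sum.cong)
    qed
  qed (use i SC c_matrix_carrier in auto)
  then show "S n \<gamma> c i (residue_class n \<gamma> p) = det ?C * S_det n ?f ?w i"
    using det_mult[OF c_matrix_carrier SC] by (simp add: S_def S_det_def)
qed

end

section \<open>Homogeneity of S and T\<close>

lemma homogeneous_uminus: "homogeneous d p \<Longrightarrow> homogeneous d (- p)"
  using homogeneous_diff[OF homogeneous_0, of d p] by simp

context
  fixes V :: "'v set" and X :: "nat \<Rightarrow> 'v cpoly" and n :: nat and f :: "nat \<Rightarrow> complex"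
  assumes X: "\<And>j. homogeneous 1 (X j)" "\<And>j. X j \<in> polys_in V"
begin

lemma times_zeta_iterate_form:
  "homogeneous 1 ((times_zeta n (\<lambda>i. Const (f i)) ^^ k) X i)
    \<and> (times_zeta n (\<lambda>i. Const (f i)) ^^ k) X i \<in> polys_in V"
  by (induction k arbitrary: i)
    (auto simp: times_zeta_def X X[unfolded One_nat_def] homogeneous_0
      intro!: homogeneous_diff homogeneous_Const_mult homogeneous_uminus polys_in_intros)

text \<open>Every product in the Leibniz expansion contains exactly one factor from each of the \<open>k\<close> columns of
linear forms.\<close>

lemma det_columns_form:
  assumes k: "k \<le> n"
    and A: "A \<in> carrier_mat n n"
    and hom: "\<And>i j. i < n \<Longrightarrow> j < n \<Longrightarrow> homogeneous (if j < k then 1 else 0) (A $$ (i, j))"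
    and V: "\<And>i j. i < n \<Longrightarrow> j < n \<Longrightarrow> A $$ (i, j) \<in> polys_in V"
  shows "homogeneous k (det A)" and "det A \<in> polys_in V"
proof -
  have sign: "signof p = Const (signof p)" for p :: "nat \<Rightarrow> nat"
    by (simp add: sign_def hom_distribs)
  have prod: "homogeneous k (\<Prod>i = 0..<n. A $$ (i, p i))" if p: "p permutes {0..<n}" for p
  proof -
    have "homogeneous (\<Sum>i = 0..<n. if p i < k then 1 else 0) (\<Prod>i = 0..<n. A $$ (i, p i))"
      using permutes_in_image[OF p] by (intro homogeneous_prod hom) auto
    moreover have "(\<Sum>i = 0..<n. if p i < k then 1 else 0) = (\<Sum>j = 0..<n. if j < k then 1 else 0 :: nat)"
      using sum.permute[OF p, of "\<lambda>j. if j < k then 1 else 0 :: nat"] by (simp add: o_def)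
    moreover have "(\<Sum>j = 0..<n. if j < k then 1 else 0 :: nat) = k"
    proof -
      have "{j \<in> {0..<n}. j < k} = {0..<k}" using k by auto
      then show ?thesis by (simp add: sum.If_cases Int_def)
    qed
    ultimately show ?thesis by simp
  qed
  show "homogeneous k (det A)"
    unfolding det_def'[OF A] by (subst sign) (intro homogeneous_sum homogeneous_Const_mult prod, simp)
  show "det A \<in> polys_in V"
    unfolding det_def'[OF A]
  proof (subst sign, intro polys_in_sum polys_in_mult polys_in_Const polys_in_prod)
    fix p i assume "p \<in> {p. p permutes {0..<n}}" "i \<in> {0..<n}"
    then show "A $$ (i, p i) \<in> polys_in V" using permutes_in_image[of p] by (intro V) auto
  qed
qed

lemma T_S_det_form:
  assumes k: "k \<le> n"
  shows "homogeneous k (T_det n (\<lambda>i. Const (f i)) X k)" "T_det n (\<lambda>i. Const (f i)) X k \<in> polys_in V"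
    and "homogeneous k (S_det n (\<lambda>i. Const (f i)) X k)" "S_det n (\<lambda>i. Const (f i)) X k \<in> polys_in V"
proof -
  have T: "homogeneous (if j < k then 1 else 0) (T_mat n (\<lambda>i. Const (f i)) X k $$ (i, j))"
      "T_mat n (\<lambda>i. Const (f i)) X k $$ (i, j) \<in> polys_in V"
    and S: "homogeneous (if j < k then 1 else 0) (S_mat n (\<lambda>i. Const (f i)) X k $$ (i, j))"
      "S_mat n (\<lambda>i. Const (f i)) X k $$ (i, j) \<in> polys_in V" if "i < n" "j < n" for i j
    using that times_zeta_iterate_form
    by (auto simp: T_mat_def S_mat_def homogeneous_0 homogeneous_1 polys_in_0 polys_in_1)
  have C: "T_mat n (\<lambda>i. Const (f i)) X k \<in> carrier_mat n n" "S_mat n (\<lambda>i. Const (f i)) X k \<in> carrier_mat n n"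
    by (simp_all add: T_mat_def S_mat_def)
  show "homogeneous k (T_det n (\<lambda>i. Const (f i)) X k)" "T_det n (\<lambda>i. Const (f i)) X k \<in> polys_in V"
    using det_columns_form[OF k C(1) T] by (auto simp: T_det_def homogeneous_1 polys_in_1)
  show "homogeneous k (S_det n (\<lambda>i. Const (f i)) X k)" "S_det n (\<lambda>i. Const (f i)) X k \<in> polys_in V"
    using det_columns_form[OF k C(2) S] by (auto simp: S_det_def)
qed

end

text \<open>Evaluation of the homogeneous polynomials \<open>T\<close> and \<open>S\<close> in the variables \<open>w\<^sub>0, w\<^sub>1, \<dots>\<close>.\<close>

lemma T_S_det_scale:
  fixes f w :: "nat \<Rightarrow> complex"
  assumes "i \<le> n"
  shows "T_det n f (\<lambda>j. k * w j) i = k ^ i * T_det n f w i"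
    and "S_det n f (\<lambda>j. k * w j) i = k ^ i * S_det n f w i"
proof -
  note form = T_S_det_form[of Var UNIV i n f, OF homogeneous_Var polys_in_Var[OF UNIV_I] assms]
  have peval: "peval x (T_det n (\<lambda>i. Const (f i)) Var i) = T_det n f x i"
    "peval x (S_det n (\<lambda>i. Const (f i)) Var i) = S_det n f x i" for x
    by (simp_all add: hom_T_det[OF peval_hom] hom_S_det[OF peval_hom])
      (simp_all add: peval_eq_eval_via eval_via_Const[OF identity_hom] eval_via_Var[OF identity_hom])
  show "T_det n f (\<lambda>j. k * w j) i = k ^ i * T_det n f w i"
    "S_det n f (\<lambda>j. k * w j) i = k ^ i * S_det n f w i"
    using peval_homogeneous[OF form(1), of k w] peval_homogeneous[OF form(3), of k w]
    by (simp_all add: peval)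
qed

section \<open>The bijection on points\<close>

locale alpha_setting =
  fixes n :: nat and \<gamma> :: "nat \<Rightarrow> complex" and c :: "complex poly set \<Rightarrow> complex vec"
  assumes n: "n \<ge> 2" and \<gamma>: "\<gamma> n = 1" and c: "is_linear_iso n \<gamma> c"
begin

abbreviation "res \<equiv> residue_class n \<gamma>"
abbreviation "crd \<equiv> coords n \<gamma>"
abbreviation "f \<equiv> f_coeff n \<gamma>"
abbreviation "Td \<equiv> T_det n f"
abbreviation "Sd \<equiv> S_det n f"
abbreviation "I \<equiv> Zo_ideal n \<gamma>"
abbreviation "Z \<equiv> Zo_points n \<gamma>"
abbreviation "Y \<equiv> Yo_points n \<gamma> c"
abbreviation "P \<equiv> polys_in (zQU_vars n)"
abbreviation "ev \<equiv> point_eval n"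
abbreviation eqv (infix \<open>\<approx>\<close> 50) where "eqv \<equiv> zQ_cong n \<gamma>"

lemma n0: "n > 0" using n by simp

definition admissible :: "complex poly \<Rightarrow> bool" where
  "admissible p \<longleftrightarrow> (\<forall>i\<in>{1..n}. Td (crd p) i \<noteq> 0 \<and> Sd (crd p) i \<noteq> 0)"

lemma admissible_smult: "admissible (smult k p) \<longleftrightarrow> k \<noteq> 0 \<and> admissible p"
proof -
  have eq: "Td (crd (smult k p)) i = k ^ i * Td (crd p) i" "Sd (crd (smult k p)) i = k ^ i * Sd (crd p) i"
    if "i \<in> {1..n}" for i
    using that by (simp_all add: coords_smult T_S_det_scale)
  show ?thesis
  proof
    assume admissible: "admissible (smult k p)"
    have one: "1 \<in> {1..n}" using n by simp
    then have "Td (crd (smult k p)) 1 \<noteq> 0" using admissible unfolding admissible_def by blast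
    then have "k \<noteq> 0" unfolding eq(1)[OF one] by auto
    moreover have "Td (crd p) i \<noteq> 0 \<and> Sd (crd p) i \<noteq> 0" if "i \<in> {1..n}" for i
      using admissible[unfolded admissible_def, rule_format, OF that] unfolding eq[OF that] by auto
    ultimately show "k \<noteq> 0 \<and> admissible p" by (simp add: admissible_def)
  next
    assume k: "k \<noteq> 0 \<and> admissible p"
    have "Td (crd (smult k p)) i \<noteq> 0 \<and> Sd (crd (smult k p)) i \<noteq> 0" if "i \<in> {1..n}" for i
      using k[unfolded admissible_def] that unfolding eq[OF that] by auto
    then show "admissible (smult k p)" by (simp add: admissible_def)
  qed
qed

lemma admissible_cong: "res p = res q \<Longrightarrow> admissible p \<longleftrightarrow> admissible q"
  using coords_cong[OF n0, of \<gamma> p q] by (simp only: admissible_def)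

lemma admissible_iff: "admissible p \<longleftrightarrow> (\<forall>i\<in>{1..n}. T n \<gamma> c i (res p) \<noteq> 0 \<and> S n \<gamma> c i (res p) \<noteq> 0)"
  unfolding admissible_def using det_c_matrix[OF n0 c] by (auto simp: T_S_eq_det[OF n0 c])

lemma admissible_imp_nonzero: "admissible p \<Longrightarrow> res p \<noteq> \<zero>\<^bsub>O_alg n \<gamma>\<^esub>"
proof
  assume "admissible p" "res p = \<zero>\<^bsub>O_alg n \<gamma>\<^esub>"
  then have "res p = res (smult 0 p)" by (simp add: O_alg_zero)
  then show False using admissible_cong[of p "smult 0 p"] admissible_smult[of 0 p] \<open>admissible p\<close> by blast
qed

lemma in_line: "res p \<in> line n \<gamma> (res p)"
  unfolding line_residue_class by (rule CollectI) (rule exI[of _ 1], simp)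

lemma line_eq_imp:
  assumes "line n \<gamma> (res p) = line n \<gamma> (res q)"
  obtains k where "res q = res (smult k p)"
proof -
  have "res q \<in> line n \<gamma> (res p)" using in_line[of q] by (simp only: assms)
  then show thesis using that unfolding line_residue_class by blast
qed

lemma line_smult:
  assumes "k \<noteq> 0" shows "line n \<gamma> (res (smult k p)) = line n \<gamma> (res p)"
proof -
  have "\<exists>m. res (smult l (smult k p)) = res (smult m p)" for l by (rule exI[of _ "l * k"]) simp
  moreover have "\<exists>m. res (smult l p) = res (smult m (smult k p))" for l
    using assms by (intro exI[of _ "l / k"]) simp
  ultimately show ?thesis unfolding line_residue_class by fast
qed

text \<open>The condition \<open>T\<^sub>i \<noteq> 0\<close>, \<open>S\<^sub>i \<noteq> 0\<close> does not depend on the representative of the line, because \<open>T\<^sub>i\<close> and \<open>S\<^sub>i\<close> are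
homogeneous of degree \<open>i\<close>.\<close>

lemma Yo_iff: "line n \<gamma> (res p) \<in> Y \<longleftrightarrow> admissible p"
proof
  assume "line n \<gamma> (res p) \<in> Y"
  then obtain q where q: "line n \<gamma> (res p) = line n \<gamma> (res q)" "admissible q"
    unfolding Yo_points_def by (auto simp: O_alg_carrier admissible_iff)
  obtain k where "res q = res (smult k p)" using line_eq_imp[OF q(1)] .
  then show "admissible p" using q(2) admissible_cong[of q "smult k p"] admissible_smult by simp
next
  assume "admissible p"
  then show "line n \<gamma> (res p) \<in> Y"
    using admissible_imp_nonzero[of p] unfolding Yo_points_def proj_O_def
    by (auto simp: O_alg_carrier admissible_iff)
qed

lemma Yo_cases:
  assumes "y \<in> Y" obtains p where "y = line n \<gamma> (res p)" "admissible p"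
  using assms Yo_iff unfolding Yo_points_def proj_O_def by (auto simp: O_alg_carrier)

definition delta :: "(nat \<Rightarrow> complex) \<times> (nat \<Rightarrow> complex) \<Rightarrow> complex poly" where
  "delta x = tail_poly n (fst x) (snd x) 1"

lemma \<alpha>_eq: "\<alpha> n \<gamma> x = line n \<gamma> (res (delta x))"
  using n by (cases x) (simp add: \<alpha>_def delta_def Delta11_eq_tail_poly)

lemma coords_delta: "crd (delta x) = coeff (delta x)"
  using n by (intro coords_low_degree) (simp add: delta_def coeff_tail_poly_beyond)

lemma ev_univ_w: "ev x (univ_w n i) = crd (delta x) i"
proof -
  have "(\<lambda>k. ev x (zV k)) k = fst x k" if "k \<in> {1..n}" for k
    using that by (cases x) (auto simp: point_eval_Var zQU_vars_def)
  moreover have "(\<lambda>k. ev x (QV k)) k = snd x k" if "k \<in> {1..n-1}" for k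
    using that by (cases x) (auto simp: point_eval_Var zQU_vars_def)
  ultimately have "tail_poly n (\<lambda>k. ev x (zV k)) (\<lambda>k. ev x (QV k)) 1 = delta x"
    unfolding delta_def by (rule tail_poly_cong)
  then show ?thesis by (simp add: univ_w_def hom_coeff_tail_poly[OF point_eval_hom] coords_delta)
qed

lemma ev_univ_T: "ev x (univ_T n \<gamma> i) = Td (crd (delta x)) i"
  and ev_univ_S: "ev x (univ_S n \<gamma> i) = Sd (crd (delta x)) i"
  by (simp_all add: univ_T_def univ_S_def hom_T_det[OF point_eval_hom] hom_S_det[OF point_eval_hom]
      ev_univ_w univ_f_def point_eval_Const)

lemma ev_unit:
  assumes "x \<in> Z" "zQ_cong.unit n \<gamma> p" shows "ev x p \<noteq> 0"
proof -
  interpret ev: comm_ring_hom "ev x" by (rule point_eval_hom)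
  obtain q where "p * q \<approx> 1" using assms(2) unfolding zQ_cong.unit_def by blast
  then have "ev x p * ev x q = 1"
    using zQ_cong_point_eval[OF assms(1)] by (fastforce simp: hom_distribs)
  then show ?thesis by auto
qed

lemma admissible_delta: "x \<in> Z \<Longrightarrow> admissible (delta x)"
  unfolding admissible_def
  unfolding ev_univ_T[symmetric] ev_univ_S[symmetric]
  using ev_unit univ_units[of n \<gamma>, OF n \<gamma>] by blast

lemma \<alpha>_in_Yo: "x \<in> Z \<Longrightarrow> \<alpha> n \<gamma> x \<in> Y"
  by (simp add: \<alpha>_eq Yo_iff admissible_delta)

text \<open>The representative \<open>\<Delta>\<^sub>1\<^sub>1\<close> is monic, so the line determines it; \<open>S\<close> and \<open>T\<close> at \<open>\<Delta>\<^sub>1\<^sub>1\<close> then determine \<open>z\<close> and \<open>Q\<close>.\<close>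

lemma \<alpha>_inj: "inj_on (\<alpha> n \<gamma>) Z"
proof (rule inj_onI)
  fix x y assume x: "x \<in> Z" and y: "y \<in> Z" and eq: "\<alpha> n \<gamma> x = \<alpha> n \<gamma> y"
  obtain k where "res (delta y) = res (smult k (delta x))"
    using line_eq_imp eq unfolding \<alpha>_eq by metis
  then have scale: "crd (delta y) = (\<lambda>i. k * crd (delta x) i)"
    using coords_cong[OF n0] by (metis coords_smult)
  have "crd (delta x) (n - 1) = 1" for x
    using tail_poly_ends[of 1 n "fst x" "snd x"] n by (simp add: coords_delta) (simp add: delta_def)
  with scale have "k = 1" by (metis mult.right_neutral)
  with scale have w: "crd (delta y) = crd (delta x)" by simp
  let ?T = "Td (crd (delta x))" and ?S = "Sd (crd (delta x))"
  have nz: "?T i \<noteq> 0 \<and> ?S i \<noteq> 0" if "i \<le> n" for i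
    using admissible_delta[OF x] that by (cases "i = 0") (auto simp: admissible_def T_det_def S_det_0)
  have relz: "?T (i - 1) * ?S i * fst u i = ?S (i - 1) * ?T i" if "u \<in> {x, y}" "i \<in> {1..n}" for u i
  proof -
    interpret ev: comm_ring_hom "ev u" by (rule point_eval_hom)
    have "ev u (zV i) = fst u i" using that by (cases u) (auto simp: point_eval_Var zQU_vars_def)
    then show ?thesis
      using zQ_cong_point_eval[OF _ univ_z_relation[of n \<gamma> i, OF n \<gamma>], of u] that x y w
      by (auto simp: hom_distribs ev_univ_T ev_univ_S)
  qed
  have relQ: "(?T i)\<^sup>2 * snd u i = ?T (Suc i) * ?T (i - 1)" if "u \<in> {x, y}" "i \<in> {1..n-1}" for u i
  proof -
    interpret ev: comm_ring_hom "ev u" by (rule point_eval_hom)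
    have "ev u (QV i) = snd u i" using that by (cases u) (auto simp: point_eval_Var zQU_vars_def)
    then show ?thesis
      using zQ_cong_point_eval[OF _ univ_Q_relation[of n \<gamma> i, OF n \<gamma>], of u] that x y w
      by (auto simp: hom_distribs ev_univ_T ev_univ_S)
  qed
  have "fst x i = fst y i" if "i \<in> {1..n}" for i
  proof -
    have "?T (i - 1) * ?S i * fst x i = ?T (i - 1) * ?S i * fst y i"
      using relz[of x i] relz[of y i] that by simp
    moreover have "i - 1 \<le> n" "i \<le> n" using that by auto
    then have "?T (i - 1) * ?S i \<noteq> 0" using nz[of i] nz[of "i - 1"] by simp
    ultimately show ?thesis by (simp only: mult_cancel_left simp_thms)
  qed
  moreover have "snd x i = snd y i" if "i \<in> {1..n-1}" for i
  proof -
    have "(?T i)\<^sup>2 * snd x i = (?T i)\<^sup>2 * snd y i"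
      using relQ[of x i] relQ[of y i] that by simp
    moreover have "i \<le> n" using that by auto
    then have "?T i \<noteq> 0" using nz[of i] by simp
    ultimately show ?thesis by simp
  qed
  moreover have "fst x \<in> extensional {1..n}" "snd x \<in> extensional {1..n-1}"
    "fst y \<in> extensional {1..n}" "snd y \<in> extensional {1..n-1}"
    using x y by (auto simp: Zo_points_def Z_points_def affine_space_zQ_def PiE_def)
  ultimately show "x = y" by (intro prod_eqI extensionalityI) auto
qed

text \<open>The continued fraction of \<open>\<phi> / f\<close> provides \<open>z\<close> and \<open>Q\<close>; since its zeroth remainder is \<open>f\<close> itself, comparing
coefficients gives \<open>F\<^sub>i(z, Q) = \<gamma>\<^sub>i\<close>.\<close>

lemma admissible_obtain_point:
  assumes "admissible p"
  obtains x k where "x \<in> Z" "k \<noteq> 0" "res p = res (smult k (delta x))"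
proof -
  let ?g = "f_poly n \<gamma>" and ?\<phi> = "p mod f_poly n \<gamma>"
  have w: "crd p = coeff ?\<phi>" by (rule coords_eq_coeff_mod[OF n0])
  have "coeff ?g 0 = (-1) ^ n" using coeff_f_poly[of n n \<gamma>] n \<gamma> by simp
  then have g0: "coeff ?g 0 \<noteq> 0" by simp
  have nz: "Sd (coeff ?\<phi>) i \<noteq> 0 \<and> Td (coeff ?\<phi>) i \<noteq> 0" if "1 \<le> i" "i \<le> n" for i
    using assms that unfolding admissible_def w by simp
  have n1: "1 \<le> n" using n by simp
  obtain z Q l where l: "l \<noteq> 0" "\<And>i. 1 \<le> i \<Longrightarrow> i < n \<Longrightarrow> Q i \<noteq> 0"
    and \<phi>: "?\<phi> = smult l (tail_poly n z Q 1)" and g: "?g = tail_poly n z Q 0"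
    by (rule continued_fraction_exists[OF f_poly_monic degree_f_poly g0 f_poly_mod[OF n0] nz n1],
        assumption, assumption, assumption, rule that)
  define x where "x = (restrict z {1..n}, restrict Q {1..n-1})"
  have tail: "tail_poly n (fst x) (snd x) k = tail_poly n z Q k" for k
    by (rule tail_poly_cong) (simp_all add: x_def)
  have "F n i (fst x) (snd x) = \<gamma> i" if i: "i \<in> {1..n}" for i
  proof -
    have "(-1) ^ i * F n i (fst x) (snd x) = (-1) ^ i * \<gamma> i"
      using coeff_tail_poly_0[of i n "fst x" "snd x"] coeff_f_poly[OF i, of \<gamma>] i tail[of 0] g by simp
    then show ?thesis by simp
  qed
  then have "x \<in> Z"
    using l(2) by (auto simp: x_def Zo_points_def Z_points_def affine_space_zQ_def)
  moreover have "res p = res (smult l (delta x))"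
    using residue_class_mod[OF n0, of \<gamma> p] \<phi> tail[of 1] by (simp add: delta_def)
  ultimately show thesis using l(1) that by blast
qed

lemma \<alpha>_bij: "bij_betw (\<alpha> n \<gamma>) Z Y"
  unfolding bij_betw_def
proof (intro conjI \<alpha>_inj equalityI subsetI)
  fix y assume "y \<in> \<alpha> n \<gamma> ` Z" then show "y \<in> Y" using \<alpha>_in_Yo by blast
next
  fix y assume "y \<in> Y"
  then obtain p where p: "y = line n \<gamma> (res p)" "admissible p" by (rule Yo_cases)
  obtain x k where x: "x \<in> Z" "k \<noteq> 0" "res p = res (smult k (delta x))"
    using admissible_obtain_point[OF p(2)] .
  then have "y = \<alpha> n \<gamma> x" by (simp add: p(1) \<alpha>_eq line_smult)
  then show "y \<in> \<alpha> n \<gamma> ` Z" using x(1) by blast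
qed

end

section \<open>Clearing denominators at the universal point\<close>

context alpha_setting
begin

definition form :: "nat \<Rightarrow> nat cpoly \<Rightarrow> bool" where
  "form d p \<longleftrightarrow> homogeneous d p \<and> p \<in> polys_in {0..<n}"

lemma form_add: "form d p \<Longrightarrow> form d q \<Longrightarrow> form d (p + q)"
  by (simp add: form_def homogeneous_add polys_in_add)

lemma form_mult: "form d p \<Longrightarrow> form e q \<Longrightarrow> form (d + e) (p * q)"
  by (simp add: form_def homogeneous_mult polys_in_mult)

lemma form_Const: "form 0 (Const k)"
  by (simp add: form_def homogeneous_Const polys_in_Const)

lemma form_Const_mult: "form d p \<Longrightarrow> form d (Const k * p)"
  using form_mult[OF form_Const] by fastforce

lemma form_power: "form d p \<Longrightarrow> form (k * d) (p ^ k)"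
  by (simp add: form_def homogeneous_power polys_in_power)

lemma form_prod: "finite A \<Longrightarrow> (\<And>i. i \<in> A \<Longrightarrow> form (d i) (g i)) \<Longrightarrow> form (sum d A) (prod g A)"
  by (simp add: form_def homogeneous_prod polys_in_prod)

definition c_entry :: "nat \<Rightarrow> nat \<Rightarrow> complex" where
  "c_entry i j = c_matrix n \<gamma> c $$ (i, j)"

definition c_entry_inv :: "nat \<Rightarrow> nat \<Rightarrow> complex" where
  "c_entry_inv = (SOME M. \<forall>i<n. \<forall>j<n. (\<Sum>k<n. M i k * c_entry k j) = (if i = j then 1 else 0))"

lemma c_entry_inv: "i < n \<Longrightarrow> j < n \<Longrightarrow> (\<Sum>k<n. c_entry_inv i k * c_entry k j) = (if i = j then 1 else 0)"
proof -
  obtain M where "\<forall>i<n. \<forall>j<n. (\<Sum>k<n. M $$ (i, k) * c_matrix n \<gamma> c $$ (k, j)) = (if i = j then 1 else 0)"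
    using c_matrix_left_inverse[OF n0 c] by blast
  then have "\<exists>M. \<forall>i<n. \<forall>j<n. (\<Sum>k<n. M i k * c_entry k j) = (if i = j then 1 else 0 :: complex)"
    unfolding c_entry_def by (intro exI[of _ "\<lambda>i k. M $$ (i, k)"])
  then have "\<forall>i<n. \<forall>j<n. (\<Sum>k<n. c_entry_inv i k * c_entry k j) = (if i = j then 1 else 0)"
    unfolding c_entry_inv_def by (rule someI_ex)
  then show "i < n \<Longrightarrow> j < n \<Longrightarrow> (\<Sum>k<n. c_entry_inv i k * c_entry k j) = (if i = j then 1 else 0)" by blast
qed

definition c_coords :: "complex poly \<Rightarrow> nat \<Rightarrow> complex" where
  "c_coords p j = c (res p) $ j"

lemma c_coords_eq: "j < n \<Longrightarrow> c_coords p j = (\<Sum>k<n. c_entry j k * crd p k)"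
  by (simp add: c_coords_def c_entry_def c_eq_coords[OF n0 c])

lemma c_entry_inv_c_entry:
  assumes "i < n" and h: "comm_ring_hom h"
  shows "(\<Sum>j<n. h (c_entry_inv i j) * (\<Sum>k<n. h (c_entry j k) * v k)) = v i"
proof -
  interpret h: comm_ring_hom h by (rule h)
  have "(\<Sum>j<n. h (c_entry_inv i j) * (\<Sum>k<n. h (c_entry j k) * v k))
      = (\<Sum>j<n. \<Sum>k<n. h (c_entry_inv i j * c_entry j k) * v k)"
    by (simp add: sum_distrib_left hom_distribs mult_ac)
  also have "\<dots> = (\<Sum>k<n. h (\<Sum>j<n. c_entry_inv i j * c_entry j k) * v k)"
    by (subst sum.swap) (simp add: hom_distribs sum_distrib_right)
  also have "\<dots> = (\<Sum>k<n. if k = i then v i else 0)"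
    using assms(1) by (intro sum.cong) (simp_all add: c_entry_inv)
  finally show ?thesis using assms(1) by simp
qed

text \<open>Regular functions on \<open>Y\<^sub>\<gamma>\<degree>\<close> are written in the coordinates given by \<open>c\<close>.  These linear forms express the
coordinates with respect to \<open>1, \<zeta>, \<dots>, \<zeta>\<^bsup>n-1\<^esup>\<close> through them.\<close>

definition gen_coord :: "nat \<Rightarrow> nat cpoly" where
  "gen_coord i = (if i < n then \<Sum>j<n. Const (c_entry_inv i j) * Var j else 0)"

definition T_form :: "nat \<Rightarrow> nat cpoly" where "T_form i = T_det n (univ_f n \<gamma>) gen_coord i"
definition S_form :: "nat \<Rightarrow> nat cpoly" where "S_form i = S_det n (univ_f n \<gamma>) gen_coord i"
definition D_form :: "nat cpoly" where "D_form = (\<Prod>i\<le>n. T_form i) * (\<Prod>i\<le>n. S_form i)"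

lemma T_form_S_form_0: "T_form 0 = 1" "S_form 0 = 1"
  by (simp_all add: T_form_def S_form_def T_det_def S_det_0)

lemma form_T_form: "i \<le> n \<Longrightarrow> form i (T_form i)" and form_S_form: "i \<le> n \<Longrightarrow> form i (S_form i)"
proof -
  have gen_coord: "homogeneous 1 (gen_coord j)" "gen_coord j \<in> polys_in {0..<n}" for j
    by (auto simp: gen_coord_def homogeneous_0
        intro!: homogeneous_sum homogeneous_Const_mult polys_in_intros homogeneous_Var[unfolded One_nat_def])
  have f: "univ_f n \<gamma> = (\<lambda>i. Const (f i))" by (simp add: univ_f_def fun_eq_iff)
  show "i \<le> n \<Longrightarrow> form i (T_form i)" "i \<le> n \<Longrightarrow> form i (S_form i)"
    using T_S_det_form[OF gen_coord] by (simp_all add: form_def T_form_def S_form_def f)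
qed

lemma sum_degrees: "2 * (\<Sum>i\<le>n. i) = n * (n + 1)"
  using gauss_sum_nat[of n] by (simp add: atLeast0AtMost)

lemma form_D_form: "form (n * (n + 1)) D_form"
proof -
  have "form ((\<Sum>i\<le>n. i) + (\<Sum>i\<le>n. i)) D_form"
    unfolding D_form_def by (intro form_mult form_prod form_T_form form_S_form) auto
  then show ?thesis using sum_degrees by (simp only: mult_2)
qed

text \<open>Substitution of the universal point, that is, of the \<open>c\<close>-coordinates of \<open>\<Delta>\<^sub>1\<^sub>1\<close> formed from the variables \<open>z\<^sub>i\<close>
and \<open>Q\<^sub>i\<close>.\<close>

definition at_univ :: "nat cpoly \<Rightarrow> zQ_var cpoly" where
  "at_univ = eval_via Const (\<lambda>j. \<Sum>k<n. Const (c_entry j k) * univ_w n k)"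

lemma at_univ_hom: "comm_ring_hom at_univ"
  unfolding at_univ_def by (rule eval_via_hom[OF Const_hom])

interpretation at_univ: comm_ring_hom at_univ by (rule at_univ_hom)

lemma at_univ_Const: "at_univ (Const k) = Const k"
  by (simp add: at_univ_def eval_via_Const[OF Const_hom])

lemma at_univ_gen_coord: "at_univ (gen_coord i) = univ_w n i"
proof (cases "i < n")
  case True
  then show ?thesis
    by (simp add: gen_coord_def hom_distribs at_univ_Const)
      (simp add: at_univ_def eval_via_Var[OF Const_hom] c_entry_inv_c_entry[OF _ Const_hom])
next
  case False
  then show ?thesis using n by (simp add: gen_coord_def univ_w_def coeff_tail_poly_beyond)
qed

lemma at_univ_T_form: "at_univ (T_form i) = univ_T n \<gamma> i" and at_univ_S_form: "at_univ (S_form i) = univ_S n \<gamma> i"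
  by (simp_all add: T_form_def S_form_def hom_T_det[OF at_univ_hom] hom_S_det[OF at_univ_hom] univ_T_def univ_S_def
      at_univ_gen_coord univ_f_def[abs_def] at_univ_Const)

lemma peval_gen_coord: "peval (c_coords p) (gen_coord i) = crd p i"
proof -
  interpret peval: comm_ring_hom "peval (c_coords p)" by (rule peval_hom)
  have k: "peval (c_coords p) (Const a) = a" "peval (c_coords p) (Var j) = c_coords p j" for a j
    by (simp_all add: peval_eq_eval_via eval_via_Const[OF identity_hom] eval_via_Var[OF identity_hom])
  show ?thesis
    using c_entry_inv_c_entry[of i "\<lambda>k. k" "crd p", OF _ identity_hom] coords_beyond[OF n0]
    by (simp add: gen_coord_def hom_distribs k c_coords_eq)
qed

lemma peval_T_form: "peval (c_coords p) (T_form i) = Td (crd p) i" and peval_S_form: "peval (c_coords p) (S_form i) = Sd (crd p) i"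
proof -
  have k: "peval (c_coords p) (Const a) = a" for a
    by (simp add: peval_eq_eval_via eval_via_Const[OF identity_hom])
  show "peval (c_coords p) (T_form i) = Td (crd p) i" "peval (c_coords p) (S_form i) = Sd (crd p) i"
    by (simp_all add: T_form_def S_form_def hom_T_det[OF peval_hom] hom_S_det[OF peval_hom] peval_gen_coord univ_f_def k)
qed

lemma peval_D_form: "peval (c_coords p) D_form = (\<Prod>i\<in>{1..n}. Td (crd p) i * Sd (crd p) i)"
proof -
  interpret peval: comm_ring_hom "peval (c_coords p)" by (rule peval_hom)
  have "{..n} = insert 0 {1..n}" by auto
  then have "(\<Prod>i\<le>n. g i) = g 0 * (\<Prod>i\<in>{1..n}. g i)" for g :: "nat \<Rightarrow> nat cpoly" by simp
  then show ?thesis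
    by (simp add: D_form_def T_form_S_form_0 hom_distribs peval_T_form peval_S_form prod.distrib)
qed

lemma admissible_iff_D_form: "admissible p \<longleftrightarrow> peval (c_coords p) D_form \<noteq> 0"
  by (auto simp: peval_D_form admissible_def)

lemma T_S_prod: "(\<Prod>i\<in>{1..n}. T n \<gamma> c i (res p) * S n \<gamma> c i (res p))
    = ((det (c_matrix n \<gamma> c))\<^sup>2) ^ n * peval (c_coords p) D_form"
proof -
  have "(\<Prod>i\<in>{1..n}. T n \<gamma> c i (res p) * S n \<gamma> c i (res p))
      = (\<Prod>i\<in>{1..n}. (det (c_matrix n \<gamma> c))\<^sup>2 * (Td (crd p) i * Sd (crd p) i))"
    by (intro prod.cong) (simp_all add: T_S_eq_det[OF n0 c] power2_eq_square)
  then show ?thesis by (simp add: prod.distrib peval_D_form)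
qed

lemma peval_form_cong:
  assumes "form d G" "\<And>j. j < n \<Longrightarrow> x j = y j" shows "peval x G = peval y G"
  unfolding peval_eq_eval_via using assms by (intro eval_via_cong[of G "{0..<n}"]) (auto simp: form_def)

lemma ev_at_univ:
  assumes "form d G" shows "ev x (at_univ G) = peval (c_coords (delta x)) G"
proof -
  interpret ev: comm_ring_hom "ev x" by (rule point_eval_hom)
  have "ev x (at_univ G) = eval_via (\<lambda>k. k) (\<lambda>j. \<Sum>k<n. c_entry j k * crd (delta x) k) G"
    unfolding at_univ_def hom_eval_via[OF point_eval_hom]
    by (simp add: o_def hom_distribs point_eval_Const ev_univ_w)
  also have "\<dots> = peval (c_coords (delta x)) G"
    unfolding peval_eq_eval_via[symmetric] using assms by (rule peval_form_cong) (simp add: c_coords_eq)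
  finally show ?thesis .
qed

lemma peval_form_smult:
  assumes "form d G" "res q = res (smult k p)" shows "peval (c_coords q) G = k ^ d * peval (c_coords p) G"
proof -
  have "c_coords q j = k * c_coords p j" if "j < n" for j
    using c_carrier[OF n0 c, of p] that by (simp add: c_coords_def assms(2) c_smult[OF n0 c])
  then have "peval (c_coords q) G = peval (\<lambda>j. k * c_coords p j) G" by (intro peval_form_cong[OF assms(1)])
  then show ?thesis using assms(1) by (simp add: peval_homogeneous form_def)
qed

lemma unit_at_univ_D_form: "zQ_cong.unit n \<gamma> (at_univ D_form)"
proof -
  have "zQ_cong.unit n \<gamma> (at_univ (T_form i))" "zQ_cong.unit n \<gamma> (at_univ (S_form i))" if "i \<le> n" for i
    using that univ_units[of n \<gamma> i, OF n \<gamma>]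
    by (cases "i = 0"; simp add: T_form_S_form_0 zQ_cong.unit_1 at_univ_T_form at_univ_S_form)+
  then show ?thesis
    unfolding D_form_def hom_distribs by (intro zQ_cong.unit_mult zQ_cong.unit_prod) auto
qed

text \<open>\<open>p\<close> is the value at the universal point of a quotient \<open>G / D\<^sup>N\<close> of degree 0.\<close>

definition fraction :: "zQ_var cpoly \<Rightarrow> bool" where
  "fraction p \<longleftrightarrow> (\<exists>N G. form (N * (n * (n + 1))) G \<and> at_univ G \<approx> at_univ D_form ^ N * p)"

text \<open>A quotient \<open>a / b\<close> of degree 0 qualifies if \<open>b\<close> divides a power of \<open>D\<close>.\<close>

lemma fraction_quotient:
  assumes "form d a" "b * b' = D_form ^ N" "form d' b'" "d + d' = N * (n * (n + 1))" "at_univ b * p \<approx> at_univ a"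
  shows "fraction p"
proof -
  have "at_univ (a * b') = at_univ a * at_univ b'" by (simp add: hom_distribs)
  also have "\<dots> \<approx> at_univ b * p * at_univ b'"
    by (intro zQ_cong.mult zQ_cong.sym[OF assms(5)] zQ_cong.refl)
  also have "\<dots> = at_univ (b * b') * p" by (simp add: hom_distribs mult_ac)
  also have "\<dots> = at_univ D_form ^ N * p" by (simp add: assms(2) hom_distribs)
  finally show ?thesis
    using form_mult[OF assms(1,3)] assms(4) unfolding fraction_def by metis
qed

lemma fraction_add:
  assumes "fraction p" "fraction q" shows "fraction (p + q)"
proof -
  obtain N G where p: "form (N * (n * (n + 1))) G" "at_univ G \<approx> at_univ D_form ^ N * p"
    using assms(1) unfolding fraction_def by blast
  obtain K H where q: "form (K * (n * (n + 1))) H" "at_univ H \<approx> at_univ D_form ^ K * q"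
    using assms(2) unfolding fraction_def by blast
  have "form ((N + K) * (n * (n + 1))) (G * D_form ^ K + H * D_form ^ N)"
  proof (rule form_add)
    show "form ((N + K) * (n * (n + 1))) (G * D_form ^ K)"
      using form_mult[OF p(1) form_power[OF form_D_form, of K]] by (simp add: algebra_simps)
    show "form ((N + K) * (n * (n + 1))) (H * D_form ^ N)"
      using form_mult[OF q(1) form_power[OF form_D_form, of N]] by (simp add: algebra_simps)
  qed
  moreover have "at_univ (G * D_form ^ K + H * D_form ^ N) = at_univ G * at_univ D_form ^ K + at_univ H * at_univ D_form ^ N"
    by (simp add: hom_distribs)
  moreover have "\<dots> \<approx> at_univ D_form ^ N * p * at_univ D_form ^ K + at_univ D_form ^ K * q * at_univ D_form ^ N"
    by (intro zQ_cong.add zQ_cong.mult p(2) q(2) zQ_cong.refl)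
  moreover have "\<dots> = at_univ D_form ^ (N + K) * (p + q)" by (simp add: power_add algebra_simps)
  ultimately show ?thesis unfolding fraction_def by metis
qed

lemma fraction_mult:
  assumes "fraction p" "fraction q" shows "fraction (p * q)"
proof -
  obtain N G where p: "form (N * (n * (n + 1))) G" "at_univ G \<approx> at_univ D_form ^ N * p"
    using assms(1) unfolding fraction_def by blast
  obtain K H where q: "form (K * (n * (n + 1))) H" "at_univ H \<approx> at_univ D_form ^ K * q"
    using assms(2) unfolding fraction_def by blast
  have "form ((N + K) * (n * (n + 1))) (G * H)"
    using form_mult[OF p(1) q(1)] by (simp add: algebra_simps)
  moreover have "at_univ (G * H) = at_univ G * at_univ H" by (simp add: hom_distribs)
  moreover have "\<dots> \<approx> (at_univ D_form ^ N * p) * (at_univ D_form ^ K * q)"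
    by (intro zQ_cong.mult p(2) q(2))
  moreover have "\<dots> = at_univ D_form ^ (N + K) * (p * q)" by (simp add: power_add algebra_simps)
  ultimately show ?thesis unfolding fraction_def by metis
qed

lemma fraction_Const: "fraction (Const k)"
  unfolding fraction_def
  by (rule exI[of _ 0], rule exI[of _ "Const k"]) (simp add: form_Const at_univ_Const)

lemma form_prod_except:
  assumes "i \<le> n"
  shows "form ((\<Sum>j\<le>n. j) - i) (\<Prod>j\<in>{..n} - {i}. T_form j)" "T_form i * (\<Prod>j\<in>{..n} - {i}. T_form j) = (\<Prod>j\<le>n. T_form j)"
    and "form ((\<Sum>j\<le>n. j) - i) (\<Prod>j\<in>{..n} - {i}. S_form j)" "S_form i * (\<Prod>j\<in>{..n} - {i}. S_form j) = (\<Prod>j\<le>n. S_form j)"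
    and "i \<le> (\<Sum>j\<le>n. j)"
proof -
  have sum: "(\<Sum>j\<in>{..n} - {i}. j) = (\<Sum>j\<le>n. j) - i" using assms by (simp add: sum_diff1_nat)
  show "form ((\<Sum>j\<le>n. j) - i) (\<Prod>j\<in>{..n} - {i}. T_form j)" "form ((\<Sum>j\<le>n. j) - i) (\<Prod>j\<in>{..n} - {i}. S_form j)"
    unfolding sum[symmetric] by (intro form_prod form_T_form form_S_form; simp)+
  show "T_form i * (\<Prod>j\<in>{..n} - {i}. T_form j) = (\<Prod>j\<le>n. T_form j)" "S_form i * (\<Prod>j\<in>{..n} - {i}. S_form j) = (\<Prod>j\<le>n. S_form j)"
    using assms by (simp_all add: prod.remove[of "{..n}" i])
  show "i \<le> (\<Sum>j\<le>n. j)" using assms by (intro member_le_sum[of i "{..n}" "\<lambda>j. j"]) auto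
qed

text \<open>\<open>z\<^sub>i = S\<^bsub>i-1\<^esub> T\<^sub>i / (T\<^bsub>i-1\<^esub> S\<^sub>i)\<close>.\<close>

lemma fraction_z:
  assumes "i \<in> {1..n}" shows "fraction (zV i)"
proof (rule fraction_quotient)
  let ?b' = "(\<Prod>j\<in>{..n} - {i - 1}. T_form j) * (\<Prod>j\<in>{..n} - {i}. S_form j)"
  have i: "i - 1 \<le> n" "i \<le> n" "1 \<le> i" using assms by auto
  show "form (i - 1 + i) (S_form (i - 1) * T_form i)" using i by (intro form_mult form_S_form form_T_form)
  show "form ((\<Sum>j\<le>n. j) - (i - 1) + ((\<Sum>j\<le>n. j) - i)) ?b'"
    using i by (intro form_mult form_prod_except)
  have "(T_form (i - 1) * S_form i) * ?b' = (T_form (i - 1) * (\<Prod>j\<in>{..n} - {i - 1}. T_form j)) * (S_form i * (\<Prod>j\<in>{..n} - {i}. S_form j))"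
    by (simp only: mult_ac)
  then show "(T_form (i - 1) * S_form i) * ?b' = D_form ^ 1"
    unfolding form_prod_except(2)[OF i(1)] form_prod_except(4)[OF i(2)] by (simp add: D_form_def)
  show "i - 1 + i + ((\<Sum>j\<le>n. j) - (i - 1) + ((\<Sum>j\<le>n. j) - i)) = 1 * (n * (n + 1))"
    using form_prod_except(5)[OF i(1)] form_prod_except(5)[OF i(2)] sum_degrees by linarith
  show "at_univ (T_form (i - 1) * S_form i) * zV i \<approx> at_univ (S_form (i - 1) * T_form i)"
    using univ_z_relation[of n \<gamma> i, OF n \<gamma>] i by (simp add: hom_distribs at_univ_T_form at_univ_S_form)
qed

text \<open>\<open>Q\<^sub>i = T\<^bsub>i+1\<^esub> T\<^bsub>i-1\<^esub> / T\<^sub>i\<^sup>2\<close>; the square in the denominator requires \<open>D\<^sup>2\<close>.\<close>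

lemma fraction_Q:
  assumes "i \<in> {1..n-1}" shows "fraction (QV i)"
proof (rule fraction_quotient)
  let ?b' = "(\<Prod>j\<in>{..n} - {i}. T_form j)\<^sup>2 * (\<Prod>j\<le>n. S_form j)\<^sup>2"
  have i: "i - 1 \<le> n" "Suc i \<le> n" "i \<le> n" "1 \<le> i" "i < n" using assms by auto
  show "form (Suc i + (i - 1)) (T_form (Suc i) * T_form (i - 1))" using i by (intro form_mult form_T_form)
  show "form (2 * ((\<Sum>j\<le>n. j) - i) + 2 * (\<Sum>j\<le>n. j)) ?b'"
    using i by (intro form_mult form_power form_prod_except form_prod form_S_form) auto
  have "(T_form i)\<^sup>2 * ?b' = (T_form i * (\<Prod>j\<in>{..n} - {i}. T_form j))\<^sup>2 * (\<Prod>j\<le>n. S_form j)\<^sup>2"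
    by (simp only: power_mult_distrib mult_ac)
  then show "(T_form i)\<^sup>2 * ?b' = D_form ^ 2"
    unfolding form_prod_except(2)[OF i(3)] by (simp add: D_form_def power_mult_distrib)
  show "Suc i + (i - 1) + (2 * ((\<Sum>j\<le>n. j) - i) + 2 * (\<Sum>j\<le>n. j)) = 2 * (n * (n + 1))"
    using form_prod_except(5)[OF i(3)] sum_degrees i(4) by linarith
  show "at_univ ((T_form i)\<^sup>2) * QV i \<approx> at_univ (T_form (Suc i) * T_form (i - 1))"
    using univ_Q_relation[of n \<gamma> i, OF n \<gamma>] i by (simp add: hom_distribs at_univ_T_form)
qed

text \<open>\<open>U = T\<^sub>1 T\<^bsub>n-1\<^esub> / T\<^sub>n\<close>.\<close>

lemma fraction_U: "fraction (Var Uv)"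
proof (rule fraction_quotient)
  let ?b' = "(\<Prod>j\<in>{..n} - {n}. T_form j) * (\<Prod>j\<le>n. S_form j)"
  show "form (1 + (n - 1)) (T_form 1 * T_form (n - 1))" using n by (intro form_mult form_T_form) auto
  show "form (((\<Sum>j\<le>n. j) - n) + (\<Sum>j\<le>n. j)) ?b'"
    by (intro form_mult form_prod_except form_prod form_S_form) auto
  show "T_form n * ?b' = D_form ^ 1"
    unfolding mult.assoc[symmetric] form_prod_except(2)[OF order_refl] by (simp add: D_form_def)
  show "1 + (n - 1) + ((\<Sum>j\<le>n. j) - n + (\<Sum>j\<le>n. j)) = 1 * (n * (n + 1))"
    using form_prod_except(5)[OF order_refl] sum_degrees n by linarith
  show "at_univ (T_form n) * Var Uv \<approx> at_univ (T_form 1 * T_form (n - 1))"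
    using univ_U_relation[of n \<gamma>, OF n \<gamma>] by (simp add: hom_distribs at_univ_T_form)
qed

lemma fraction_polys_in: "p \<in> P \<Longrightarrow> fraction p"
  by (induction rule: polys_in_induct)
    (auto simp: zQU_vars_def intro: fraction_Const fraction_z fraction_Q fraction_U fraction_add fraction_mult)

text \<open>Specialization of the congruence to a point of \<open>Z\<^sub>\<gamma>\<degree>\<close>; as \<open>G\<close> and \<open>D\<^sup>N\<close> have the same degree, every other
representative of the line may be used as well.\<close>

lemma fraction_peval:
  assumes G: "form (N * (n * (n + 1))) G" "at_univ G \<approx> at_univ D_form ^ N * p"
    and x: "x \<in> Z" and q: "res q = res (smult k (delta x))"
  shows "peval (c_coords q) G = peval (c_coords q) D_form ^ N * ev x p"
proof -
  interpret ev: comm_ring_hom "ev x" by (rule point_eval_hom)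
  have "ev x (at_univ G) = ev x (at_univ D_form) ^ N * ev x p"
    using zQ_cong_point_eval[OF x G(2)] by (simp add: hom_distribs)
  then have "peval (c_coords (delta x)) G = peval (c_coords (delta x)) D_form ^ N * ev x p"
    by (simp add: ev_at_univ[OF G(1)] ev_at_univ[OF form_D_form])
  then show ?thesis
    unfolding peval_form_smult[OF G(1) q] peval_form_smult[OF form_D_form q]
    by (simp add: power_mult_distrib mult.commute flip: power_mult)
qed

text \<open>The ideal contains every polynomial that vanishes on \<open>Z\<^sub>\<gamma>\<degree>\<close>: the numerator \<open>G\<close> vanishes wherever \<open>D\<close> does not,
so \<open>G D\<close> is the zero polynomial, also at the universal point, where \<open>D\<close> is a unit.\<close>

lemma vanishing_imp_cong_0:
  assumes p: "p \<in> P" and van: "\<And>x. x \<in> Z \<Longrightarrow> ev x p = 0"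
  shows "p \<approx> 0"
proof -
  obtain N G where G: "form (N * (n * (n + 1))) G" "at_univ G \<approx> at_univ D_form ^ N * p"
    using fraction_polys_in[OF p] unfolding fraction_def by blast
  have form: "form (N * (n * (n + 1)) + n * (n + 1)) (G * D_form)" using G(1) form_D_form by (rule form_mult)
  have "peval x (G * D_form) = 0" for x
  proof -
    have "vec n x \<in> c ` carrier (O_alg n \<gamma>)" using c_bij[OF n0 c] by (simp add: bij_betw_def)
    then obtain q where q: "c (res q) = vec n x" by (auto simp: O_alg_carrier)
    have "peval x (G * D_form) = peval (c_coords q) (G * D_form)"
      by (rule peval_form_cong[OF form]) (simp add: c_coords_def q)
    also have "\<dots> = 0"
    proof (cases "admissible q")
      case True
      then obtain y k where y: "y \<in> Z" "res q = res (smult k (delta y))"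
        by (rule admissible_obtain_point)
      interpret peval: comm_ring_hom "peval (c_coords q)" by (rule peval_hom)
      show ?thesis using fraction_peval[OF G y] van[OF y(1)] by (simp add: hom_distribs)
    next
      case False
      interpret peval: comm_ring_hom "peval (c_coords q)" by (rule peval_hom)
      show ?thesis using False by (simp add: admissible_iff_D_form hom_distribs)
    qed
    finally show ?thesis .
  qed
  then have "G * D_form = 0" using form by (intro cpoly_vanishing_imp_zero) (auto simp: form_def)
  then have "at_univ (G * D_form) = at_univ 0" by (simp only:)
  then have "at_univ G * at_univ D_form = 0" by (simp only: at_univ.hom_mult at_univ.hom_zero)
  then have "at_univ D_form ^ Suc N * p = at_univ D_form ^ Suc N * p - at_univ G * at_univ D_form" by simp
  also have "\<dots> = (at_univ D_form ^ N * p - at_univ G) * at_univ D_form" by (simp add: algebra_simps)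
  also have "\<dots> \<approx> (at_univ D_form ^ N * p - at_univ D_form ^ N * p) * at_univ D_form"
    by (intro zQ_cong.mult zQ_cong.diff G(2) zQ_cong.refl)
  finally have "at_univ D_form ^ Suc N * p \<approx> at_univ D_form ^ Suc N * 0" by simp
  moreover have "zQ_cong.unit n \<gamma> (at_univ D_form ^ Suc N)"
    by (induction N) (auto intro: zQ_cong.unit_mult unit_at_univ_D_form)
  ultimately show ?thesis using zQ_cong.unit_cancel by blast
qed

section \<open>The isomorphism of coordinate rings\<close>

text \<open>The function on \<open>Y\<^sub>\<gamma>\<degree>\<close> that corresponds to \<open>p\<close> under the bijection \<open>\<alpha>\<close>.\<close>

definition regular_fun :: "zQ_var cpoly \<Rightarrow> complex poly set set \<Rightarrow> complex" where
  "regular_fun p = restrict (\<lambda>y. ev (the_inv_into Z (\<alpha> n \<gamma>) y) p) Y"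

lemma regular_fun_\<alpha>: "x \<in> Z \<Longrightarrow> regular_fun p (\<alpha> n \<gamma> x) = ev x p"
  by (simp add: regular_fun_def \<alpha>_in_Yo the_inv_into_f_f[OF \<alpha>_inj])

lemma regular_fun_eqI:
  assumes "g \<in> extensional Y" "\<And>x. x \<in> Z \<Longrightarrow> g (\<alpha> n \<gamma> x) = ev x p" shows "g = regular_fun p"
proof (rule extensionalityI[OF assms(1)])
  show "regular_fun p \<in> extensional Y" by (simp add: regular_fun_def)
  fix y assume "y \<in> Y"
  then have "y \<in> \<alpha> n \<gamma> ` Z" using \<alpha>_bij by (simp add: bij_betw_def)
  then obtain x where "x \<in> Z" "y = \<alpha> n \<gamma> x" by blast
  then show "g y = regular_fun p y" by (simp add: regular_fun_\<alpha> assms(2))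
qed

lemma regular_fun_in_Yo_functions:
  assumes "p \<in> P" shows "regular_fun p \<in> Yo_functions n \<gamma> c"
proof -
  obtain N G where G: "form (N * (n * (n + 1))) G" "at_univ G \<approx> at_univ D_form ^ N * p"
    using fraction_polys_in[OF assms] unfolding fraction_def by blast
  define d where "d = ((det (c_matrix n \<gamma> c))\<^sup>2) ^ n"
  have d: "d \<noteq> 0" using det_c_matrix[OF n0 c] by (simp add: d_def)
  let ?G = "Const (d ^ N) * G"
  have "regular_fun p (line n \<gamma> \<phi>) = peval (\<lambda>j. c \<phi> $ j) ?G / (\<Prod>i\<in>{1..n}. T n \<gamma> c i \<phi> * S n \<gamma> c i \<phi>) ^ N"
    if \<phi>: "\<phi> \<in> carrier (O_alg n \<gamma>)" "line n \<gamma> \<phi> \<in> Y" for \<phi>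
  proof -
    obtain q where q: "\<phi> = res q" using \<phi>(1) by (auto simp: O_alg_carrier)
    then have admissible: "admissible q" using \<phi>(2) by (simp add: Yo_iff)
    then obtain x k where x: "x \<in> Z" "k \<noteq> 0" "res q = res (smult k (delta x))"
      by (rule admissible_obtain_point)
    have "line n \<gamma> \<phi> = \<alpha> n \<gamma> x" using x by (simp add: q \<alpha>_eq line_smult)
    then have "regular_fun p (line n \<gamma> \<phi>) = ev x p" using x by (simp add: regular_fun_\<alpha>)
    moreover have "peval (\<lambda>j. c \<phi> $ j) ?G = d ^ N * (peval (c_coords q) D_form ^ N * ev x p)"
    proof -
      interpret peval: comm_ring_hom "peval (c_coords q)" by (rule peval_hom)
      have "peval (c_coords q) (Const a) = a" for a
        by (simp add: peval_eq_eval_via eval_via_Const[OF identity_hom])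
      then have "peval (c_coords q) ?G = d ^ N * (peval (c_coords q) D_form ^ N * ev x p)"
        using fraction_peval[OF G x(1,3)] by (simp add: hom_distribs)
      then show ?thesis by (simp add: c_coords_def[abs_def] q)
    qed
    moreover have "(\<Prod>i\<in>{1..n}. T n \<gamma> c i \<phi> * S n \<gamma> c i \<phi>) = d * peval (c_coords q) D_form"
      unfolding q d_def by (rule T_S_prod)
    ultimately show ?thesis using admissible d by (simp add: admissible_iff_D_form power_mult_distrib)
  qed
  moreover have "?G \<in> polys_in {0..<n}" "homogeneous (N * (n * (n + 1))) ?G"
    using form_Const_mult[OF G(1)] by (simp_all add: form_def)
  moreover have "regular_fun p \<in> extensional Y" by (simp add: regular_fun_def)
  ultimately show ?thesis unfolding Yo_functions_def by blast
qed

text \<open>Evaluate \<open>G / D\<^sup>N\<close> at the representative \<open>\<Delta>\<^sub>1\<^sub>1\<close>: the result is a polynomial in \<open>z\<close>, \<open>Q\<close> and \<open>U\<close>, because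
\<open>D\<close> has a polynomial inverse \<open>D'\<close> modulo the ideal.\<close>

lemma Yo_functions_is_regular_fun:
  assumes "g \<in> Yo_functions n \<gamma> c" shows "\<exists>p\<in>P. g = regular_fun p"
proof -
  obtain N G where g: "g \<in> extensional Y" and G: "G \<in> polys_in {0..<n}" "homogeneous (N * (n * (n + 1))) G"
    and eq: "\<And>\<phi>. \<phi> \<in> carrier (O_alg n \<gamma>) \<Longrightarrow> line n \<gamma> \<phi> \<in> Y \<Longrightarrow>
      g (line n \<gamma> \<phi>) = peval (\<lambda>j. c \<phi> $ j) G / (\<Prod>i\<in>{1..n}. T n \<gamma> c i \<phi> * S n \<gamma> c i \<phi>) ^ N"
    using assms unfolding Yo_functions_def by blast
  have form: "form (N * (n * (n + 1))) G" using G by (simp add: form_def)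
  define d where "d = ((det (c_matrix n \<gamma> c))\<^sup>2) ^ n"
  obtain D' where D': "at_univ D_form * D' \<approx> 1" using unit_at_univ_D_form unfolding zQ_cong.unit_def by blast
  define p where "p = restrict_vars n (at_univ G * (Const (1 / d) * D') ^ N)"
  have "g (\<alpha> n \<gamma> x) = ev x p" if x: "x \<in> Z" for x
  proof -
    interpret ev: comm_ring_hom "ev x" by (rule point_eval_hom)
    let ?w = "delta x"
    have "ev x (at_univ D_form) * ev x D' = 1"
      using zQ_cong_point_eval[OF x D'] by (simp add: hom_distribs)
    then have inv: "ev x D' = 1 / peval (c_coords ?w) D_form"
      by (simp add: ev_at_univ[OF form_D_form] eq_divide_eq mult.commute) auto
    have "g (\<alpha> n \<gamma> x) = peval (c_coords ?w) G / (d * peval (c_coords ?w) D_form) ^ N"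
      using eq[of "res ?w"] \<alpha>_in_Yo[OF x] T_S_prod[of ?w]
      by (simp add: \<alpha>_eq O_alg_carrier d_def c_coords_def[abs_def])
    also have "\<dots> = ev x (at_univ G) * (1 / d * ev x D') ^ N"
      by (simp add: ev_at_univ[OF form] inv power_divide power_mult_distrib)
    also have "\<dots> = ev x p"
      by (simp add: p_def point_eval_restrict_vars hom_distribs point_eval_Const)
    finally show ?thesis .
  qed
  then have "g = regular_fun p" by (rule regular_fun_eqI[OF g])
  moreover have "p \<in> P" unfolding p_def by (rule restrict_vars_polys_in)
  ultimately show ?thesis by blast
qed

lemma Yo_functions_eq: "Yo_functions n \<gamma> c = regular_fun ` P"
  using regular_fun_in_Yo_functions Yo_functions_is_regular_fun by blast

lemma regular_fun_eq_iff:
  assumes "p \<in> P" "q \<in> P" shows "regular_fun p = regular_fun q \<longleftrightarrow> p - q \<in> I"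
proof
  assume eq: "regular_fun p = regular_fun q"
  have "ev x (p - q) = 0" if "x \<in> Z" for x
  proof -
    interpret ev: comm_ring_hom "ev x" by (rule point_eval_hom)
    show ?thesis using arg_cong[OF eq, of "\<lambda>g. g (\<alpha> n \<gamma> x)"] that by (simp add: regular_fun_\<alpha> hom_distribs)
  qed
  then have "p - q \<approx> 0" using assms by (intro vanishing_imp_cong_0 polys_in_diff)
  then show "p - q \<in> I" using assms by (simp add: zQ_cong_polys_in polys_in_diff polys_in_0)
next
  assume "p - q \<in> I"
  then have "p \<approx> q" using assms by (simp add: zQ_cong_polys_in)
  then show "regular_fun p = regular_fun q"
    using zQ_cong_point_eval[of _ n \<gamma> p q] by (intro regular_fun_eqI) (simp add: regular_fun_def, simp add: regular_fun_\<alpha>)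
qed

definition zQ_class :: "zQ_var cpoly \<Rightarrow> zQ_var cpoly set" where
  "zQ_class p = I +>\<^bsub>zQU_ring n\<^esub> p"

lemma zQ_class_hom:
  assumes "p \<in> P" "q \<in> P"
  shows "zQ_class p \<otimes>\<^bsub>zQU_ring n Quot I\<^esub> zQ_class q = zQ_class (p * q)"
    and "zQ_class p \<oplus>\<^bsub>zQU_ring n Quot I\<^esub> zQ_class q = zQ_class (p + q)"
    and "\<one>\<^bsub>zQU_ring n Quot I\<^esub> = zQ_class 1"
  unfolding zQ_class_def zQU_ring_eq
  by (rule ring_on_Quot_hom[OF polys_in_cring Zo_ideal_ideal assms])+

text \<open>The class is independent of the choice by \<open>regular_fun_eq_iff\<close>.\<close>

definition comorphism :: "(complex poly set set \<Rightarrow> complex) \<Rightarrow> zQ_var cpoly set" where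
  "comorphism g = zQ_class (SOME p. p \<in> P \<and> regular_fun p = g)"

lemma zQ_class_eq_iff:
  assumes "p \<in> P" "q \<in> P" shows "zQ_class p = zQ_class q \<longleftrightarrow> regular_fun p = regular_fun q"
  unfolding regular_fun_eq_iff[OF assms] zQ_class_def zQU_ring_eq
  using ring_on_coset_eq_iff[OF polys_in_cring Zo_ideal_ideal assms] .

lemma comorphism_regular_fun:
  assumes "p \<in> P" shows "comorphism (regular_fun p) = zQ_class p"
proof -
  have "(SOME q. q \<in> P \<and> regular_fun q = regular_fun p) \<in> P \<and> regular_fun (SOME q. q \<in> P \<and> regular_fun q = regular_fun p) = regular_fun p"
    using assms by (intro someI[of "\<lambda>q. q \<in> P \<and> regular_fun q = regular_fun p" p]) simp
  then show ?thesis using assms unfolding comorphism_def by (simp add: zQ_class_eq_iff)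
qed

lemma regular_fun_ring:
  "restrict (\<lambda>y. regular_fun p y * regular_fun q y) Y = regular_fun (p * q)"
  "restrict (\<lambda>y. regular_fun p y + regular_fun q y) Y = regular_fun (p + q)"
  "restrict (\<lambda>y. k) Y = regular_fun (Const k)"
  "restrict (\<lambda>y. 1) Y = regular_fun 1"
proof -
  interpret ev: comm_ring_hom "ev x" for x by (rule point_eval_hom)
  show "restrict (\<lambda>y. regular_fun p y * regular_fun q y) Y = regular_fun (p * q)"
    "restrict (\<lambda>y. regular_fun p y + regular_fun q y) Y = regular_fun (p + q)"
    "restrict (\<lambda>y. k) Y = regular_fun (Const k)" "restrict (\<lambda>y. 1) Y = regular_fun 1"
    by (rule regular_fun_eqI; simp add: \<alpha>_in_Yo regular_fun_\<alpha> hom_distribs point_eval_Const)+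
qed

lemma val_zQ_class:
  assumes x: "x \<in> Z" and p: "p \<in> P"
  shows "the_elem (peval (zQU_assignment n x) ` zQ_class p) = ev x p"
proof -
  interpret ev: comm_ring_hom "ev x" by (rule point_eval_hom)
  have IP: "i \<in> P" if "i \<in> I" for i using that Zo_ideal_closed(1) by blast
  have "peval (zQU_assignment n x) (i + p) = ev x p" if "i \<in> I" for i
    using Zo_ideal_vanishes[OF x that] IP[OF that] p
    by (simp add: hom_distribs polys_in_add flip: point_eval_polys_in)
  then have "peval (zQU_assignment n x) ` zQ_class p = {ev x p}"
    unfolding zQ_class_def zQU_ring_eq ring_on_coset[OF polys_in_cring Zo_ideal_ideal]
    using Zo_ideal_closed(2) by (auto simp: image_image)
  then show ?thesis by simp
qed

lemma comorphism_iso: "comorphism \<in> ring_iso (coord_ring (Yo_variety n \<gamma> c)) (coord_ring (Zo_variety n \<gamma>))"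
proof -
  let ?R = "coord_ring (Yo_variety n \<gamma> c)" and ?S = "zQU_ring n Quot I"
  have carrier: "carrier ?R = regular_fun ` P" by (simp add: Yo_variety_def Yo_functions_eq)
  have carrier_S: "carrier ?S = zQ_class ` P"
    using ring_on_Quot_carrier[OF polys_in_cring Zo_ideal_ideal, of n \<gamma>]
    by (simp add: zQU_ring_eq zQ_class_def[abs_def])
  have "comorphism \<in> Ring.ring_hom ?R ?S"
  proof (rule ring_hom_memI)
    fix g h assume "g \<in> carrier ?R"
    then obtain p where p: "p \<in> P" "g = regular_fun p" by (auto simp: carrier)
    then show "comorphism g \<in> carrier ?S" by (simp add: comorphism_regular_fun carrier_S)
    assume "h \<in> carrier ?R"
    then obtain q where q: "q \<in> P" "h = regular_fun q" by (auto simp: carrier)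
    show "comorphism (g \<otimes>\<^bsub>?R\<^esub> h) = comorphism g \<otimes>\<^bsub>?S\<^esub> comorphism h"
      using p q by (simp add: Yo_variety_def regular_fun_ring comorphism_regular_fun polys_in_mult zQ_class_hom)
    show "comorphism (g \<oplus>\<^bsub>?R\<^esub> h) = comorphism g \<oplus>\<^bsub>?S\<^esub> comorphism h"
      using p q by (simp add: Yo_variety_def regular_fun_ring comorphism_regular_fun polys_in_add zQ_class_hom)
  next
    show "comorphism \<one>\<^bsub>?R\<^esub> = \<one>\<^bsub>?S\<^esub>"
      using zQ_class_hom(3)[OF polys_in_0 polys_in_0]
      by (simp add: Yo_variety_def regular_fun_ring comorphism_regular_fun polys_in_1)
  qed
  moreover have "bij_betw comorphism (carrier ?R) (carrier ?S)"
    unfolding carrier carrier_S bij_betw_def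
    by (auto simp: inj_on_def comorphism_regular_fun zQ_class_eq_iff image_image)
  ultimately show ?thesis by (simp add: ring_iso_def Zo_variety_def)
qed

lemma isomorphism: "affine_isomorphism (\<alpha> n \<gamma>) (Zo_variety n \<gamma>) (Yo_variety n \<gamma> c)"
  unfolding affine_isomorphism_def
proof (intro conjI bexI[OF _ comorphism_iso] allI ballI)
  show "bij_betw (\<alpha> n \<gamma>) (points (Zo_variety n \<gamma>)) (points (Yo_variety n \<gamma> c))"
    using \<alpha>_bij by (simp add: Zo_variety_def Yo_variety_def)
  show "comorphism (scalar (Yo_variety n \<gamma> c) k) = scalar (Zo_variety n \<gamma>) k" for k
    by (simp add: Yo_variety_def Zo_variety_def regular_fun_ring comorphism_regular_fun polys_in_Const zQ_class_def)
  fix g x assume "g \<in> carrier (coord_ring (Yo_variety n \<gamma> c))" "x \<in> points (Zo_variety n \<gamma>)"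
  then obtain p where "p \<in> P" "g = regular_fun p" "x \<in> Z"
    by (auto simp: Yo_variety_def Zo_variety_def Yo_functions_eq)
  then show "val (Zo_variety n \<gamma>) (comorphism g) x = val (Yo_variety n \<gamma> c) g (\<alpha> n \<gamma> x)"
    by (simp add: Yo_variety_def Zo_variety_def comorphism_regular_fun val_zQ_class regular_fun_\<alpha>)
qed

end

theorem theorem2p4:
  fixes n :: nat and \<gamma> :: "nat \<Rightarrow> complex" and c :: "complex poly set \<Rightarrow> complex vec"
  assumes "n \<ge> 2"
    and "\<gamma> n = 1"
    and "is_linear_iso n \<gamma> c"
  shows "affine_isomorphism (\<alpha> n \<gamma>) (Zo_variety n \<gamma>) (Yo_variety n \<gamma> c)"
proof -
  interpret alpha_setting n \<gamma> c using assms by unfold_locales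
  show ?thesis by (rule isomorphism)
qed

end
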